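(* Let $0$ be a symmetric equilibrium of a smooth $\mathbb{Z}_2^R\times\mathbb{Z}_2^S$ reversible equivariant Hamiltonian vector field $f=J\nabla H$ on the symplectic space $(\mathbb{R}^{2m},\omega)$, where $R$ is a reversing involution acting symplectically and $S$ is an (equivariant) involution acting anti-symplectically. Suppose that $Df(0)$ has two purely imaginary pairs of eigenvalues $\pm i$ with no other eigenvalues of the form $\pm ki$, $k\in\mathbb{Z}$. Let $h=\delta\,g(N,C,D^2,\tau)$ be the reduced Hamiltonian and denote $g_N(0)=n$ and $g_C(0)=c$. Then: (1) There exists a two-parameter family of $R$-symmetric periodic solutions in the conical subspace $\delta=0$, with two of them having extra symmetry $S$. The period of all orbits tends to $2\pi$ as they approach the equilibrium. (2) There exist two Liapunov centre families of $SR$-symmetric periodic solutions in the open subset $\delta\neq0$, provided that $n^2-c^2>0$: one with $\delta>0$ and one with $\delta<0$. These two families are exchanged by both involutions $R$ and $S$.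
   Context: Hamiltonian setting. $\omega(x,y)=\langle x,Jy\rangle$ with $J^*=-J$, $J^2=-I$; $f=J\nabla H$ with $H(0)=0$. The commuting linear involutions $R,S$ are taken orthogonal. $R$ is symplectic ($\omega(Rx,Ry)=\omega(x,y)$) and reversing ($f(Rx)=-Rf(x)$); $S$ is anti-symplectic ($\omega(Sx,Sy)=-\omega(x,y)$) and equivariant ($f(Sx)=Sf(x)$). A $T$-periodic solution $x(t)$ is symmetric under a reversing symmetry $Q$ (such as $R$ or $SR$) if $Qx(\theta-t)=x(t)$ for some $\theta\in\mathbb{R}/T\mathbb{Z}$, and symmetric under $S$ if $Sx(t+\theta)=x(t)$ for some $\theta\in\mathbb{R}/T\mathbb{Z}$. A Liapunov centre family is a one-parameter family of periodic orbits emanating from the equilibrium. Normal form. The linear part $L=Df(0)$ is semisimple on the four-dimensional eigenspace $V\cong\mathbb{C}^2$ for $\pm i$, with coordinates $(z_1,z_2)$ chosen so that $J(z_1,z_2)=(iz_1,iz_2)$, $L(z_1,z_2)=(iz_1,-iz_2)$, $R(z_1,z_2)=(z_2,z_1)$, $S(z_1,z_2)=(\bar z_2,\bar z_1)$. Liapunov-Schmidt reduction. Let $\mathcal{C}_{2\pi}$ (resp. $\mathcal{C}^1_{2\pi}$) be the space of continuous (resp. $C^1$) $2\pi$-periodic $\mathbb{R}^{2m}$-valued functions, and $\Phi:\mathcal{C}^1_{2\pi}\times\mathbb{R}\to\mathcal{C}_{2\pi}$, $\Phi(u,\tau)=(1+\tau)\frac{du}{dt}-f(u)$. Zeros of $\Phi$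 correspond to periodic solutions of $\dot x=f(x)$ of period $2\pi/(1+\tau)$. Let $\mathcal{L}=(d\Phi)_{(0,0)}$; its kernel, and the orthogonal complement of its range, are identified with $\mathbb{C}^2$ by $z\mapsto e^{tL}z$. Let $E$ be the projection onto $\mathrm{range}\,\mathcal{L}$ along $(\mathrm{range}\,\mathcal{L})^\perp$ (complements taken with respect to an inner product invariant under the group generated by time shifts, $R$ and $S$). Solve $E\Phi(v+W(v,\tau),\tau)=0$ near $(0,0)$ for $W(v,\tau)\in(\ker\mathcal{L})^\perp$ by the implicit function theorem, and set $\varphi(v,\tau)=(I-E)\Phi(v+W(v,\tau),\tau)$. Then $\varphi(\cdot,\tau)$ is the Hamiltonian vector field on $\mathbb{C}^2$ of a function $h(\cdot,\tau)$ (the reduced Hamiltonian, $\varphi=J\nabla h$ with real gradient, $h(0,\tau)=0$), invariant under $\theta(z_1,z_2)=(e^{i\theta}z_1,e^{-i\theta}z_2)$ and satisfying $h\circ R=-h$, $h\circ S=-h$. Hence $h=\delta\,g(N,C,D^2,\tau)$ with $g$ smooth, where $$N=|z_1|^2+|z_2|^2,\quad \delta=|z_1|^2-|z_2|^2,\quad C+iD=2z_1z_2,$$ and $g(0)=0$, $\frac{\partial g}{\partial\tau}(0)=\frac12$. Subscripts on $g$ denote partial derivatives. Periodic solutions near $0$ of period near $2\pi$ correspond to zeros $(z,\tau)$ of $\nabla_z h$ near $0$, and $\delta$ is evaluated at the corresponding point $z$ in these reduced coordinates. *)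

theory Defs
  imports "HOL-Analysis.Analysis"
begin

text \<open>Having continuous directional derivatives is the same as being continuously
  (Frechet) differentiable, because the domain is finite-dimensional.\<close>

primrec ck_on :: "nat \<Rightarrow> ('a::euclidean_space \<Rightarrow> 'b::real_normed_vector) \<Rightarrow> 'a set \<Rightarrow> bool" where
  "ck_on 0 f U \<longleftrightarrow> continuous_on U f"
| "ck_on (Suc k) f U \<longleftrightarrow> (\<forall>x\<in>U. f differentiable (at x)) \<and>
     (\<forall>v. ck_on k (\<lambda>x. frechet_derivative f (at x) v) U)"

definition smooth_on :: "('a::euclidean_space \<Rightarrow> 'b::real_normed_vector) \<Rightarrow> 'a set \<Rightarrow> bool" where
  "smooth_on f U \<longleftrightarrow> (\<forall>k. ck_on k f U)"

definition grad :: "('a::euclidean_space \<Rightarrow> real) \<Rightarrow> 'a \<Rightarrow> 'a" where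
  "grad F x = (THE D. GDERIV F x :> D)"

text \<open>The complexification of the real space \<open>'a\<close> is \<open>'a \<times> 'a\<close>, where \<open>(a, b)\<close> stands for
  \<open>a + \<i> b\<close>. The algebraic multiplicity is the complex dimension of the generalized
  eigenspace in the complexification; \<open>dim\<close> is the real dimension, hence the factor 2.\<close>

definition cscale :: "complex \<Rightarrow> 'a::euclidean_space \<times> 'a \<Rightarrow> 'a \<times> 'a" where
  "cscale \<mu> x = (Re \<mu> *\<^sub>R fst x - Im \<mu> *\<^sub>R snd x, Im \<mu> *\<^sub>R fst x + Re \<mu> *\<^sub>R snd x)"

definition complexify :: "('a::euclidean_space \<Rightarrow> 'a) \<Rightarrow> 'a \<times> 'a \<Rightarrow> 'a \<times> 'a" where
  "complexify L x = (L (fst x), L (snd x))"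

definition eigenvalue_of :: "('a::euclidean_space \<Rightarrow> 'a) \<Rightarrow> complex \<Rightarrow> bool" where
  "eigenvalue_of L \<mu> \<longleftrightarrow> (\<exists>x. x \<noteq> 0 \<and> complexify L x = cscale \<mu> x)"

definition alg_mult :: "('a::euclidean_space \<Rightarrow> 'a) \<Rightarrow> complex \<Rightarrow> nat" where
  "alg_mult L \<mu> =
     dim {x. \<exists>k. ((\<lambda>y. complexify L y - cscale \<mu> y) ^^ k) x = 0} div 2"

definition solution_of :: "('a::euclidean_space \<Rightarrow> 'a) \<Rightarrow> (real \<Rightarrow> 'a) \<Rightarrow> bool" where
  "solution_of f x \<longleftrightarrow> (\<forall>t. (x has_vector_derivative f (x t)) (at t))"

text \<open>\<open>T\<close> is the minimal period; in particular equilibria are excluded.\<close>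

definition periodic_solution ::
  "('a::euclidean_space \<Rightarrow> 'a) \<Rightarrow> real \<Rightarrow> (real \<Rightarrow> 'a) \<Rightarrow> bool" where
  "periodic_solution f T x \<longleftrightarrow> solution_of f x \<and> T > 0 \<and> (\<forall>t. x (t + T) = x t) \<and>
     (\<forall>s. 0 < s \<and> s < T \<longrightarrow> (\<exists>t. x (t + s) \<noteq> x t))"

definition reversing_symmetric :: "('a \<Rightarrow> 'a) \<Rightarrow> (real \<Rightarrow> 'a) \<Rightarrow> bool" where
  "reversing_symmetric Q x \<longleftrightarrow> (\<exists>\<theta>. \<forall>t. Q (x (\<theta> - t)) = x t)"

definition equivariant_symmetric :: "('a \<Rightarrow> 'a) \<Rightarrow> (real \<Rightarrow> 'a) \<Rightarrow> bool" where
  "equivariant_symmetric Q x \<longleftrightarrow> (\<exists>\<theta>. \<forall>t. Q (x (t + \<theta>)) = x t)"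

text \<open>A family of periodic orbits with parameter domain \<open>P\<close>; different parameters give
  different orbits, so the dimension of \<open>P\<close> is the number of parameters.\<close>

definition orbit_family ::
  "('a::euclidean_space \<Rightarrow> 'a) \<Rightarrow> ('p::euclidean_space) set \<Rightarrow> ('p \<Rightarrow> real \<Rightarrow> 'a) \<Rightarrow> ('p \<Rightarrow> real) \<Rightarrow> bool"
where
  "orbit_family f P X T \<longleftrightarrow>
     (\<forall>p\<in>P. periodic_solution f (T p) (X p)) \<and>
     continuous_on (P \<times> UNIV) (\<lambda>(p, t). X p t) \<and> continuous_on P T \<and>
     inj_on (\<lambda>p. range (X p)) P"

definition emanates_from_0 ::
  "('p::euclidean_space) set \<Rightarrow> ('p \<Rightarrow> real \<Rightarrow> 'a::euclidean_space) \<Rightarrow> bool" where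
  "emanates_from_0 P X \<longleftrightarrow> uniform_limit UNIV X (\<lambda>_. 0) (at 0 within P)"

definition liapunov_centre_family ::
  "('a::euclidean_space \<Rightarrow> 'a) \<Rightarrow> real \<Rightarrow> (real \<Rightarrow> real \<Rightarrow> 'a) \<Rightarrow> (real \<Rightarrow> real) \<Rightarrow> bool" where
  "liapunov_centre_family f \<epsilon> X T \<longleftrightarrow> \<epsilon> > 0 \<and>
     orbit_family f {0<..<\<epsilon>} X T \<and> emanates_from_0 {0<..<\<epsilon>} X"

definition orbits :: "'p set \<Rightarrow> ('p \<Rightarrow> real \<Rightarrow> 'a) \<Rightarrow> 'a set set" where
  "orbits P X = (\<lambda>p. range (X p)) ` P"

definition exchanges :: "('a \<Rightarrow> 'a) \<Rightarrow> 'a set set \<Rightarrow> 'a set set \<Rightarrow> bool" where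
  "exchanges Q A B \<longleftrightarrow> (\<lambda>M. Q ` M) ` A = B \<and> (\<lambda>M. Q ` M) ` B = A"

type_synonym c2 = "complex \<times> complex"

definition J0 :: "c2 \<Rightarrow> c2" where "J0 z = (\<i> * fst z, \<i> * snd z)"
definition L0 :: "c2 \<Rightarrow> c2" where "L0 z = (\<i> * fst z, - \<i> * snd z)"
definition R0 :: "c2 \<Rightarrow> c2" where "R0 z = (snd z, fst z)"
definition S0 :: "c2 \<Rightarrow> c2" where "S0 z = (cnj (snd z), cnj (fst z))"

definition invN :: "c2 \<Rightarrow> real" where "invN z = (cmod (fst z))\<^sup>2 + (cmod (snd z))\<^sup>2"
definition invdelta :: "c2 \<Rightarrow> real" where "invdelta z = (cmod (fst z))\<^sup>2 - (cmod (snd z))\<^sup>2"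
definition invC :: "c2 \<Rightarrow> real" where "invC z = Re (2 * fst z * snd z)"
definition invD :: "c2 \<Rightarrow> real" where "invD z = Im (2 * fst z * snd z)"

text \<open>\<open>Psi\<close> gives the coordinates \<open>(z\<^sub>1, z\<^sub>2)\<close> on the eigenspace \<open>V = range Psi\<close>. That \<open>J\<close> takes
  the form \<open>J0\<close> in these coordinates is a statement about the symplectic form
  \<open>\<omega>(x, y) = x \<bullet> J y\<close>, which \<open>Psi\<close> pulls back to \<open>z \<bullet> J0 w\<close>: \<open>V\<close> is always a symplectic
  subspace, but need not be invariant under the ambient matrix \<open>J\<close>.\<close>

definition normal_form_coordinates ::
  "('a::euclidean_space \<Rightarrow> 'a) \<Rightarrow> ('a \<Rightarrow> 'a) \<Rightarrow> ('a \<Rightarrow> 'a) \<Rightarrow> ('a \<Rightarrow> 'a) \<Rightarrow> (c2 \<Rightarrow> 'a) \<Rightarrow> bool" where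
  "normal_form_coordinates J L R S Psi \<longleftrightarrow> linear Psi \<and>
     (\<forall>z w. Psi z \<bullet> J (Psi w) = z \<bullet> J0 w) \<and>
     (\<forall>z. L (Psi z) = Psi (L0 z)) \<and> (\<forall>z. R (Psi z) = Psi (R0 z)) \<and> (\<forall>z. S (Psi z) = Psi (S0 z))"

text \<open>The loop \<open>t \<mapsto> e\<^bsup>tL\<^esup> z\<close>, with \<open>e\<^bsup>tL\<^esup>\<close> written out in the coordinates.\<close>

definition lin_loop :: "(c2 \<Rightarrow> 'a) \<Rightarrow> c2 \<Rightarrow> real \<Rightarrow> 'a" where
  "lin_loop Psi z t = Psi (cis t * fst z, cis (- t) * snd z)"

definition loops :: "(real \<Rightarrow> 'a::euclidean_space) set" where
  "loops = {u. continuous_on UNIV u \<and> (\<forall>t. u (t + 2 * pi) = u t)}"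

definition loops1 :: "(real \<Rightarrow> 'a::euclidean_space) set" where
  "loops1 = {u. u C1_differentiable_on UNIV \<and> (\<forall>t. u (t + 2 * pi) = u t)}"

definition c1_norm :: "(real \<Rightarrow> 'a::euclidean_space) \<Rightarrow> real" where
  "c1_norm u = (SUP t. norm (u t)) + (SUP t. norm (vector_derivative u (at t)))"

definition Phi :: "('a::euclidean_space \<Rightarrow> 'a) \<Rightarrow> (real \<Rightarrow> 'a) \<Rightarrow> real \<Rightarrow> real \<Rightarrow> 'a" where
  "Phi f u \<tau> = (\<lambda>t. (1 + \<tau>) *\<^sub>R vector_derivative u (at t) - f (u t))"

text \<open>The derivative of \<open>Phi f\<close> with respect to \<open>u\<close> at \<open>u = 0\<close>, \<open>\<tau> = 0\<close>, where \<open>L = Df(0)\<close>.\<close>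

definition lin_Phi :: "('a::euclidean_space \<Rightarrow> 'a) \<Rightarrow> (real \<Rightarrow> 'a) \<Rightarrow> real \<Rightarrow> 'a" where
  "lin_Phi L u = (\<lambda>t. vector_derivative u (at t) - L (u t))"

definition ker_Phi :: "('a::euclidean_space \<Rightarrow> 'a) \<Rightarrow> (real \<Rightarrow> 'a) set" where
  "ker_Phi L = {u \<in> loops1. lin_Phi L u = (\<lambda>_. 0)}"

definition range_Phi :: "('a::euclidean_space \<Rightarrow> 'a) \<Rightarrow> (real \<Rightarrow> 'a) set" where
  "range_Phi L = lin_Phi L ` loops1"

type_synonym 'a loop_form = "(real \<Rightarrow> 'a) \<Rightarrow> (real \<Rightarrow> 'a) \<Rightarrow> real"

definition loop_orth :: "'a::euclidean_space loop_form \<Rightarrow> (real \<Rightarrow> 'a) set \<Rightarrow> (real \<Rightarrow> 'a) set" where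
  "loop_orth ip A = {u \<in> loops. \<forall>v\<in>A. ip u v = 0}"

text \<open>Inner products on the space of loops that are invariant under the group generated by time
  shifts, \<open>R\<close> and \<open>S\<close>. The reversing \<open>R\<close> acts on loops together with time reversal.\<close>

definition invariant_inner ::
  "('a::euclidean_space \<Rightarrow> 'a) \<Rightarrow> ('a \<Rightarrow> 'a) \<Rightarrow> 'a loop_form \<Rightarrow> bool" where
  "invariant_inner R S ip \<longleftrightarrow>
     (\<forall>u\<in>loops. \<forall>v\<in>loops. ip u v = ip v u) \<and>
     (\<forall>u\<in>loops. \<forall>v\<in>loops. \<forall>w\<in>loops. \<forall>a b.
        ip (\<lambda>t. a *\<^sub>R u t + b *\<^sub>R v t) w = a * ip u w + b * ip v w) \<and>
     (\<forall>u\<in>loops. u \<noteq> (\<lambda>_. 0) \<longrightarrow> ip u u > 0) \<and>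
     (\<forall>u\<in>loops. \<forall>v\<in>loops. \<forall>\<theta>. ip (\<lambda>t. u (t + \<theta>)) (\<lambda>t. v (t + \<theta>)) = ip u v) \<and>
     (\<forall>u\<in>loops. \<forall>v\<in>loops. ip (\<lambda>t. R (u (- t))) (\<lambda>t. R (v (- t))) = ip u v) \<and>
     (\<forall>u\<in>loops. \<forall>v\<in>loops. ip (\<lambda>t. S (u t)) (\<lambda>t. S (v t)) = ip u v)"

definition range_proj ::
  "('a::euclidean_space \<Rightarrow> 'a) \<Rightarrow> 'a loop_form \<Rightarrow> (real \<Rightarrow> 'a) \<Rightarrow> real \<Rightarrow> 'a" where
  "range_proj L ip u =
     (THE r. r \<in> range_Phi L \<and> (\<lambda>t. u t - r t) \<in> loop_orth ip (range_Phi L))"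

text \<open>\<open>W\<close> is the solution furnished by the implicit function theorem on the neighbourhood \<open>U\<close> of
  \<open>(0, 0)\<close>: the unique solution \<open>w\<close> in a small \<open>C\<^sup>1\<close>-ball of \<open>(ker)\<^sup>\<bottom>\<close>, depending continuously
  on \<open>(z, \<tau>)\<close>.\<close>

definition implicit_solution ::
  "('a::euclidean_space \<Rightarrow> 'a) \<Rightarrow> ('a \<Rightarrow> 'a) \<Rightarrow> 'a loop_form \<Rightarrow> (c2 \<Rightarrow> 'a) \<Rightarrow>
   (c2 \<times> real) set \<Rightarrow> (c2 \<Rightarrow> real \<Rightarrow> real \<Rightarrow> 'a) \<Rightarrow> bool" where
  "implicit_solution f L ip Psi U W \<longleftrightarrow> open U \<and> (0, 0) \<in> U \<and>
     (\<exists>r>0. \<forall>(z, \<tau>)\<in>U. \<forall>w.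
        w = W z \<tau> \<longleftrightarrow>
        w \<in> loops1 \<and> w \<in> loop_orth ip (ker_Phi L) \<and> c1_norm w < r \<and>
        range_proj L ip (Phi f (\<lambda>t. lin_loop Psi z t + w t) \<tau>) = (\<lambda>_. 0)) \<and>
     (\<forall>(z, \<tau>)\<in>U.
        ((\<lambda>(z', \<tau>'). c1_norm (\<lambda>t. W z' \<tau>' t - W z \<tau> t)) \<longlongrightarrow> 0) (at (z, \<tau>)))"

text \<open>\<open>\<phi>(z, \<tau>)\<close>, read in \<open>\<complex>\<^sup>2\<close> through the identification of the complement of the range.\<close>

definition reduced_field ::
  "('a::euclidean_space \<Rightarrow> 'a) \<Rightarrow> ('a \<Rightarrow> 'a) \<Rightarrow> 'a loop_form \<Rightarrow> (c2 \<Rightarrow> 'a) \<Rightarrow>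
   (c2 \<Rightarrow> real \<Rightarrow> real \<Rightarrow> 'a) \<Rightarrow> c2 \<Rightarrow> real \<Rightarrow> c2" where
  "reduced_field f L ip Psi W z \<tau> =
     (let y = Phi f (\<lambda>t. lin_loop Psi z t + W z \<tau> t) \<tau>
      in THE \<zeta>. lin_loop Psi \<zeta> = (\<lambda>t. y t - range_proj L ip y t))"

definition reduced_hamiltonian ::
  "('a::euclidean_space \<Rightarrow> 'a) \<Rightarrow> ('a \<Rightarrow> 'a) \<Rightarrow> 'a loop_form \<Rightarrow> (c2 \<Rightarrow> 'a) \<Rightarrow>
   (c2 \<times> real) set \<Rightarrow> (c2 \<Rightarrow> real \<Rightarrow> real \<Rightarrow> 'a) \<Rightarrow> (c2 \<Rightarrow> real \<Rightarrow> real) \<Rightarrow> bool" where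
  "reduced_hamiltonian f L ip Psi U W h \<longleftrightarrow>
     (\<forall>(z, \<tau>)\<in>U. (\<lambda>z. h z \<tau>) differentiable (at z) \<and>
        reduced_field f L ip Psi W z \<tau> = J0 (grad (\<lambda>z. h z \<tau>) z)) \<and>
     (\<forall>\<tau>. (0, \<tau>) \<in> U \<longrightarrow> h 0 \<tau> = 0)"

text \<open>The curve of period \<open>2\<pi> / (1 + \<tau>)\<close> in the phase space that corresponds to \<open>(z, \<tau>)\<close>; it solves
  the differential equation if \<open>(z, \<tau>)\<close> is a zero of the reduced field.\<close>

definition lifted :: "(c2 \<Rightarrow> 'a::euclidean_space) \<Rightarrow> (c2 \<Rightarrow> real \<Rightarrow> real \<Rightarrow> 'a) \<Rightarrow>
   c2 \<Rightarrow> real \<Rightarrow> real \<Rightarrow> 'a" where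
  "lifted Psi W z \<tau> t = lin_loop Psi z ((1 + \<tau>) * t) + W z \<tau> ((1 + \<tau>) * t)"

definition corresponds_on ::
  "(c2 \<Rightarrow> 'a::euclidean_space) \<Rightarrow> (c2 \<times> real) set \<Rightarrow> (c2 \<Rightarrow> real \<Rightarrow> real \<Rightarrow> 'a) \<Rightarrow>
   (c2 \<Rightarrow> real \<Rightarrow> real) \<Rightarrow> 'p set \<Rightarrow> ('p \<Rightarrow> c2) \<Rightarrow> ('p \<Rightarrow> real) \<Rightarrow>
   ('p \<Rightarrow> real \<Rightarrow> 'a) \<Rightarrow> ('p \<Rightarrow> real) \<Rightarrow> bool" where
  "corresponds_on Psi U W h P \<zeta> \<tau> X T \<longleftrightarrow>
     (\<forall>p\<in>P. (\<zeta> p, \<tau> p) \<in> U \<and> grad (\<lambda>z. h z (\<tau> p)) (\<zeta> p) = 0 \<and>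
        X p = lifted Psi W (\<zeta> p) (\<tau> p) \<and> T p = 2 * pi / (1 + \<tau> p))"

end

theory Submission
  imports Defs "HOL-Computational_Algebra.Fundamental_Theorem_Algebra"
begin

text \<open>A loop \<open>y\<close> lies in the range of \<open>d/dt - L\<close> if and only if the average \<open>avg y\<close> over a period of
  \<open>e\<^sup>-\<^sup>t\<^sup>L\<close> times the symplectic projection of \<open>y(t)\<close> to the eigenspace vanishes. This turns the abstract
  projections of the reduction into the explicit operator \<open>avg\<close>; the inner product only enters
  through invariance and positivity.

  The equation for \<open>W\<close> gives \<open>W(z, \<tau>) = o(|z|)\<close>, hence \<open>\<phi>(z, \<tau>) = \<tau> L z + o(|z|)\<close> for every fixed
  small \<open>\<tau>\<close>. Comparing with \<open>h = \<delta> g\<close> yields \<open>g(0, 0, 0, \<tau>) = \<tau>/2\<close>. In the cone \<open>\<delta> = 0\<close> the critical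
  point equation reduces to \<open>g = 0\<close>, which is solved for \<open>\<tau>\<close>. Outside the cone one restricts to real
  points \<open>(a, a k)\<close>, the fixed plane of \<open>SR\<close>; after combining the two equations so that powers
  of \<open>a\<close> can be cancelled, they become at \<open>a = 0\<close> a triangular system for \<open>(k, \<tau>)\<close>, whose first
  equation \<open>2 k n + (1 + k\<^sup>2) c = 0\<close> has a simple root with \<open>|k| < 1\<close> if \<open>n\<^sup>2 > c\<^sup>2\<close>. The remaining
  properties of the periodic orbits follow from the uniqueness of \<open>W\<close>, which makes it equivariant,
  and from the fact that \<open>avg\<close> recovers \<open>z\<close> from a loop.\<close>

section \<open>The flow of a linear vector field\<close>

text \<open>\<open>W\<close> is known only through a uniqueness clause and continuity in the C^1
  norm; no derivative of \<open>W\<close> in (z, \<tau>) is given. The linearization of the reduced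
  field therefore comes from an a priori bound on \<open>W\<close> instead of the chain rule,
  separately for each fixed \<tau>. A second obstacle is that the eigenspace need not be invariant
  under \<open>J\<close>, so the orthogonal projection onto it need not commute with
  \<open>L\<close>; the symplectic one does, because \<open>J \<circ> L\<close> is symmetric. The
  equations outside the cone are combined as follows. At (a, a k) the two real partial derivatives
  of h, divided by 2 a, are \<delta> (g_N + k g_C) + g and \<delta> (k g_N + g_C) - k g, with
  \<delta> = a^2 (1 - k^2). Adding the second to k times the first eliminates g and leaves \<delta>
  times an equation for k; dividing by \<delta> removes the factor that vanishes on the cone.
  Subtracting k times the second from the first leaves an equation in which g has the coefficient 1
  + k^2, and this one determines \<tau>. The condition |k| < 1 on the root is what makes \<delta>
  positive.\<close>

text \<open>The wrapper makes the endomorphisms a Banach algebra, so that the library's exponential applies.\<close>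

typedef (overloaded) 'a endo = "UNIV :: ('a::euclidean_space \<Rightarrow>\<^sub>L 'a) set"
  morphisms blin_of Endo by simp

declare Endo_inverse [OF UNIV_I, simp] blin_of_inverse [simp]

lemma endo_eqI: "blin_of A = blin_of B \<Longrightarrow> A = B"
  by (simp add: blin_of_inject)

instantiation endo :: (euclidean_space) real_normed_vector
begin
definition "0 = Endo 0"
definition "A + B = Endo (blin_of A + blin_of B)"
definition "A - B = Endo (blin_of A - blin_of B)"
definition "- A = Endo (- blin_of A)"
definition "r *\<^sub>R A = Endo (r *\<^sub>R blin_of A)"
definition "norm A = norm (blin_of A)"
definition "sgn A = inverse (norm A) *\<^sub>R A" for A :: "'a endo"
definition "dist A B = norm (A - B)" for A B :: "'a endo"
definition
  "(uniformity :: ('a endo \<times> 'a endo) filter) = (INF e\<in>{0 <..}. principal {(x, y). dist x y < e})"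
definition
  "open (U :: 'a endo set) = (\<forall>x\<in>U. eventually (\<lambda>(x', y). x' = x \<longrightarrow> y \<in> U) uniformity)"
instance
  by standard
    (auto simp: zero_endo_def plus_endo_def minus_endo_def uminus_endo_def scaleR_endo_def
      norm_endo_def sgn_endo_def dist_endo_def uniformity_endo_def open_endo_def algebra_simps
      norm_triangle_ineq
      intro!: endo_eqI)
end

instantiation endo :: (euclidean_space) real_normed_algebra_1
begin
definition "A * B = Endo (blin_of A o\<^sub>L blin_of B)"
definition "1 = Endo id_blinfun"
instance
proof
  fix A B C :: "'a endo" and r :: real
  show "norm (A * B) \<le> norm A * norm B"
    by (simp add: norm_endo_def times_endo_def norm_blinfun_compose)
  show n1: "norm (1 :: 'a endo) = 1"
    by (simp add: norm_endo_def one_endo_def)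
  show "(0::'a endo) \<noteq> 1"
  proof
    assume "(0::'a endo) = 1"
    then have "norm (0::'a endo) = 1" using n1 by simp
    then show False by simp
  qed
qed (auto simp: times_endo_def one_endo_def plus_endo_def scaleR_endo_def
      blinfun.bilinear_simps intro!: endo_eqI blinfun_eqI)
end

lemma dist_endo: "dist A B = dist (blin_of A) (blin_of B)"
  by (simp add: dist_endo_def minus_endo_def norm_endo_def dist_norm)

instance endo :: (euclidean_space) banach
proof
  fix X :: "nat \<Rightarrow> 'a endo"
  assume "Cauchy X"
  then have "Cauchy (\<lambda>n. blin_of (X n))"
    by (simp add: Cauchy_def dist_endo)
  then obtain l where "(\<lambda>n. blin_of (X n)) \<longlonglongrightarrow> l"
    using Cauchy_convergent convergent_def by blast
  then have "X \<longlonglongrightarrow> Endo l"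
    by (simp add: tendsto_iff dist_endo)
  then show "convergent X"
    by (auto simp: convergent_def)
qed

text \<open>This is e^(tL). It is linear in \<open>x\<close> for every \<open>L\<close>, but
  \<open>Blinfun L\<close> represents \<open>L\<close> only if \<open>L\<close> is linear, hence the
  linearity assumption in the derivative rules below.\<close>

definition flow :: "('a::euclidean_space \<Rightarrow> 'a) \<Rightarrow> real \<Rightarrow> 'a \<Rightarrow> 'a" where
  "flow L t x = blin_of (exp (t *\<^sub>R Endo (Blinfun L))) x"

lemma bounded_linear_blin_of: "bounded_linear blin_of"
  by (rule bounded_linear_intro[where K=1])
    (simp_all add: plus_endo_def scaleR_endo_def norm_endo_def)

lemma linear_flow: "linear (flow L t)"
  unfolding flow_def [abs_def] by (rule bounded_linear.linear[OF blinfun.bounded_linear_right])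

lemma flow_0 [simp]: "flow L 0 x = x"
  by (simp add: flow_def one_endo_def)

lemma flow_add: "flow L (s + t) x = flow L s (flow L t x)"
proof -
  have "exp ((s + t) *\<^sub>R Endo (Blinfun L)) = exp (s *\<^sub>R Endo (Blinfun L)) * exp (t *\<^sub>R Endo (Blinfun L))"
    by (simp add: exp_add_commuting scaleR_add_left)
  then show ?thesis by (simp add: flow_def times_endo_def)
qed

lemma flow_inverse [simp]: "flow L (- t) (flow L t x) = x" "flow L t (flow L (- t) x) = x"
  using flow_add[of L "- t" t x] flow_add[of L t "- t" x] by simp_all

lemma flow_generator:
  assumes "linear L"
  shows "flow L t (L x) = L (flow L t x)"
proof -
  have comm: "exp (t *\<^sub>R Endo (Blinfun L)) * Endo (Blinfun L) = Endo (Blinfun L) * exp (t *\<^sub>R Endo (Blinfun L))"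
    by (rule exp_times_scaleR_commute)
  show ?thesis
    using arg_cong[OF comm, of "\<lambda>A. blin_of A x"] assms
    by (simp add: flow_def times_endo_def bounded_linear_Blinfun_apply linear_conv_bounded_linear)
qed

lemma flow_has_vector_derivative:
  assumes L: "linear L" and c: "(c has_vector_derivative c') (at t within A)"
  shows "((\<lambda>t. flow L t (c t)) has_vector_derivative L (flow L t (c t)) + flow L t c') (at t within A)"
proof -
  have E: "((\<lambda>t. exp (t *\<^sub>R Endo (Blinfun L))) has_vector_derivative
      Endo (Blinfun L) * exp (t *\<^sub>R Endo (Blinfun L))) (at t within A)"
    by (rule has_vector_derivative_at_within) (rule exp_scaleR_has_vector_derivative_left)
  have 1: "((\<lambda>t. blin_of (exp (t *\<^sub>R Endo (Blinfun L)))) has_vector_derivative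
      blin_of (Endo (Blinfun L) * exp (t *\<^sub>R Endo (Blinfun L)))) (at t within A)"
    by (rule bounded_linear.has_vector_derivative[OF bounded_linear_blin_of E])
  have "((\<lambda>t. blin_of (exp (t *\<^sub>R Endo (Blinfun L))) (c t)) has_vector_derivative
      blin_of (exp (t *\<^sub>R Endo (Blinfun L))) c' +
      blin_of (Endo (Blinfun L) * exp (t *\<^sub>R Endo (Blinfun L))) (c t)) (at t within A)"
    by (rule bounded_bilinear.has_vector_derivative[OF bounded_bilinear_blinfun_apply 1 c])
  then show ?thesis
    using L by (simp add: flow_def times_endo_def bounded_linear_Blinfun_apply linear_conv_bounded_linear add.commute)
qed

text \<open>The integrating factor makes c' - L c an exact derivative. Uniqueness for linear
  equations, the vanishing of averages on the range and the bound for the inverse of d/dt - L all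
  rest on this identity.\<close>

lemma flow_minus_has_vector_derivative:
  assumes L: "linear L" and c: "(c has_vector_derivative c') (at t)"
  shows "((\<lambda>t. flow L (- t) (c t)) has_vector_derivative flow L (- t) (c' - L (c t))) (at t)"
proof -
  have m: "((\<lambda>s::real. - s) has_vector_derivative - 1) (at x)" for x
    by (auto intro!: derivative_eq_intros)
  have "((\<lambda>s. c (- s)) has_vector_derivative - c') (at (- t))"
    using vector_diff_chain_at[OF m, of c c' "- t"] c by (simp add: o_def)
  then have "((\<lambda>s. flow L s (c (- s))) has_vector_derivative
      L (flow L (- t) (c (- (- t)))) + flow L (- t) (- c')) (at (- t))"
    by (rule flow_has_vector_derivative[OF L])
  from vector_diff_chain_at[OF m this] show ?thesis
    by (simp add: o_def linear_diff[OF linear_flow] linear_neg[OF linear_flow]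
        flow_generator[OF L])
qed

lemma linear_ode_solution:
  assumes L: "linear L" and v: "\<And>t. (v has_vector_derivative L (v t)) (at t)"
  shows "v t = flow L t (v 0)"
proof -
  have "((\<lambda>t. flow L (- t) (v t)) has_vector_derivative 0) (at t)" for t
    using flow_minus_has_vector_derivative[OF L v] by (simp add: linear_0[OF linear_flow])
  then obtain c where "\<And>t. flow L (- t) (v t) = c"
    using has_vector_derivative_zero_constant[of UNIV "\<lambda>t. flow L (- t) (v t)"] by auto
  from this[of t] this[of 0] have "flow L (- t) (v t) = v 0" by simp
  then show ?thesis by (metis flow_inverse(2))
qed

lemma linear_has_vector_derivative:
  fixes A :: "'a::euclidean_space \<Rightarrow> 'b::real_normed_vector"
  assumes "linear A" "(u has_vector_derivative u') F"
  shows "((\<lambda>t. A (u t)) has_vector_derivative A u') F"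
  using bounded_linear.has_vector_derivative[OF assms(1)[unfolded linear_conv_bounded_linear] assms(2)] .

lemma continuous_flow [continuous_intros]:
  assumes "continuous_on A a" "continuous_on A c"
  shows "continuous_on A (\<lambda>t. flow L (a t) (c t))"
proof -
  have "continuous_on UNIV (\<lambda>t. exp (t *\<^sub>R Endo (Blinfun L)))"
    by (intro continuous_at_imp_continuous_on ballI)
      (rule has_vector_derivative_continuous[OF exp_scaleR_has_vector_derivative_left])
  then have "continuous_on A (\<lambda>t. exp (a t *\<^sub>R Endo (Blinfun L)))"
    by (rule continuous_on_compose2[OF _ assms(1)]) simp
  then show ?thesis
    unfolding flow_def using assms(2)
    by (intro continuous_intros bounded_linear.continuous_on[OF bounded_linear_blin_of])
qed

section \<open>Eigenvectors of the complexification and the normal-form rotation\<close>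

lemma cscale_simps [simp]:
  "cscale 0 v = 0" "cscale 1 v = v" "cscale \<mu> 0 = 0"
  by (simp_all add: cscale_def zero_prod_def)

lemma cscale_add: "cscale \<mu> (v + w) = cscale \<mu> v + cscale \<mu> w"
  and cscale_add_left: "cscale (\<mu> + \<nu>) v = cscale \<mu> v + cscale \<nu> v"
  and cscale_cscale: "cscale \<mu> (cscale \<nu> v) = cscale (\<mu> * \<nu>) v"
  by (simp_all add: cscale_def prod_eq_iff algebra_simps)

lemma cscale_of_real: "cscale (of_real r) v = r *\<^sub>R v"
  by (simp add: cscale_def prod_eq_iff)

lemma cscale_eq_0_iff: "cscale \<mu> v = 0 \<longleftrightarrow> \<mu> = 0 \<or> v = 0"
proof
  assume *: "cscale \<mu> v = 0"
  show "\<mu> = 0 \<or> v = 0"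
  proof (cases "\<mu> = 0")
    case False
    then have "v = cscale (inverse \<mu>) (cscale \<mu> v)" by (simp add: cscale_cscale)
    then show ?thesis using * by simp
  qed simp
qed auto

lemma linear_cscale_left: "linear (\<lambda>\<mu>. cscale \<mu> v)"
  by (rule linearI) (simp_all add: cscale_def prod_eq_iff algebra_simps)

lemma linear_complexify: "linear L \<Longrightarrow> linear (complexify L)"
  by (rule linearI) (simp_all add: complexify_def linear_add linear_scale)

lemma complexify_cscale: "linear L \<Longrightarrow> complexify L (cscale \<mu> v) = cscale \<mu> (complexify L v)"
  by (simp add: complexify_def cscale_def linear_add linear_diff linear_scale)

text \<open>Horner's scheme for p(L) v on the complexification. Complex coefficients act through
  \<open>cscale\<close>, so the fundamental theorem of algebra can be applied without giving the
  product type a complex vector space structure.\<close>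

definition poly_apply :: "('a::euclidean_space \<Rightarrow> 'a) \<Rightarrow> complex poly \<Rightarrow> 'a \<times> 'a \<Rightarrow> 'a \<times> 'a" where
  "poly_apply L p v = fold_coeffs (\<lambda>a w. cscale a v + complexify L w) p 0"

lemma poly_apply_0 [simp]: "poly_apply L 0 v = 0"
  by (simp add: poly_apply_def)

lemma poly_apply_pCons:
  assumes "linear L"
  shows "poly_apply L (pCons a p) v = cscale a v + complexify L (poly_apply L p v)"
  by (cases "a = 0 \<and> p = 0") (auto simp: poly_apply_def linear_0[OF linear_complexify[OF assms]])

lemma poly_apply_add:
  assumes "linear L"
  shows "poly_apply L (p + q) v = poly_apply L p v + poly_apply L q v"
  by (induction p q rule: poly_induct2)
    (simp_all add: poly_apply_pCons[OF assms] cscale_add_left linear_add[OF linear_complexify[OF assms]] algebra_simps)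

lemma poly_apply_smult:
  assumes "linear L"
  shows "poly_apply L (smult a p) v = cscale a (poly_apply L p v)"
  by (induction p)
    (simp_all add: poly_apply_pCons[OF assms] cscale_add cscale_cscale complexify_cscale[OF assms])

lemma poly_apply_linear_factor:
  assumes "linear L"
  shows "poly_apply L ([:- \<mu>, 1:] * q) v = complexify L (poly_apply L q v) - cscale \<mu> (poly_apply L q v)"
proof -
  have "cscale (- \<mu>) w = - cscale \<mu> w" for w :: "'a \<times> 'a"
    by (simp add: cscale_def prod_eq_iff)
  moreover have "[:- \<mu>, 1:] * q = pCons 0 q + smult (- \<mu>) q" by simp
  ultimately show ?thesis
    by (simp only: poly_apply_add[OF assms] poly_apply_smult[OF assms] poly_apply_pCons[OF assms])
      simp
qed

lemma poly_apply_monom: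
  assumes "linear L"
  shows "poly_apply L (monom a i) v = cscale a ((complexify L ^^ i) v)"
  by (induction i)
    (simp_all add: monom_0 monom_Suc poly_apply_pCons[OF assms] complexify_cscale[OF assms]
      linear_0[OF linear_complexify[OF assms]])

lemma poly_apply_sum:
  assumes "linear L"
  shows "poly_apply L (sum p A) v = (\<Sum>i\<in>A. poly_apply L (p i) v)"
  by (induction A rule: infinite_finite_induct) (simp_all add: poly_apply_add[OF assms])

text \<open>\<open>dependent\<close> speaks of sets, in which repetitions disappear; two equal
  members of the sequence yield the relation with coefficients 1 and -1 directly.\<close>

lemma dependent_sequence:
  fixes u :: "nat \<Rightarrow> 'b::euclidean_space"
  obtains a :: "nat \<Rightarrow> real" and j where "j \<le> DIM('b)" "a j \<noteq> 0" "(\<Sum>i\<le>DIM('b). a i *\<^sub>R u i) = 0"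
proof (cases "inj_on u {..DIM('b)}")
  case True
  then have "card (u ` {..DIM('b)}) = Suc (DIM('b))" by (simp add: card_image)
  then have "dependent (u ` {..DIM('b)})" by (intro dependent_biggerset) simp_all
  then obtain c v where "v \<in> u ` {..DIM('b)}" "c v \<noteq> 0" "(\<Sum>w\<in>u ` {..DIM('b)}. c w *\<^sub>R w) = 0"
    by (auto simp: real_vector.dependent_finite)
  then show ?thesis
    using that[of _ "c \<circ> u"] True by (auto simp: sum.reindex)
next
  case False
  then obtain i j where ij: "i \<le> DIM('b)" "j \<le> DIM('b)" "i \<noteq> j" "u i = u j"
    by (auto simp: inj_on_def)
  define a :: "nat \<Rightarrow> real" where "a k = (if k = i then 1 else if k = j then - 1 else 0)" for k
  have "(\<Sum>k\<le>DIM('b). a k *\<^sub>R u k) = (\<Sum>k\<in>{i, j}. a k *\<^sub>R u k)"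
    using ij by (intro sum.mono_neutral_right) (auto simp: a_def)
  also have "\<dots> = 0" using ij by (simp add: a_def)
  finally show ?thesis using that[of i a] ij by (simp add: a_def)
qed

text \<open>The iterates of \<open>v\<close> up to the real dimension of the complexification are
  one too many to be independent, and a relation between them is a polynomial. It depends on
  \<open>v\<close>, so neither determinants nor a characteristic polynomial are involved.\<close>

lemma annihilating_poly:
  fixes L :: "'a::euclidean_space \<Rightarrow> 'a"
  assumes "linear L"
  obtains p where "p \<noteq> 0" "poly_apply L p v = 0"
proof -
  obtain a :: "nat \<Rightarrow> real" and j where a: "j \<le> DIM('a \<times> 'a)" "a j \<noteq> 0"
    "(\<Sum>i\<le>DIM('a \<times> 'a). a i *\<^sub>R (complexify L ^^ i) v) = 0"
    by (rule dependent_sequence)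
  define p where "p = (\<Sum>i\<le>DIM('a \<times> 'a). monom (of_real (a i) :: complex) i)"
  have "coeff p j = of_real (a j)"
    using a(1) by (simp add: p_def coeff_sum)
  then have "p \<noteq> 0" using a(2) by auto
  moreover have "poly_apply L p v = 0"
    using a(3) by (simp add: p_def poly_apply_sum[OF assms] poly_apply_monom[OF assms] cscale_of_real)
  ultimately show ?thesis by (rule that)
qed

text \<open>Split a linear factor with root \<mu> off a polynomial that annihilates v. If the
  quotient q still annihilates v, the degree has dropped; otherwise q(L) v is an eigenvector for
  \<mu>. Since \<open>K\<close> is a real subspace, membership is expressed for the real and the
  imaginary part.\<close>

lemma eigenvector_in_invariant_subspace:
  fixes L :: "'a::euclidean_space \<Rightarrow> 'a"
  assumes L: "linear L" and K: "subspace K" and inv: "\<And>x. x \<in> K \<Longrightarrow> L x \<in> K"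
    and x: "x \<in> K" "x \<noteq> 0"
  obtains \<mu> y where "y \<noteq> 0" "fst y \<in> K" "snd y \<in> K" "complexify L y = cscale \<mu> y"
proof -
  have in_K: "poly_apply L p v \<in> K \<times> K" if "v \<in> K \<times> K" for p v
    by (induction p)
      (use K that in \<open>auto simp: poly_apply_pCons[OF L] subspace_0 zero_prod_def cscale_def complexify_def
         intro!: subspace_add subspace_diff subspace_scale inv\<close>)
  have "\<exists>\<mu> y. y \<noteq> 0 \<and> fst y \<in> K \<and> snd y \<in> K \<and> complexify L y = cscale \<mu> y"
    if "degree p = d" "p \<noteq> 0" "v \<in> K \<times> K" "v \<noteq> 0" "poly_apply L p v = 0" for d p v
    using that
  proof (induction d arbitrary: p)
    case 0
    then obtain a where "p = [:a:]" by (meson degree_eq_zeroE)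
    with 0 show ?case
      by (auto simp: poly_apply_pCons[OF L] linear_0[OF linear_complexify[OF L]] cscale_eq_0_iff)
  next
    case (Suc d)
    then have "\<not> constant (poly p)"
      by (simp add: constant_degree)
    then obtain \<mu> where "poly p \<mu> = 0"
      using fundamental_theorem_of_algebra by blast
    then obtain q where q: "p = [:- \<mu>, 1:] * q"
      by (auto simp: poly_eq_0_iff_dvd elim: dvdE)
    with Suc.prems have "q \<noteq> 0" by auto
    have "degree p = degree [:- \<mu>, 1:] + degree q"
      unfolding q using \<open>q \<noteq> 0\<close> by (intro degree_mult_eq) auto
    with Suc.prems have "degree q = d" by simp
    have eq: "complexify L (poly_apply L q v) = cscale \<mu> (poly_apply L q v)"
      using Suc.prems(5) unfolding q poly_apply_linear_factor[OF L] by simp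
    show ?case
    proof (cases "poly_apply L q v = 0")
      case True
      then show ?thesis using Suc.IH \<open>degree q = d\<close> \<open>q \<noteq> 0\<close> Suc.prems by blast
    next
      case False
      then show ?thesis using eq in_K[OF Suc.prems(3), of q] by (metis mem_Times_iff)
    qed
  qed
  moreover obtain p where "p \<noteq> 0" "poly_apply L p (x, 0) = 0"
    by (rule annihilating_poly[OF L])
  moreover have "(x, 0) \<in> K \<times> K" using x K by (simp add: subspace_0)
  ultimately show ?thesis
    using that x by (metis prod.inject zero_prod_def)
qed

text \<open>Both sides solve the same linear equation with the same initial value. The comparison is
  made for \<open>fst\<close> and \<open>snd\<close> separately, because \<open>flow\<close> lives
  on the real space.\<close>

lemma eigenvector_flow:
  assumes L: "linear L" and y: "complexify L y = cscale \<mu> y"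
  shows "cscale (exp (of_real t * \<mu>)) y = (flow L t (fst y), flow L t (snd y))"
proof -
  let ?Y = "\<lambda>t. cscale (exp (of_real t * \<mu>)) y"
  have e: "((\<lambda>t. exp (of_real t * \<mu>)) has_vector_derivative \<mu> * exp (of_real t * \<mu>)) (at t)" for t :: real
    using exp_scaleR_has_vector_derivative_left[of \<mu> t] by (simp add: scaleR_conv_of_real)
  have "(?Y has_vector_derivative cscale (\<mu> * exp (of_real t * \<mu>)) y) (at t)" for t
    by (rule linear_has_vector_derivative[OF linear_cscale_left e])
  moreover have "cscale (\<mu> * exp (of_real t * \<mu>)) y = complexify L (?Y t)" for t
    by (simp add: complexify_cscale[OF L] y cscale_cscale mult.commute)
  ultimately have d: "(?Y has_vector_derivative complexify L (?Y t)) (at t)" for t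
    by simp
  have "P (?Y t) = flow L t (P y)"
    if P: "linear P" "\<And>x. P (complexify L x) = L (P x)" for P :: "'a \<times> 'a \<Rightarrow> 'a"
    using linear_ode_solution[OF L, of "\<lambda>t. P (?Y t)" t] linear_has_vector_derivative[OF P(1) d]
    by (simp add: P(2))
  from this[OF linear_fst] this[OF linear_snd]
  show ?thesis by (simp add: complexify_def prod_eq_iff)
qed

text \<open>This is e^(t L0) in closed form, see \<open>rot_eq_flow\<close>, and at the same time
  the circle action that time shifts of loops induce on the coordinates.\<close>

definition rot :: "real \<Rightarrow> c2 \<Rightarrow> c2" where
  "rot t z = (cis t * fst z, cis (- t) * snd z)"

lemma lin_loop_eq: "lin_loop Psi z t = Psi (rot t z)"
  by (simp add: lin_loop_def rot_def)

lemma rot_add: "rot (s + t) z = rot s (rot t z)"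
  by (simp add: rot_def cis_mult flip: mult.assoc)

lemma rot_0 [simp]: "rot 0 z = z"
  by (simp add: rot_def)

lemma rot_inverse [simp]: "rot (- t) (rot t z) = z" "rot t (rot (- t) z) = z"
  using rot_add[of "- t" t z] rot_add[of t "- t" z] by simp_all

lemma rot_2pi [simp]: "rot (2 * pi) z = z" "rot (- (2 * pi)) z = z"
proof -
  have "cis (2 * pi) = 1" "cis (- (2 * pi)) = 1" by (simp_all add: complex_eq_iff)
  then show "rot (2 * pi) z = z" "rot (- (2 * pi)) z = z" by (simp_all add: rot_def)
qed

lemma norm_rot [simp]: "norm (rot t z) = norm z"
  by (simp add: rot_def norm_prod_def norm_mult)

lemma linear_rot: "linear (rot t)"
  by (rule linearI) (simp_all add: rot_def algebra_simps)

lemma linear_L0: "linear L0"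
  by (rule linearI) (simp_all add: L0_def algebra_simps)

lemma L0_L0 [simp]: "L0 (L0 z) = - z"
  by (simp add: L0_def prod_eq_iff flip: mult.assoc)

lemma rot_has_vector_derivative: "((\<lambda>t. rot t z) has_vector_derivative L0 (rot t z)) (at t)"
  unfolding rot_def L0_def has_vector_derivative_def
  by (auto intro!: derivative_eq_intros simp: algebra_simps)

lemma rot_eq_flow: "rot = flow L0"
proof (intro ext)
  show "rot t z = flow L0 t z" for t z
    using linear_ode_solution[OF linear_L0 rot_has_vector_derivative[where z = z], of t] by simp
qed

lemma continuous_rot [continuous_intros]:
  "continuous_on A a \<Longrightarrow> continuous_on A c \<Longrightarrow> continuous_on A (\<lambda>t. rot (a t) (c t))"
  unfolding rot_eq_flow by (rule continuous_flow)

section \<open>Loops and the resonant part of the spectrum\<close>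

lemma loops_reduce:
  assumes "u \<in> loops"
  obtains s where "s \<in> {0..2*pi}" "u t = u s"
proof -
  have per: "u (t + 2 * pi) = u t" for t using assms by (simp add: loops_def)
  have nat: "u (t + of_nat j * (2 * pi)) = u t" for t j
  proof (induction j)
    case (Suc j)
    have "t + of_nat (Suc j) * (2 * pi) = (t + of_nat j * (2 * pi)) + 2 * pi"
      by (simp add: algebra_simps)
    then show ?case using Suc per by metis
  qed simp
  have int: "u (t + of_int k * (2 * pi)) = u t" for t k
  proof (cases "k \<ge> 0")
    case True
    then show ?thesis using nat[of t "nat k"] by simp
  next
    case False
    then show ?thesis using nat[of "t + of_int k * (2 * pi)" "nat (- k)"] by (simp add: algebra_simps)
  qed
  define k where "k = - \<lfloor>t / (2 * pi)\<rfloor>"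
  have "t + of_int k * (2 * pi) = 2 * pi * frac (t / (2 * pi))"
    by (simp add: k_def frac_def algebra_simps)
  then have "t + of_int k * (2 * pi) \<in> {0..2 * pi}"
    using frac_lt_1[of "t / (2 * pi)"] frac_ge_0[of "t / (2 * pi)"]
    by (simp add: mult_left_le)
  then show ?thesis using that int by metis
qed

lemma loops_bounded:
  assumes "u \<in> loops"
  obtains B where "\<And>t. norm (u t) \<le> B"
proof -
  have "compact (u ` {0..2*pi})"
    using assms by (intro compact_continuous_image) (auto simp: loops_def intro: continuous_on_subset)
  then obtain B where "\<And>t. t \<in> {0..2*pi} \<Longrightarrow> norm (u t) \<le> B"
    by (metis bounded_iff compact_imp_bounded imageI)
  then show ?thesis using that loops_reduce[OF assms] by metis
qed

lemma loops1_has_vector_derivative: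
  assumes "u \<in> loops1"
  shows "(u has_vector_derivative vector_derivative u (at t)) (at t)"
  using assms unfolding loops1_def C1_differentiable_on_eq
  by (auto simp: vector_derivative_works)

lemma loops1_deriv_loops:
  assumes u: "u \<in> loops1"
  shows "(\<lambda>t. vector_derivative u (at t)) \<in> loops"
proof -
  have "vector_derivative u (at (t + 2 * pi)) = vector_derivative u (at t)" for t
  proof -
    have "((\<lambda>s. u (s + 2 * pi)) has_vector_derivative vector_derivative u (at (t + 2 * pi))) (at t)"
    proof -
      have "((\<lambda>s. s + 2 * pi) has_vector_derivative 1) (at t)"
        by (auto intro!: derivative_eq_intros)
      from vector_diff_chain_at[OF this loops1_has_vector_derivative[OF u]] show ?thesis
        by (simp add: o_def)
    qed
    moreover have "(\<lambda>s. u (s + 2 * pi)) = u" using u by (auto simp: loops1_def)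
    ultimately show ?thesis by (metis vector_derivative_at)
  qed
  then show ?thesis
    using u by (auto simp: loops_def loops1_def C1_differentiable_on_eq)
qed

lemma loops1_2pi: "u \<in> loops1 \<Longrightarrow> u (2 * pi) = u 0"
  unfolding loops1_def by (metis (mono_tags, lifting) add_0 mem_Collect_eq)

lemma loops1_subset_loops: "u \<in> loops1 \<Longrightarrow> u \<in> loops"
  by (auto simp: loops_def loops1_def intro: C1_differentiable_imp_continuous_on)

lemma loops1I:
  assumes "\<And>t. (u has_vector_derivative u' t) (at t)" "continuous_on UNIV u'" "\<And>t. u (t + 2 * pi) = u t"
  shows "u \<in> loops1"
  using assms by (auto simp: loops1_def C1_differentiable_on_def)

text \<open>The suprema in \<open>c1_norm\<close> are upper bounds only for bounded functions;
  periodicity and compactness of one period supply the boundedness.\<close>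

lemma norm_le_c1_norm:
  assumes u: "u \<in> loops1"
  shows "norm (u t) \<le> c1_norm u" "norm (vector_derivative u (at t)) \<le> c1_norm u"
proof -
  obtain B where B: "\<And>t. norm (u t) \<le> B" using loops_bounded[OF loops1_subset_loops[OF u]] by blast
  obtain C where C: "\<And>t. norm (vector_derivative u (at t)) \<le> C"
    using loops_bounded[OF loops1_deriv_loops[OF u]] by blast
  have 1: "norm (u t) \<le> (SUP t. norm (u t))" for t
    by (rule cSUP_upper) (auto intro: bdd_aboveI2 B)
  have 2: "norm (vector_derivative u (at t)) \<le> (SUP t. norm (vector_derivative u (at t)))" for t
    by (rule cSUP_upper) (auto intro: bdd_aboveI2 C)
  show "norm (u t) \<le> c1_norm u" "norm (vector_derivative u (at t)) \<le> c1_norm u"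
    using 1[of t] 2[of t] norm_ge_zero[of "u t"] norm_ge_zero[of "vector_derivative u (at t)"]
    unfolding c1_norm_def by linarith+
qed

lemma lin_combo_loops: "u \<in> loops \<Longrightarrow> v \<in> loops \<Longrightarrow> (\<lambda>t. a *\<^sub>R u t + b *\<^sub>R v t) \<in> loops"
  by (auto simp: loops_def intro!: continuous_intros)

lemma diff_loops: "u \<in> loops \<Longrightarrow> v \<in> loops \<Longrightarrow> (\<lambda>t. u t - v t) \<in> loops"
  by (auto simp: loops_def intro!: continuous_intros)

lemma linear_loops: "linear A \<Longrightarrow> u \<in> loops \<Longrightarrow> (\<lambda>t. A (u t)) \<in> loops"
  by (auto simp: loops_def intro: linear_continuous_on_compose)

lemma lin_combo_loops1:
  assumes u: "u \<in> loops1" and v: "v \<in> loops1"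
  shows "(\<lambda>t. a *\<^sub>R u t + b *\<^sub>R v t) \<in> loops1"
    and "vector_derivative (\<lambda>t. a *\<^sub>R u t + b *\<^sub>R v t) (at t) =
      a *\<^sub>R vector_derivative u (at t) + b *\<^sub>R vector_derivative v (at t)"
proof -
  have d: "((\<lambda>t. a *\<^sub>R u t + b *\<^sub>R v t) has_vector_derivative
      a *\<^sub>R vector_derivative u (at t) + b *\<^sub>R vector_derivative v (at t)) (at t)" for t
    by (intro has_vector_derivative_add bounded_linear.has_vector_derivative[OF bounded_linear_scaleR_right]
        loops1_has_vector_derivative u v)
  show "(\<lambda>t. a *\<^sub>R u t + b *\<^sub>R v t) \<in> loops1"
    using loops1_deriv_loops[OF u] loops1_deriv_loops[OF v] u v
    by (intro loops1I[OF d]) (auto simp: loops_def loops1_def intro!: continuous_intros)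
  show "vector_derivative (\<lambda>t. a *\<^sub>R u t + b *\<^sub>R v t) (at t) =
      a *\<^sub>R vector_derivative u (at t) + b *\<^sub>R vector_derivative v (at t)"
    by (rule vector_derivative_at[OF d])
qed

text \<open>\<open>proj\<close> stands for the symplectic projection onto the eigenspace, read in
  coordinates. Keeping it abstract separates the linear theory from the Hamiltonian structure: a
  left inverse of \<open>Psi\<close> that intertwines \<open>L\<close> and \<open>L0\<close> is all
  that is used.\<close>

locale resonant_linear_part =
  fixes L :: "'a::euclidean_space \<Rightarrow> 'a" and Psi :: "c2 \<Rightarrow> 'a" and proj :: "'a \<Rightarrow> c2"
  assumes L: "linear L" and Psi: "linear Psi" and proj: "linear proj"
    and proj_Psi [simp]: "proj (Psi z) = z"
    and L_Psi: "L (Psi z) = Psi (L0 z)" and proj_L: "proj (L x) = L0 (proj x)"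
    and alg_mult_i: "alg_mult L \<i> = 2"
    and eigenvalues: "eigenvalue_of L (of_int k * \<i>) \<Longrightarrow> k = 1 \<or> k = - 1"
begin

lemma flow_Psi: "flow L t (Psi z) = Psi (rot t z)"
  using linear_ode_solution[OF L, of "\<lambda>t. Psi (rot t z)" t]
    linear_has_vector_derivative[OF Psi rot_has_vector_derivative]
  by (simp add: L_Psi)

lemma proj_flow: "proj (flow L t x) = rot t (proj x)"
proof -
  have "((\<lambda>t. proj (flow L t x)) has_vector_derivative L0 (proj (flow L t x))) (at t)" for t
    using linear_has_vector_derivative[OF proj flow_has_vector_derivative[OF L has_vector_derivative_const[of x]]]
    by (simp add: proj_L linear_0[OF linear_flow])
  from linear_ode_solution[OF linear_L0 this] show ?thesis by (simp add: rot_eq_flow)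
qed

text \<open>A dimension count: such a \<open>y\<close> would enlarge the eigenspace of \<i> to
  complex dimension at least 3, against algebraic multiplicity 2.\<close>

lemma no_further_eigenvector_i:
  assumes y: "complexify L y = cscale \<i> y" "proj (fst y) = 0" "proj (snd y) = 0"
  shows "y = 0"
proof (rule ccontr)
  assume "y \<noteq> 0"
  define G where "G = {x. \<exists>k. ((\<lambda>y. complexify L y - cscale \<i> y) ^^ k) x = 0}"
  \<comment> \<open>For real part a = Psi z the eigenvector equation for \<i> forces the imaginary
    part - L a = - Psi (L0 z), and L0^2 = -1 makes this sufficient. The domain has real dimension 4
    + 2 = 6.\<close>
  define F where "F = (\<lambda>(z, \<mu>). (Psi z, - Psi (L0 z)) + cscale \<mu> y)"
  have "linear F"
  proof (rule linearI)
    fix a b r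
    show "F (a + b) = F a + F b"
      by (simp add: F_def split_def cscale_add_left linear_add[OF Psi] linear_add[OF linear_L0])
    show "F (r *\<^sub>R a) = r *\<^sub>R F a"
      by (simp add: F_def split_def linear_scale[OF linear_cscale_left] linear_scale[OF Psi]
          linear_scale[OF linear_L0] scaleR_add_right)
  qed
  have "inj F"
    unfolding linear_injective_0[OF \<open>linear F\<close>]
  proof clarify
    fix z \<mu> assume *: "F (z, \<mu>) = 0"
    then have "proj (fst (F (z, \<mu>))) = 0" by (simp add: linear_0[OF proj])
    then have "z = 0"
      using y by (simp add: F_def cscale_def linear_add[OF proj] linear_diff[OF proj] linear_scale[OF proj])
    then have "cscale \<mu> y = 0"
      using * by (simp add: F_def linear_0[OF Psi] linear_0[OF linear_L0] zero_prod_def[symmetric])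
    then have "\<mu> = 0" using \<open>y \<noteq> 0\<close> by (simp add: cscale_eq_0_iff)
    then show "(z, \<mu>) = 0" using \<open>z = 0\<close> by (simp add: zero_prod_def)
  qed
  have "complexify L (F w) = cscale \<i> (F w)" for w
  proof -
    have "complexify L (Psi z, - Psi (L0 z)) = cscale \<i> (Psi z, - Psi (L0 z))" for z
      by (simp add: complexify_def cscale_def linear_neg[OF L] L_Psi linear_neg[OF Psi])
    then show ?thesis
      by (simp add: F_def split_def linear_add[OF linear_complexify[OF L]] cscale_add
          complexify_cscale[OF L] y cscale_cscale mult.commute)
  qed
  then have "range F \<subseteq> G"
    by (auto simp: G_def intro!: exI[of _ 1])
  then have "dim (range F) \<le> dim G" by (rule dim_subset)
  moreover have "dim (range F) = 6"
    using dim_image_eq[OF \<open>linear F\<close>, of UNIV] \<open>inj F\<close> by simp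
  moreover have "dim G div 2 = 2"
    using alg_mult_i by (simp add: alg_mult_def G_def)
  ultimately show False by simp
qed

text \<open>The component of \<open>x\<close> in the kernel of \<open>proj\<close> generates an
  invariant subspace of points fixed by the time 2 pi map. An eigenvector there satisfies e^(2 pi
  \<mu>) = 1, so \<mu> is an integer multiple of \<i>; non-resonance leaves \<i> and - \<i>, which
  the multiplicity excludes. Passing to an eigenvector avoids any discussion of Jordan
  blocks.\<close>

lemma flow_2pi_fixed:
  assumes "flow L (2 * pi) x = x"
  shows "Psi (proj x) = x"
proof (rule ccontr)
  assume neq: "Psi (proj x) \<noteq> x"
  define K where "K = {x. proj x = 0 \<and> flow L (2 * pi) x = x}"
  have "subspace K"
    by (auto simp: K_def subspace_def linear_0[OF proj] linear_add[OF proj] linear_scale[OF proj]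
        linear_0[OF linear_flow] linear_add[OF linear_flow] linear_scale[OF linear_flow])
  moreover have "L v \<in> K" if "v \<in> K" for v
    using that by (simp add: K_def proj_L linear_0[OF linear_L0] flow_generator[OF L])
  moreover have "x - Psi (proj x) \<in> K"
    using assms by (simp add: K_def linear_diff[OF proj] linear_diff[OF linear_flow] flow_Psi)
  moreover have "x - Psi (proj x) \<noteq> 0" using neq by simp
  ultimately obtain \<mu> y where y: "y \<noteq> 0" "fst y \<in> K" "snd y \<in> K" "complexify L y = cscale \<mu> y"
    using eigenvector_in_invariant_subspace[OF L] by metis
  have "cscale (exp (of_real (2 * pi) * \<mu>)) y = y"
    using eigenvector_flow[OF L y(4), of "2 * pi"] y(2,3) by (simp add: K_def)
  then have "cscale (exp (of_real (2 * pi) * \<mu>) - 1) y = 0"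
    using cscale_add_left[of "exp (of_real (2 * pi) * \<mu>) - 1" 1 y] by simp
  then have "exp (of_real (2 * pi) * \<mu>) = 1"
    using y(1) by (simp add: cscale_eq_0_iff)
  then obtain k :: int where "Re \<mu> = 0" "Im \<mu> = of_int k"
    unfolding exp_eq_1 by auto
  then have \<mu>: "\<mu> = of_int k * \<i>"
    by (simp add: complex_eq_iff)
  then have "eigenvalue_of L (of_int k * \<i>)"
    using y unfolding eigenvalue_of_def by blast
  then consider "\<mu> = \<i>" | "\<mu> = - \<i>"
    using eigenvalues \<mu> by fastforce
  then show False
  proof cases
    case 1
    then show False using no_further_eigenvector_i[of y] y by (simp add: K_def)
  next
    case 2
    \<comment> \<open>Complex conjugation turns an eigenvector for - \<i> into one for \<i>.\<close>
    have "complexify L (fst y, - snd y) = cscale \<i> (fst y, - snd y)"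
      using y(4) 2 by (simp add: complexify_def cscale_def linear_neg[OF L] prod_eq_iff) 
    then have "(fst y, - snd y) = 0"
      using y by (intro no_further_eigenvector_i) (simp_all add: K_def linear_neg[OF proj])
    then show False using y(1) by (simp add: prod_eq_iff)
  qed
qed

lemma flow_minus_2pi_fixed:
  assumes "flow L (- (2 * pi)) x = x"
  shows "Psi (proj x) = x"
  using flow_2pi_fixed assms flow_inverse(2) by metis

end

section \<open>The Fredholm alternative on loops\<close>

lemma norm_flow_le: "norm (flow L s x) \<le> exp (\<bar>s\<bar> * norm (Endo (Blinfun L))) * norm x"
proof -
  have "norm (flow L s x) \<le> norm (exp (s *\<^sub>R Endo (Blinfun L))) * norm x"
    unfolding flow_def norm_endo_def by (rule norm_blinfun)
  also have "\<dots> \<le> exp (\<bar>s\<bar> * norm (Endo (Blinfun L))) * norm x"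
    using norm_exp[of "s *\<^sub>R Endo (Blinfun L)"] by (intro mult_right_mono) simp_all
  finally show ?thesis .
qed

lemma rot_L0: "rot t (L0 z) = L0 (rot t z)"
  by (simp add: L0_def rot_def)

context resonant_linear_part
begin

text \<open>The factor 1 / (2 pi) makes \<open>avg\<close> a left inverse of
  \<open>lin_loop Psi\<close>, see \<open>avg_lin_loop\<close>. The inner product \<open>ip\<close>
  does not occur, so the value can be computed and estimated directly.\<close>

definition avg :: "(real \<Rightarrow> 'a) \<Rightarrow> c2" where
  "avg u = (1 / (2 * pi)) *\<^sub>R integral {0..2*pi} (\<lambda>t. rot (- t) (proj (u t)))"

lemma continuous_avg: "u \<in> loops \<Longrightarrow> continuous_on A (\<lambda>t. rot (- t) (proj (u t)))"
  by (auto simp: loops_def intro!: continuous_intros linear_continuous_on_compose[OF _ proj]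
      intro: continuous_on_subset)

lemma avg_cong: "(\<And>t. u t = v t) \<Longrightarrow> avg u = avg v"
  by (simp add: avg_def)

lemma avg_lin_combo:
  assumes "u \<in> loops" "v \<in> loops"
  shows "avg (\<lambda>t. a *\<^sub>R u t + b *\<^sub>R v t) = a *\<^sub>R avg u + b *\<^sub>R avg v"
proof -
  have int: "(\<lambda>t. c *\<^sub>R rot (- t) (proj (y t))) integrable_on {0..2*pi}" if "y \<in> loops" for c y
    by (intro integrable_continuous_real continuous_on_scaleR continuous_on_const continuous_avg that)
  have "integral {0..2*pi} (\<lambda>t. a *\<^sub>R rot (- t) (proj (u t)) + b *\<^sub>R rot (- t) (proj (v t))) =
      a *\<^sub>R integral {0..2*pi} (\<lambda>t. rot (- t) (proj (u t))) + b *\<^sub>R integral {0..2*pi} (\<lambda>t. rot (- t) (proj (v t)))"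
    using assms by (subst integral_add) (simp_all add: int)
  then show ?thesis
    by (simp add: avg_def linear_add[OF proj] linear_scale[OF proj] linear_add[OF linear_rot]
        linear_scale[OF linear_rot] scaleR_add_right)
qed

lemma avg_lin_loop [simp]: "avg (lin_loop Psi z) = z"
  by (simp add: avg_def lin_loop_eq)

lemma lin_loop_has_vector_derivative:
  "(lin_loop Psi z has_vector_derivative lin_loop Psi (L0 z) t) (at t)"
proof -
  have "((\<lambda>t. Psi (rot t z)) has_vector_derivative Psi (L0 (rot t z))) (at t)"
    by (rule linear_has_vector_derivative[OF Psi rot_has_vector_derivative])
  then show ?thesis by (simp add: lin_loop_eq[abs_def] rot_L0)
qed

lemma vector_derivative_lin_loop [simp]:
  "vector_derivative (lin_loop Psi z) (at t) = lin_loop Psi (L0 z) t"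
  by (rule vector_derivative_at[OF lin_loop_has_vector_derivative])

lemma L_lin_loop: "L (lin_loop Psi z t) = lin_loop Psi (L0 z) t"
  unfolding lin_loop_eq L_Psi rot_L0 ..

lemma lin_loop_add_2pi: "lin_loop Psi z (t + 2 * pi) = lin_loop Psi z t"
  by (simp add: lin_loop_eq rot_add)

lemma lin_loop_cont: "continuous_on UNIV (lin_loop Psi z)"
  unfolding lin_loop_eq[abs_def] by (intro linear_continuous_on_compose[OF _ Psi] continuous_intros)

lemma lin_loop_loops: "lin_loop Psi z \<in> loops"
  using lin_loop_cont by (simp add: loops_def lin_loop_add_2pi)

lemma lin_loop_loops1: "lin_loop Psi z \<in> loops1"
proof (rule loops1I[OF lin_loop_has_vector_derivative lin_loop_cont])
  show "lin_loop Psi z (t + 2 * pi) = lin_loop Psi z t" for t by (rule lin_loop_add_2pi)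
qed

lemma lin_loop_inject [simp]: "lin_loop Psi z = lin_loop Psi w \<longleftrightarrow> z = w"
proof
  assume "lin_loop Psi z = lin_loop Psi w"
  then have "avg (lin_loop Psi z) = avg (lin_loop Psi w)" by (rule arg_cong)
  then show "z = w" by simp
qed (rule arg_cong)

lemma lin_loop_zero [simp]: "lin_loop Psi 0 t = 0"
  by (simp add: lin_loop_eq linear_0[OF Psi] linear_0[OF linear_rot])

lemma lin_loop_linear: "linear (\<lambda>z. lin_loop Psi z t)"
  using linear_compose[OF linear_rot Psi] by (simp add: lin_loop_eq o_def)

lemma lin_Phi_loops: "u \<in> loops1 \<Longrightarrow> lin_Phi L u \<in> loops"
  unfolding lin_Phi_def
  by (rule diff_loops[OF loops1_deriv_loops linear_loops[OF L loops1_subset_loops]])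

text \<open>By the intertwining property of \<open>proj\<close>, the integrand is the derivative of
  the 2 pi periodic function \<open>rot (- t) (proj (u t))\<close>, so its integral over a period
  vanishes.\<close>

lemma avg_lin_Phi:
  assumes u: "u \<in> loops1"
  shows "avg (lin_Phi L u) = 0"
proof -
  have "((\<lambda>t. rot (- t) (proj (u t))) has_vector_derivative rot (- t) (proj (lin_Phi L u t))) (at t)" for t
    unfolding rot_eq_flow
    using flow_minus_has_vector_derivative[OF linear_L0
        linear_has_vector_derivative[OF proj loops1_has_vector_derivative[OF u]]]
    by (simp add: lin_Phi_def linear_diff[OF proj] proj_L)
  then have "((\<lambda>t. rot (- t) (proj (lin_Phi L u t))) has_integral
      rot (- (2 * pi)) (proj (u (2 * pi))) - rot (- 0) (proj (u 0))) {0..2 * pi}"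
    by (intro fundamental_theorem_of_calculus) (auto intro: has_vector_derivative_at_within)
  moreover have "u (2 * pi) = u 0" by (rule loops1_2pi[OF u])
  ultimately show ?thesis by (simp add: avg_def integral_unique)
qed

lemma norm_avg_le:
  obtains K where "K > 0" "\<And>u B. u \<in> loops \<Longrightarrow> (\<And>t. norm (u t) \<le> B) \<Longrightarrow> norm (avg u) \<le> K * B"
proof -
  obtain K where K: "K > 0" "\<And>x. norm (proj x) \<le> K * norm x"
    using linear_bounded_pos[OF proj] by blast
  show ?thesis
  proof (rule that[OF K(1)])
    fix u :: "real \<Rightarrow> 'a" and B assume u: "u \<in> loops" "\<And>t. norm (u t) \<le> B"
    have "norm (integral {0..2*pi} (\<lambda>t. rot (- t) (proj (u t)))) \<le> (K * B) * (2 * pi - 0)"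
    proof (rule integral_bound)
      fix t
      have "norm (proj (u t)) \<le> K * norm (u t)" by (rule K)
      also have "\<dots> \<le> K * B" using K(1) u(2) by (intro mult_left_mono) simp_all
      finally show "norm (rot (- t) (proj (u t))) \<le> K * B" by simp
    qed (auto intro: continuous_avg u)
    then show "norm (avg u) \<le> K * B"
      by (simp add: avg_def field_simps)
  qed
qed

text \<open>Variation of constants: w(t) = e^(tL) (x0 + c(t)), where c is the integral of e^(-sL)
  y(s) from 0 to t. Periodicity amounts to (e^(-2 pi L) - 1) x0 = c(2 pi), and the vanishing average
  puts the right-hand side into the kernel of \<open>proj\<close>, where this operator is
  bijective.\<close>

lemma solve_lin_Phi:
  assumes y: "y \<in> loops" "avg y = 0"
  obtains w where "w \<in> loops1" "lin_Phi L w = y"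
proof -
  have cy: "continuous_on UNIV y" using y by (simp add: loops_def)
  have cont: "continuous_on UNIV (\<lambda>t. flow L (- t) (y t))"
    by (intro continuous_intros cy)
  then have "\<And>t. isCont (\<lambda>t. flow L (- t) (y t)) t"
    by (simp add: continuous_on_eq_continuous_at)
  then obtain F where F: "\<And>t. (F has_vector_derivative flow L (- t) (y t)) (at t)"
    using einterval_antiderivative[of "-\<infinity>" "\<infinity>" "\<lambda>t. flow L (- t) (y t)"] by auto
  define c where "c t = F t - F 0" for t
  have c: "(c has_vector_derivative flow L (- t) (y t)) (at t)" for t
    using has_vector_derivative_diff[OF F has_vector_derivative_const] by (simp add: c_def[abs_def])
  have proj_c: "proj (c (2 * pi)) = 0"
  proof -
    have "((\<lambda>t. proj (c t)) has_vector_derivative rot (- t) (proj (y t))) (at t)" for t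
      using linear_has_vector_derivative[OF proj c]
      by (simp add: proj_flow)
    then have "((\<lambda>t. rot (- t) (proj (y t))) has_integral proj (c (2 * pi)) - proj (c 0)) {0..2 * pi}"
      by (intro fundamental_theorem_of_calculus) (auto intro: has_vector_derivative_at_within)
    then show ?thesis
      using y(2) by (simp add: avg_def integral_unique c_def linear_0[OF proj])
  qed
  \<comment> \<open>On this invariant complement of the eigenspace \<open>g\<close> is injective,
    since a point fixed by the time -2 pi map lies in the range of \<open>Psi\<close>; equality of
    dimensions then gives surjectivity.\<close>
  define V where "V = {x. proj x = 0}"
  define g where "g x = flow L (- (2 * pi)) x - x" for x
  have V: "subspace V"
    by (auto simp: V_def subspace_def linear_0[OF proj] linear_add[OF proj] linear_scale[OF proj])
  have g: "linear g"
    unfolding g_def[abs_def] by (intro linear_compose_sub linear_flow linear_ident)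
  have sub: "g ` V \<subseteq> V"
    by (auto simp: V_def g_def linear_diff[OF proj] proj_flow linear_0[OF linear_rot])
  have "inj_on g V"
    unfolding linear_inj_on_iff_eq_0[OF g V]
  proof (intro ballI impI)
    fix x assume x: "x \<in> V" "g x = 0"
    then have "Psi (proj x) = x" by (intro flow_minus_2pi_fixed) (simp add: g_def)
    then show "x = 0" using x by (simp add: V_def linear_0[OF Psi])
  qed
  then have "dim (g ` V) = dim V"
    using dim_image_eq[OF g, of V] V by (simp add: span_eq_iff[THEN iffD2])
  then have "g ` V = V"
    using sub V by (intro subspace_dim_equal linear_subspace_image g) simp_all
  then obtain x0 where x0: "g x0 = c (2 * pi)"
    using proj_c by (force simp: V_def)
  define w where "w t = flow L t (x0 + c t)" for t
  have w: "(w has_vector_derivative L (w t) + y t) (at t)" for t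
  proof -
    have "((\<lambda>t. x0 + c t) has_vector_derivative flow L (- t) (y t)) (at t)"
      using has_vector_derivative_add[OF has_vector_derivative_const c] by simp
    from flow_has_vector_derivative[OF L this] show ?thesis
      by (simp add: w_def[abs_def])
  qed
  have per: "w (t + 2 * pi) = w t" for t
  proof -
    \<comment> \<open>The defect of periodicity solves the homogeneous equation, so it suffices that
      it vanishes at time 0, which is how \<open>x0\<close> was chosen.\<close>
    define v where "v t = w (t + 2 * pi) - w t" for t
    have "((\<lambda>t. w (t + 2 * pi)) has_vector_derivative L (w (t + 2 * pi)) + y t) (at t)" for t
    proof -
      have "((\<lambda>t. t + 2 * pi) has_vector_derivative 1) (at t)"
        by (auto intro!: derivative_eq_intros)
      from vector_diff_chain_at[OF this w] show ?thesis
        using y by (simp add: o_def loops_def)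
    qed
    from has_vector_derivative_diff[OF this w]
    have "(v has_vector_derivative L (v t)) (at t)" for t
      by (simp add: v_def[abs_def] linear_diff[OF L])
    from linear_ode_solution[OF L this] have v: "v t = flow L t (v 0)" .
    have "v 0 = 0"
    proof -
      have "x0 + c (2 * pi) = flow L (- (2 * pi)) x0" using x0 by (simp add: g_def algebra_simps)
      then have "w (2 * pi) = x0" by (simp add: w_def)
      then show ?thesis by (simp add: v_def w_def c_def)
    qed
    then have "v t = 0" using v by (simp add: linear_0[OF linear_flow])
    then show ?thesis by (simp add: v_def)
  qed
  have "continuous_on UNIV w"
    using w by (auto intro: continuous_at_imp_continuous_on has_vector_derivative_continuous)
  then have "w \<in> loops1"
    by (intro loops1I[OF w] continuous_intros cy linear_continuous_on_compose[OF _ L] per)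
  moreover have "lin_Phi L w = y"
    using vector_derivative_at[OF w] by (auto simp: lin_Phi_def)
  ultimately show ?thesis by (rule that)
qed

lemma range_Phi_eq: "range_Phi L = {y \<in> loops. avg y = 0}"
proof -
  have "y \<in> lin_Phi L ` loops1" if "y \<in> loops" "avg y = 0" for y
    by (rule solve_lin_Phi[OF that]) auto
  then show ?thesis
    by (auto simp: range_Phi_def avg_lin_Phi lin_Phi_loops)
qed

lemma ker_Phi_eq: "ker_Phi L = range (lin_loop Psi)"
proof
  show "range (lin_loop Psi) \<subseteq> ker_Phi L"
  proof -
    have "lin_loop Psi z \<in> ker_Phi L" for z
      unfolding ker_Phi_def
    proof (intro CollectI conjI lin_loop_loops1 ext)
      show "lin_Phi L (lin_loop Psi z) t = 0" for t by (simp add: lin_Phi_def L_lin_loop)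
    qed
    then show ?thesis by blast
  qed
  show "ker_Phi L \<subseteq> range (lin_loop Psi)"
  proof
    fix u assume u: "u \<in> ker_Phi L"
    then have u1: "u \<in> loops1" by (simp add: ker_Phi_def)
    have "vector_derivative u (at t) = L (u t)" for t
    proof -
      have "lin_Phi L u t = 0" using u by (simp add: ker_Phi_def)
      then show ?thesis by (simp add: lin_Phi_def)
    qed
    with loops1_has_vector_derivative[OF u1]
    have "(u has_vector_derivative L (u t)) (at t)" for t by metis
    from linear_ode_solution[OF L this] have ut: "u t = flow L t (u 0)" for t .
    have "u (2 * pi) = u 0" by (rule loops1_2pi[OF u1])
    then have "flow L (2 * pi) (u 0) = u 0" using ut by metis
    then have "Psi (proj (u 0)) = u 0" by (rule flow_2pi_fixed)
    then have "u t = lin_loop Psi (proj (u 0)) t" for t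
      using ut[of t] flow_Psi[of t "proj (u 0)"] by (simp add: lin_loop_eq)
    then show "u \<in> range (lin_loop Psi)" by blast
  qed
qed


text \<open>A quantitative form of the inverse of d/dt - L on loops of vanishing average. The
  variation of constants formula bounds everything except the initial value, and that one is
  controlled by periodicity together with \<open>avg w = 0\<close>.\<close>

lemma lin_Phi_bounded_below:
  obtains K where "K > 0"
    "\<And>w B t. w \<in> loops1 \<Longrightarrow> avg w = 0 \<Longrightarrow> (\<And>t. norm (lin_Phi L w t) \<le> B) \<Longrightarrow>
      norm (w t) \<le> K * B \<and> norm (vector_derivative w (at t)) \<le> K * B"
proof -
  define M where "M = exp (2 * pi * norm (Endo (Blinfun L)))"
  have M: "norm (flow L s x) \<le> M * norm x" if "\<bar>s\<bar> \<le> 2 * pi" for s x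
  proof -
    have "exp (\<bar>s\<bar> * norm (Endo (Blinfun L))) * norm x \<le> M * norm x"
      unfolding M_def using that by (intro mult_right_mono) (auto intro: mult_right_mono)
    then show ?thesis using norm_flow_le[of L s x] by linarith
  qed
  have "M > 0" by (simp add: M_def)
  obtain P where P: "P > 0" "\<And>x. norm (proj x) \<le> P * norm x"
    using linear_bounded_pos[OF proj] by blast
  obtain N where N: "N > 0" "\<And>x. norm (L x) \<le> N * norm x"
    using linear_bounded_pos[OF L] by blast
  \<comment> \<open>The first component vanishes only on the eigenspace and the second is injective
    there. Hence \<open>G\<close> is injective and, in finite dimension, bounded below by some
    \<open>b\<close>.\<close>
  define G where "G x = (flow L (- (2 * pi)) x - x, proj x)" for x
  have "linear G"
    by (rule linearI) (simp_all add: G_def linear_add[OF linear_flow] linear_scale[OF linear_flow]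
        linear_add[OF proj] linear_scale[OF proj] algebra_simps)
  moreover have "inj G"
    unfolding linear_injective_0[OF \<open>linear G\<close>]
  proof (intro allI impI)
    fix x assume "G x = 0"
    then have "flow L (- (2 * pi)) x = x" "proj x = 0" by (simp_all add: G_def zero_prod_def)
    then show "x = 0" using flow_minus_2pi_fixed[of x] by (simp add: linear_0[OF Psi])
  qed
  ultimately obtain b where b: "b > 0" "\<And>x. b * norm x \<le> norm (G x)"
    using linear_inj_bounded_below_pos by blast
  \<comment> \<open>\<open>C\<close> comes from integrating over one period, \<open>D\<close> bounds
    w(0) through \<open>G\<close>, and \<open>K\<close> bounds w(t) through the flow.\<close>
  define C where "C = M * 2 * pi"
  define D where "D = (C + P * C) / b"
  define K where "K = M * (D + C)"
  have pos: "C > 0" "D > 0" "K > 0"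
    using \<open>M > 0\<close> P(1) b(1) by (simp_all add: C_def D_def K_def add_pos_pos)
  have main: "norm (w t) \<le> K * B"
    if w: "w \<in> loops1" "avg w = 0" and B: "\<And>t. norm (lin_Phi L w t) \<le> B" for w B t
  proof -
    have "B \<ge> 0" using B[of 0] norm_ge_zero order_trans by blast
    \<comment> \<open>The displacement of w in the frame moving with the linear flow; its derivative
      is the flow at time -t applied to \<open>lin_Phi L w t\<close>.\<close>
    define e where "e t = flow L (- t) (w t) - w 0" for t
    have de: "(e has_vector_derivative flow L (- t) (lin_Phi L w t)) (at t)" for t
      using has_vector_derivative_diff[OF flow_minus_has_vector_derivative
          [OF L loops1_has_vector_derivative[OF w(1)]] has_vector_derivative_const]
      by (simp add: e_def[abs_def] lin_Phi_def)
    have e: "norm (e t) \<le> C * B" if t: "t \<in> {0..2*pi}" for t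
    proof -
      have "norm (e t - e 0) \<le> (M * B) * norm (t - 0)"
      proof (rule differentiable_bound[of "{0..2*pi}"])
        fix s assume s: "s \<in> {0..2*pi}"
        show "(e has_derivative (\<lambda>h. h *\<^sub>R flow L (- s) (lin_Phi L w s))) (at s within {0..2*pi})"
          using de has_vector_derivative_at_within unfolding has_vector_derivative_def
          by (blast intro: has_derivative_at_withinI)
        have "norm (flow L (- s) (lin_Phi L w s)) \<le> M * norm (lin_Phi L w s)"
          using s by (intro M) simp
        also have "\<dots> \<le> M * B" using B \<open>M > 0\<close> by (intro mult_left_mono) simp_all
        finally show "onorm (\<lambda>h. h *\<^sub>R flow L (- s) (lin_Phi L w s)) \<le> M * B"
          by (intro onorm_le) (simp add: mult.commute mult_left_mono)
      qed (use t in auto)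
      also have "\<dots> \<le> (M * B) * (2 * pi)"
        using t \<open>M > 0\<close> \<open>B \<ge> 0\<close> by (intro mult_left_mono) auto
      finally show ?thesis by (simp add: e_def C_def algebra_simps)
    qed
    have ce: "continuous_on A e" for A
      using de by (intro continuous_at_imp_continuous_on ballI has_vector_derivative_continuous)
    have w2pi: "w (2 * pi) = w 0" by (rule loops1_2pi[OF w(1)])
    have pe: "norm (proj (e t)) \<le> P * (C * B)" if "t \<in> {0..2*pi}" for t
      using P(2)[of "e t"] mult_left_mono[OF e[OF that], of P] P(1) by linarith
    \<comment> \<open>Averaging this identity, with \<open>avg w = 0\<close>, expresses
      \<open>proj (w 0)\<close> through the small displacement \<open>e\<close>.\<close>
    have "rot (- t) (proj (w t)) = proj (w 0) + proj (e t)" for t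
      by (simp add: e_def linear_diff[OF proj] proj_flow)
    moreover have "integral {0..2*pi} (\<lambda>t. proj (w 0) + proj (e t)) =
        (2 * pi) *\<^sub>R proj (w 0) + integral {0..2*pi} (\<lambda>t. proj (e t))"
      by (subst integral_add)
        (auto intro!: integrable_continuous_real linear_continuous_on_compose[OF ce proj])
    ultimately have eq: "(2 * pi) *\<^sub>R proj (w 0) = - integral {0..2*pi} (\<lambda>t. proj (e t))"
      using w(2) by (simp add: avg_def eq_neg_iff_add_eq_0)
    have "norm (integral {0..2*pi} (\<lambda>t. proj (e t))) \<le> (P * (C * B)) * (2 * pi - 0)"
      by (rule integral_bound) (auto intro!: linear_continuous_on_compose[OF ce proj] pe)
    moreover have "norm ((2 * pi) *\<^sub>R proj (w 0)) = norm (integral {0..2*pi} (\<lambda>t. proj (e t)))"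
      by (simp only: eq norm_minus_cancel)
    ultimately have "(2 * pi) * norm (proj (w 0)) \<le> (2 * pi) * (P * (C * B))"
      by (simp add: mult.commute)
    then have p0: "norm (proj (w 0)) \<le> P * (C * B)" by simp
    have "flow L (- (2 * pi)) (w 0) - w 0 = e (2 * pi)"
      by (simp add: e_def w2pi)
    then have "norm (flow L (- (2 * pi)) (w 0) - w 0) \<le> C * B"
      using e[of "2 * pi"] by simp
    then have "norm (G (w 0)) \<le> C * B + P * (C * B)"
      unfolding G_def using norm_Pair_le[of "flow L (- (2 * pi)) (w 0) - w 0" "proj (w 0)"] p0 by linarith
    then have "b * norm (w 0) \<le> C * B + P * (C * B)" using b(2)[of "w 0"] by linarith
    then have w0: "norm (w 0) \<le> D * B"
      using b(1) by (simp add: D_def field_simps)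
    obtain s where s: "s \<in> {0..2*pi}" "w t = w s"
      using loops_reduce[OF loops1_subset_loops[OF w(1)]] by blast
    have "w s = flow L s (w 0 + e s)" by (simp add: e_def)
    then have "norm (w s) \<le> M * norm (w 0 + e s)" using M[of s] s by simp
    also have "\<dots> \<le> M * (D * B + C * B)"
      using w0 e[OF s(1)] norm_triangle_ineq[of "w 0" "e s"] \<open>M > 0\<close> by (intro mult_left_mono) auto
    finally show ?thesis using s(2) by (simp add: K_def algebra_simps)
  qed
  show ?thesis
  \<comment> \<open>The second entry bounds the derivative, which equals L w +
    \<open>lin_Phi L w\<close>.\<close>
  proof (rule that[of "max K (N * K + 1)"])
    fix w B t
    assume w: "w \<in> loops1" "avg w = 0" and B: "\<And>t. norm (lin_Phi L w t) \<le> B"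
    have "B \<ge> 0" using B[of 0] norm_ge_zero order_trans by blast
    have "vector_derivative w (at t) = L (w t) + lin_Phi L w t" by (simp add: lin_Phi_def)
    then have "norm (vector_derivative w (at t)) \<le> norm (L (w t)) + norm (lin_Phi L w t)"
      by (simp add: norm_triangle_ineq)
    also have "\<dots> \<le> N * (K * B) + B"
    proof -
      have "N * norm (w t) \<le> N * (K * B)"
        using main[OF w B, of t] N(1) by (intro mult_left_mono) simp_all
      then show ?thesis using N(2)[of "w t"] B[of t] by linarith
    qed
    also have "\<dots> = (N * K + 1) * B" by (simp add: algebra_simps)
    also have "\<dots> \<le> max K (N * K + 1) * B" using \<open>B \<ge> 0\<close> by (intro mult_right_mono) simp_all
    finally have 1: "norm (vector_derivative w (at t)) \<le> max K (N * K + 1) * B" .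
    have "K * B \<le> max K (N * K + 1) * B" using \<open>B \<ge> 0\<close> by (intro mult_right_mono) simp_all
    with main[OF w B, of t] 1
    show "norm (w t) \<le> max K (N * K + 1) * B \<and> norm (vector_derivative w (at t)) \<le> max K (N * K + 1) * B"
      by linarith
  qed (use pos in simp)
qed

end

section \<open>Hessians, implicit functions and uniqueness of solutions\<close>

lemma has_derivative_grad:
  fixes F :: "'a::euclidean_space \<Rightarrow> real"
  assumes "F differentiable (at x)"
  shows "(F has_derivative (\<lambda>v. v \<bullet> grad F x)) (at x)"
    and "grad F x = (\<Sum>b\<in>Basis. frechet_derivative F (at x) b *\<^sub>R b)"
proof -
  let ?D = "\<Sum>b\<in>Basis. frechet_derivative F (at x) b *\<^sub>R b"
  have F': "(F has_derivative frechet_derivative F (at x)) (at x)"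
    using assms frechet_derivative_works by blast
  then have lin: "linear (frechet_derivative F (at x))" by (rule has_derivative_linear)
  have "frechet_derivative F (at x) v = v \<bullet> ?D" for v
  proof -
    have "frechet_derivative F (at x) v = frechet_derivative F (at x) (\<Sum>b\<in>Basis. (v \<bullet> b) *\<^sub>R b)"
      by (simp add: euclidean_representation)
    also have "\<dots> = v \<bullet> ?D"
      by (simp add: linear_sum[OF lin] linear_scale[OF lin] inner_sum_right mult.commute)
    finally show ?thesis .
  qed
  then have eq: "frechet_derivative F (at x) = (\<lambda>v. v \<bullet> ?D)" by (rule ext)
  then have D: "(F has_derivative (\<lambda>v. v \<bullet> ?D)) (at x)" using F' by simp
  show "grad F x = ?D"
    unfolding grad_def gderiv_def
  proof (rule the_equality)
    show "(F has_derivative (\<lambda>v. v \<bullet> ?D)) (at x)" by (rule D)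
  next
    fix E assume "(F has_derivative (\<lambda>v. v \<bullet> E)) (at x)"
    from has_derivative_unique[OF this D] have "v \<bullet> E = v \<bullet> ?D" for v by meson
    then show "E = ?D" by (metis vector_eq_ldot)
  qed
  then show "(F has_derivative (\<lambda>v. v \<bullet> grad F x)) (at x)" using D by simp
qed

lemma grad_eqI:
  fixes F :: "'a::euclidean_space \<Rightarrow> real"
  assumes "(F has_derivative (\<lambda>v. v \<bullet> D)) (at x)"
  shows "grad F x = D"
proof -
  have "F differentiable (at x)" using assms by (auto simp: differentiable_def)
  from has_derivative_unique[OF has_derivative_grad(1)[OF this] assms]
  have "v \<bullet> grad F x = v \<bullet> D" for v by meson
  then show ?thesis by (metis vector_eq_ldot)
qed

text \<open>The second difference \<Delta> is symmetric in \<open>a\<close> and \<open>b\<close>.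
  The mean value theorem, applied in either direction, compares it with s^2 times the respective
  mixed term, up to an error of order \<epsilon> s^2.\<close>

lemma hessian_symmetric:
  fixes H :: "'a::euclidean_space \<Rightarrow> real" and D :: "'a \<Rightarrow> 'a"
  assumes H: "\<And>x. (H has_derivative (\<lambda>v. v \<bullet> D x)) (at x)"
    and D: "(D has_derivative A) (at 0)"
  shows "A a \<bullet> b = A b \<bullet> a"
proof (rule ccontr)
  assume neq: "A a \<bullet> b \<noteq> A b \<bullet> a"
  define C where "C = norm a + norm b + 1"
  have C: "C > 0" by (simp add: C_def add_nonneg_pos)
  \<comment> \<open>The two errors together amount to at most 4 \<epsilon> C^2 after division by
    s^2; with this \<epsilon> that is half of the assumed difference.\<close>
  define \<epsilon> where "\<epsilon> = \<bar>A a \<bullet> b - A b \<bullet> a\<bar> / (8 * C * C)"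
  have \<epsilon>: "\<epsilon> > 0" using neq C by (simp add: \<epsilon>_def)
  have lin: "linear A" using D by (rule has_derivative_linear)
  obtain d where d: "d > 0" "\<And>y. norm y < d \<Longrightarrow> norm (D y - D 0 - A y) \<le> \<epsilon> * norm y"
    using D[unfolded has_derivative_at_alt] \<epsilon> by auto
  define s where "s = d / (2 * C)"
  have s: "s > 0" using d C by (simp add: s_def)
  have sC: "s * C < d" using d C by (simp add: s_def)
  define \<Delta> where "\<Delta> = H (s *\<^sub>R a + s *\<^sub>R b) - H (s *\<^sub>R a) - H (s *\<^sub>R b) + H 0"
  have key: "\<bar>\<Delta> - s * s * (A p \<bullet> q)\<bar> \<le> 2 * (\<epsilon> * (s * C)) * (s * C)"
    if pq: "norm p + norm q + 1 = C" "\<Delta> = H (s *\<^sub>R p + s *\<^sub>R q) - H (s *\<^sub>R p) - H (s *\<^sub>R q) + H 0" for p q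
  proof -
    \<comment> \<open>Its increment from 0 to 1 is \<Delta>, and its derivative is a difference of
      gradients at two points displaced by s p.\<close>
    define \<psi> where "\<psi> r = H (s *\<^sub>R p + (r * s) *\<^sub>R q) - H ((r * s) *\<^sub>R q)" for r :: real
    have der: "(\<psi> has_derivative (\<lambda>h. h * ((s *\<^sub>R q) \<bullet> (D (s *\<^sub>R p + (r * s) *\<^sub>R q) - D ((r * s) *\<^sub>R q))))) (at r)" for r
      unfolding \<psi>_def[abs_def]
      by (auto intro!: derivative_eq_intros has_derivative_compose[OF _ H] simp: inner_diff_right algebra_simps)
    obtain r where r: "0 < r" "r < 1"
      "\<psi> 1 - \<psi> 0 = (1 - 0) * ((s *\<^sub>R q) \<bullet> (D (s *\<^sub>R p + (r * s) *\<^sub>R q) - D ((r * s) *\<^sub>R q)))"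
      using mvt_simple[of 0 1 \<psi>, OF _ has_derivative_at_withinI[OF der]] by auto
    have "\<psi> 1 - \<psi> 0 = \<Delta>" by (simp add: \<psi>_def pq(2))
    then have \<Delta>: "\<Delta> = s * (q \<bullet> (D (s *\<^sub>R p + (r * s) *\<^sub>R q) - D ((r * s) *\<^sub>R q)))"
      using r(3) by simp
    let ?u = "s *\<^sub>R p + (r * s) *\<^sub>R q" and ?v = "(r * s) *\<^sub>R q"
    have "norm ?v \<le> s * norm q"
      using r s by (simp add: mult_right_mono mult_left_le_one_le)
    moreover have "norm ?u \<le> s * norm p + s * norm q"
      using norm_triangle_ineq[of "s *\<^sub>R p" ?v] calculation s by simp
    moreover have "s * norm p + s * norm q + s = s * C" using pq(1) by (simp add: algebra_simps flip: pq(1))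
    moreover have "s * norm p \<ge> 0" using s by simp
    ultimately have n: "norm ?u \<le> s * C" "norm ?v \<le> s * C" using s by linarith+
    have "norm (D ?u - D 0 - A ?u) \<le> \<epsilon> * (s * C)" "norm (D ?v - D 0 - A ?v) \<le> \<epsilon> * (s * C)"
      using d(2)[of ?u] d(2)[of ?v] n sC mult_left_mono[OF n(1), of \<epsilon>] mult_left_mono[OF n(2), of \<epsilon>] \<epsilon>
      by linarith+
    then have "norm ((D ?u - D 0 - A ?u) - (D ?v - D 0 - A ?v)) \<le> 2 * (\<epsilon> * (s * C))"
      using norm_triangle_ineq4[of "D ?u - D 0 - A ?u" "D ?v - D 0 - A ?v"] by linarith
    moreover have "A ?u - A ?v = s *\<^sub>R A p"
      by (simp add: linear_add[OF lin] linear_scale[OF lin])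
    ultimately have *: "norm (D ?u - D ?v - s *\<^sub>R A p) \<le> 2 * (\<epsilon> * (s * C))"
      by (simp add: algebra_simps)
    have "\<Delta> - s * s * (A p \<bullet> q) = (s *\<^sub>R q) \<bullet> (D ?u - D ?v - s *\<^sub>R A p)"
      by (simp add: \<Delta> inner_diff_right inner_commute algebra_simps)
    then have "\<bar>\<Delta> - s * s * (A p \<bullet> q)\<bar> \<le> norm (s *\<^sub>R q) * norm (D ?u - D ?v - s *\<^sub>R A p)"
      using Cauchy_Schwarz_ineq2 by metis
    also have "\<dots> \<le> (s * C) * (2 * (\<epsilon> * (s * C)))"
    proof (rule mult_mono)
      have "norm q \<le> C" using pq(1) norm_ge_zero[of p] by linarith
      then show "norm (s *\<^sub>R q) \<le> s * C" using s by simp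
    qed (use * s C in simp_all)
    finally show ?thesis by (simp add: mult.commute)
  qed
  have "\<bar>\<Delta> - s * s * (A a \<bullet> b)\<bar> \<le> 2 * (\<epsilon> * (s * C)) * (s * C)"
    by (rule key) (simp_all add: C_def \<Delta>_def)
  moreover have "\<bar>\<Delta> - s * s * (A b \<bullet> a)\<bar> \<le> 2 * (\<epsilon> * (s * C)) * (s * C)"
    by (rule key) (simp_all add: C_def \<Delta>_def add.commute)
  ultimately have "\<bar>s * s * (A a \<bullet> b) - s * s * (A b \<bullet> a)\<bar> \<le> 4 * (\<epsilon> * (s * C)) * (s * C)"
    by linarith
  moreover have "s * s * (A a \<bullet> b) - s * s * (A b \<bullet> a) = (s * s) * (A a \<bullet> b - A b \<bullet> a)"
    by (simp add: right_diff_distrib)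
  ultimately have "(s * s) * \<bar>A a \<bullet> b - A b \<bullet> a\<bar> \<le> 4 * (\<epsilon> * (s * C)) * (s * C)"
    using s by (simp add: abs_mult)
  also have "\<dots> = (s * s) * (4 * \<epsilon> * C * C)" by simp
  finally have "(s * s) * \<bar>A a \<bullet> b - A b \<bullet> a\<bar> \<le> (s * s) * (4 * \<epsilon> * C * C)" .
  then have "\<bar>A a \<bullet> b - A b \<bullet> a\<bar> \<le> 4 * \<epsilon> * C * C"
    using s by simp
  also have "\<dots> = \<bar>A a \<bullet> b - A b \<bullet> a\<bar> / 2" using C by (simp add: \<epsilon>_def)
  finally show False using neq by simp
qed

section \<open>Calculus of C^1 maps and the implicit function theorem\<close>

lemma ck_on_SucD: "ck_on (Suc k) F U \<Longrightarrow> ck_on k F U"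
proof (induction k arbitrary: F)
  case 0
  then show ?case
    by (auto intro!: continuous_at_imp_continuous_on differentiable_imp_continuous_within)
qed auto

lemma ck_on_1I:
  assumes "\<And>x. x \<in> U \<Longrightarrow> (F has_derivative F' x) (at x)" "\<And>v. continuous_on U (\<lambda>x. F' x v)"
  shows "ck_on (Suc 0) F U"
proof -
  have "frechet_derivative F (at x) = F' x" if "x \<in> U" for x
    using frechet_derivative_at[OF assms(1)[OF that]] by simp
  then have "continuous_on U (\<lambda>x. frechet_derivative F (at x) v)" for v
    using assms(2)[of v] by (simp cong: continuous_on_cong)
  then show ?thesis using assms(1) by (auto simp: differentiable_def)
qed

lemma ck_on_1D:
  assumes "ck_on (Suc 0) F U"
  shows "x \<in> U \<Longrightarrow> (F has_derivative frechet_derivative F (at x)) (at x)"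
    and "continuous_on U (\<lambda>x. frechet_derivative F (at x) v)"
    and "continuous_on U F"
  using assms ck_on_SucD[OF assms] by (auto simp: frechet_derivative_works)

lemma ck_on_1_linear: "linear F \<Longrightarrow> ck_on (Suc 0) F U"
  by (rule ck_on_1I[where F' = "\<lambda>_. F"]) (auto intro: linear_imp_has_derivative)

lemma ck_on_1_const: "ck_on (Suc 0) (\<lambda>_. c) U"
  by (rule ck_on_1I[where F' = "\<lambda>_ _. 0"]) auto

lemma ck_on_1_add:
  assumes "ck_on (Suc 0) F U" "ck_on (Suc 0) G U"
  shows "ck_on (Suc 0) (\<lambda>x. F x + G x) U"
proof (rule ck_on_1I)
  show "((\<lambda>x. F x + G x) has_derivative
      (\<lambda>v. frechet_derivative F (at x) v + frechet_derivative G (at x) v)) (at x)" if "x \<in> U" for x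
    by (rule has_derivative_add[OF ck_on_1D(1)[OF assms(1) that] ck_on_1D(1)[OF assms(2) that]])
qed (rule continuous_on_add[OF ck_on_1D(2)[OF assms(1)] ck_on_1D(2)[OF assms(2)]])

lemma ck_on_1_Pair:
  assumes "ck_on (Suc 0) F U" "ck_on (Suc 0) G U"
  shows "ck_on (Suc 0) (\<lambda>x. (F x, G x)) U"
proof (rule ck_on_1I)
  show "((\<lambda>x. (F x, G x)) has_derivative
      (\<lambda>v. (frechet_derivative F (at x) v, frechet_derivative G (at x) v))) (at x)" if "x \<in> U" for x
    by (rule has_derivative_Pair[OF ck_on_1D(1)[OF assms(1) that] ck_on_1D(1)[OF assms(2) that]])
qed (rule continuous_on_Pair[OF ck_on_1D(2)[OF assms(1)] ck_on_1D(2)[OF assms(2)]])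

lemma ck_on_1_mult:
  fixes F G :: "'a::euclidean_space \<Rightarrow> real"
  assumes "ck_on (Suc 0) F U" "ck_on (Suc 0) G U"
  shows "ck_on (Suc 0) (\<lambda>x. F x * G x) U"
proof (rule ck_on_1I)
  show "((\<lambda>x. F x * G x) has_derivative
      (\<lambda>v. F x * frechet_derivative G (at x) v + frechet_derivative F (at x) v * G x)) (at x)"
    if "x \<in> U" for x
    by (rule has_derivative_mult[OF ck_on_1D(1)[OF assms(1) that] ck_on_1D(1)[OF assms(2) that]])
qed (intro continuous_intros ck_on_1D(2,3)[OF assms(1)] ck_on_1D(2,3)[OF assms(2)])

text \<open>\<open>ck_on\<close> yields continuity of derivatives only for a fixed direction,
  whereas here the direction moves with the point; expanding it in the basis reduces the claim to
  fixed directions.\<close>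

lemma ck_on_1_compose:
  assumes F: "ck_on (Suc 0) F V" and G: "ck_on (Suc 0) G U" and GV: "\<And>x. x \<in> U \<Longrightarrow> G x \<in> V"
  shows "ck_on (Suc 0) (\<lambda>x. F (G x)) U"
proof (rule ck_on_1I[where F' = "\<lambda>x v. frechet_derivative F (at (G x)) (frechet_derivative G (at x) v)"])
  fix x assume x: "x \<in> U"
  show "((\<lambda>x. F (G x)) has_derivative
      (\<lambda>v. frechet_derivative F (at (G x)) (frechet_derivative G (at x) v))) (at x)"
    by (rule has_derivative_compose[OF ck_on_1D(1)[OF G x] ck_on_1D(1)[OF F GV[OF x]]])
next
  fix v
  have "frechet_derivative F (at (G x)) w =
      (\<Sum>b\<in>Basis. (w \<bullet> b) *\<^sub>R frechet_derivative F (at (G x)) b)" if "x \<in> U" for x w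
  proof -
    have lin: "linear (frechet_derivative F (at (G x)))"
      using ck_on_1D(1)[OF F GV[OF that]] by (rule has_derivative_linear)
    have "frechet_derivative F (at (G x)) w = frechet_derivative F (at (G x)) (\<Sum>b\<in>Basis. (w \<bullet> b) *\<^sub>R b)"
      by (simp add: euclidean_representation)
    then show ?thesis by (simp add: linear_sum[OF lin] linear_scale[OF lin])
  qed
  moreover have "continuous_on U (\<lambda>x. \<Sum>b\<in>Basis. (frechet_derivative G (at x) v \<bullet> b) *\<^sub>R frechet_derivative F (at (G x)) b)"
    by (intro continuous_intros ck_on_1D[OF G] continuous_on_compose2[OF ck_on_1D(2)[OF F] ck_on_1D(3)[OF G]])
      (use GV in auto)
  ultimately show "continuous_on U (\<lambda>x. frechet_derivative F (at (G x)) (frechet_derivative G (at x) v))"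
    by (simp cong: continuous_on_cong)
qed

text \<open>In finite dimension continuity in every direction is continuity in the operator norm,
  the form in which the inverse function theorem takes its hypothesis.\<close>

lemma ck_on_1_blinfun:
  assumes "ck_on (Suc 0) F U"
  shows "x \<in> U \<Longrightarrow> (F has_derivative blinfun_apply (Blinfun (frechet_derivative F (at x)))) (at x)"
    and "continuous_on U (\<lambda>x. Blinfun (frechet_derivative F (at x)))"
proof -
  have ap: "blinfun_apply (Blinfun (frechet_derivative F (at x))) = frechet_derivative F (at x)"
    if "x \<in> U" for x
    using ck_on_1D(1)[OF assms that] by (simp add: bounded_linear_Blinfun_apply has_derivative_bounded_linear)
  then show "x \<in> U \<Longrightarrow> (F has_derivative blinfun_apply (Blinfun (frechet_derivative F (at x)))) (at x)"
    using ck_on_1D(1)[OF assms] by simp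
  show "continuous_on U (\<lambda>x. Blinfun (frechet_derivative F (at x)))"
    by (rule continuous_on_blinfun_componentwise)
      (use ck_on_1D(2)[OF assms] ap in \<open>simp cong: continuous_on_cong\<close>)
qed

text \<open>The map (x, y) to (x, F (x, y)) has an injective derivative at the base point, hence a
  local inverse, and y(x) is the second component of the inverse at (x, 0). Continuity of the
  solution is recorded, since the families of orbits are required to be continuous.\<close>

lemma implicit_function:
  fixes F :: "'x::euclidean_space \<times> 'y::euclidean_space \<Rightarrow> 'y"
  assumes V: "open V" "(x0, y0) \<in> V" and F0: "F (x0, y0) = 0" and F: "ck_on (Suc 0) F V"
    and D: "((\<lambda>y. F (x0, y)) has_derivative D) (at y0)" "inj D"
  obtains r y where "r > 0" "continuous_on (ball x0 r) y" "y x0 = y0"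
    "\<And>x. x \<in> ball x0 r \<Longrightarrow> (x, y x) \<in> V \<and> F (x, y x) = 0"
proof -
  define G where "G p = (fst p, F p)" for p
  have G: "ck_on (Suc 0) G V"
    unfolding G_def[abs_def] by (intro ck_on_1_Pair F ck_on_1_linear linear_fst)
  let ?F' = "frechet_derivative F (at (x0, y0))" and ?G' = "frechet_derivative G (at (x0, y0))"
  have "(G has_derivative (\<lambda>h. (fst h, ?F' h))) (at (x0, y0))"
    unfolding G_def[abs_def]
    by (intro has_derivative_Pair ck_on_1D(1)[OF F V(2)] linear_imp_has_derivative linear_fst)
  then have G': "?G' = (\<lambda>h. (fst h, ?F' h))"
    using frechet_derivative_at by metis
  have lin: "linear ?G'"
    using ck_on_1D(1)[OF G V(2)] by (rule has_derivative_linear)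
  have FD: "?F' (0, k) = D k" for k
  proof -
    have "((\<lambda>y. F (x0, y)) has_derivative (\<lambda>k. ?F' (0, k))) (at y0)"
      by (rule has_derivative_compose[OF has_derivative_Pair[OF has_derivative_const has_derivative_ident]
            ck_on_1D(1)[OF F V(2)]])
    from has_derivative_unique[OF this D(1)] show ?thesis by meson
  qed
  have linD: "linear D" using D(1) by (rule has_derivative_linear)
  have "inj ?G'"
    unfolding linear_injective_0[OF lin]
  proof clarify
    fix h k assume "?G' (h, k) = 0"
    then have *: "(h, ?F' (h, k)) = (0, 0)" unfolding G' by (simp only: fst_conv zero_prod_def)
    then have "h = 0" by (rule Pair_inject)
    moreover have "?F' (h, k) = 0" using * by (rule Pair_inject)
    ultimately have "h = 0" "?F' (0, k) = 0" by blast+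
    then have "D k = 0" using FD[of k] by (simp only:)
    then have "k = 0" using D(2) linD by (simp add: linear_injective_0)
    then show "(h, k) = 0" using \<open>h = 0\<close> by (simp add: zero_prod_def)
  qed
  then obtain g where g: "linear g" "g \<circ> ?G' = id"
    using linear_injective_left_inverse[OF lin] by blast
  have invg: "Blinfun g o\<^sub>L Blinfun ?G' = id_blinfun"
  proof (rule blinfun_eqI)
    fix i
    have "g (?G' i) = i" using g(2) by (metis comp_apply id_apply)
    then show "blinfun_apply (Blinfun g o\<^sub>L Blinfun ?G') i = blinfun_apply id_blinfun i"
      using g(1) lin by (simp add: bounded_linear_Blinfun_apply linear_conv_bounded_linear)
  qed
  obtain U' V' k where inv: "open U'" "U' \<subseteq> V" "(x0, y0) \<in> U'" "open V'" "G (x0, y0) \<in> V'"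
    "homeomorphism U' V' G k"
    by (rule inverse_function_theorem[OF V(1) ck_on_1_blinfun[OF G] V(2) invg]) (assumption | rule that)+
  have "(x0, 0) \<in> V'" using inv(5) by (simp add: G_def F0)
  then obtain A B where AB: "open A" "open B" "x0 \<in> A" "0 \<in> B" "A \<times> B \<subseteq> V'"
    using inv(4) by (auto elim: open_prod_elim)
  then obtain r where r: "r > 0" "ball x0 r \<subseteq> A" by (meson openE)
  have V'in: "(x, 0) \<in> V'" if "x \<in> ball x0 r" for x using that r AB by blast
  have Gk: "G (k (x, 0)) = (x, 0)" "k (x, 0) \<in> U'" if "x \<in> ball x0 r" for x
    using inv(6) V'in[OF that] by (auto simp: homeomorphism_def)
  then have fk: "fst (k (x, 0)) = x" "F (k (x, 0)) = 0" if "x \<in> ball x0 r" for x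
    using that by (auto simp: G_def)
  show ?thesis
  proof (rule that[of r "\<lambda>x. snd (k (x, 0))"])
    show "continuous_on (ball x0 r) (\<lambda>x. snd (k (x, 0)))"
    proof (rule continuous_on_snd[OF continuous_on_compose2[of V' k _ "\<lambda>x. (x, 0)"]])
      show "continuous_on V' k" using inv(6) by (simp add: homeomorphism_def)
      show "continuous_on (ball x0 r) (\<lambda>x. (x, 0 :: 'y))" by (intro continuous_intros)
    qed (use V'in in auto)
    have "k (G (x0, y0)) = (x0, y0)" using inv(3,6) by (auto simp: homeomorphism_def)
    then show "snd (k (x0, 0)) = y0" by (simp add: G_def F0)
    fix x assume x: "x \<in> ball x0 r"
    have "(x, snd (k (x, 0))) = k (x, 0)" using fk(1)[OF x] by (metis prod.collapse)
    then show "(x, snd (k (x, 0))) \<in> V \<and> F (x, snd (k (x, 0))) = 0"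
      using fk(2)[OF x] Gk(2)[OF x] inv(2) by auto
  qed (rule r)
qed

section \<open>Uniqueness for autonomous differential equations\<close>

lemma ck_on_1_lipschitz:
  fixes F :: "'a::euclidean_space \<Rightarrow> 'b::real_normed_vector"
  assumes "ck_on (Suc 0) F UNIV"
  obtains K where "K \<ge> 0" "\<And>x y. norm x \<le> B \<Longrightarrow> norm y \<le> B \<Longrightarrow> norm (F x - F y) \<le> K * norm (x - y)"
proof -
  let ?F' = "\<lambda>x. Blinfun (frechet_derivative F (at x))"
  have "compact (?F' ` cball 0 B)"
    by (intro compact_continuous_image continuous_on_subset[OF ck_on_1_blinfun(2)[OF assms]]) auto
  then have "bounded (?F' ` cball 0 B)" by (rule compact_imp_bounded)
  then obtain K where "\<forall>A\<in>?F' ` cball 0 B. norm A \<le> K"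
    unfolding bounded_iff ..
  then have K: "\<And>x. x \<in> cball 0 B \<Longrightarrow> norm (?F' x) \<le> K" by blast
  show ?thesis
  proof (rule that[of "max K 0"])
    fix x y :: 'a assume xy: "norm x \<le> B" "norm y \<le> B"
    show "norm (F x - F y) \<le> max K 0 * norm (x - y)"
    proof (rule differentiable_bound[of "cball 0 B"])
      fix z :: 'a assume "z \<in> cball 0 B"
      then show "onorm (blinfun_apply (?F' z)) \<le> max K 0"
        using K[of z] by (simp add: norm_blinfun.rep_eq)
      show "(F has_derivative blinfun_apply (?F' z)) (at z within cball 0 B)"
        by (rule has_derivative_at_withinI[OF ck_on_1_blinfun(1)[OF assms UNIV_I]])
    qed (use xy in auto)
  qed simp
qed

text \<open>Gronwall's argument: e^(-2 K t) times the squared distance of the solutions does not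
  increase, and it starts at 0.\<close>

lemma solution_unique_forward:
  fixes F :: "'a::euclidean_space \<Rightarrow> 'a"
  assumes lip: "\<And>t. norm (F (x t) - F (y t)) \<le> K * norm (x t - y t)"
    and x: "\<And>t. (x has_vector_derivative F (x t)) (at t)"
    and y: "\<And>t. (y has_vector_derivative F (y t)) (at t)"
    and eq: "x 0 = y 0" and "t \<ge> 0"
  shows "x t = y t"
proof -
  define d where "d t = (x t - y t) \<bullet> (x t - y t)" for t
  have d: "(d has_real_derivative 2 * ((x s - y s) \<bullet> (F (x s) - F (y s)))) (at s)" for s
    unfolding d_def[abs_def] has_field_derivative_def
    by (auto intro!: derivative_eq_intros x[unfolded has_vector_derivative_def] y[unfolded has_vector_derivative_def]
        simp: inner_commute inner_diff_right inner_diff_left algebra_simps)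
  have le: "2 * ((x s - y s) \<bullet> (F (x s) - F (y s))) \<le> 2 * K * d s" for s
  proof -
    have "(x s - y s) \<bullet> (F (x s) - F (y s)) \<le> norm (x s - y s) * norm (F (x s) - F (y s))"
      by (rule norm_cauchy_schwarz)
    also have "\<dots> \<le> norm (x s - y s) * (K * norm (x s - y s))"
      by (intro mult_left_mono lip) simp
    also have "\<dots> = K * d s"
      by (simp add: d_def power2_norm_eq_inner[symmetric] power2_eq_square)
    finally show ?thesis by simp
  qed
  have "exp (- 2 * K * t) * d t \<le> exp (- 2 * K * 0) * d 0"
  proof (rule DERIV_nonpos_imp_nonincreasing[OF \<open>t \<ge> 0\<close>])
    fix s :: real
    have "((\<lambda>s. exp (- 2 * K * s) * d s) has_real_derivative
        exp (- 2 * K * s) * (2 * ((x s - y s) \<bullet> (F (x s) - F (y s))) - 2 * K * d s)) (at s)"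
      by (auto intro!: derivative_eq_intros d simp: algebra_simps)
    moreover have "exp (- 2 * K * s) * (2 * ((x s - y s) \<bullet> (F (x s) - F (y s))) - 2 * K * d s) \<le> 0"
      using le[of s] by (intro mult_nonneg_nonpos) simp_all
    ultimately show "\<exists>z. ((\<lambda>s. exp (- 2 * K * s) * d s) has_real_derivative z) (at s) \<and> z \<le> 0"
      by blast
  qed
  then have "d t \<le> 0" by (simp add: d_def eq mult_le_0_iff)
  moreover have "d t \<ge> 0" by (simp add: d_def)
  ultimately have "(x t - y t) \<bullet> (x t - y t) = 0" by (simp only: d_def order_antisym)
  then show ?thesis by simp
qed

text \<open>A common bound, which periodic solutions have, gives one Lipschitz constant along both
  curves for all times. Negative times are treated by reversing time and the sign of
  \<open>F\<close>.\<close>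

lemma solution_unique:
  fixes F :: "'a::euclidean_space \<Rightarrow> 'a"
  assumes F: "ck_on (Suc 0) F UNIV" and x: "solution_of F x" and y: "solution_of F y"
    and bd: "\<And>t. norm (x t) \<le> B" "\<And>t. norm (y t) \<le> B" and eq: "x 0 = y 0"
  shows "x = y"
proof
  fix t
  obtain K where K: "\<And>u v. norm u \<le> B \<Longrightarrow> norm v \<le> B \<Longrightarrow> norm (F u - F v) \<le> K * norm (u - v)"
    using ck_on_1_lipschitz[OF F] by metis
  show "x t = y t"
  proof (cases "t \<ge> 0")
    case True
    show ?thesis
    proof (rule solution_unique_forward[of F x y K])
      show "norm (F (x t) - F (y t)) \<le> K * norm (x t - y t)" for t by (rule K[OF bd])
    qed (use x y eq True in \<open>simp_all add: solution_of_def\<close>)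
  next
    case False
    have rev: "((\<lambda>t. z (- t)) has_vector_derivative - F (z (- t))) (at t)" if "solution_of F z" for z t
    proof -
      have "((\<lambda>t::real. - t) has_vector_derivative - 1) (at t)" by (auto intro!: derivative_eq_intros)
      from vector_diff_chain_at[OF this, of z "F (z (- t))"] that show ?thesis
        by (simp add: o_def solution_of_def)
    qed
    have "norm (- F (x (- s)) - - F (y (- s))) \<le> K * norm (x (- s) - y (- s))" for s
      using K[OF bd(1)[of "- s"] bd(2)[of "- s"]] by (simp add: norm_minus_commute)
    from solution_unique_forward[of "\<lambda>u. - F u" "\<lambda>t. x (- t)" "\<lambda>t. y (- t)" K, OF this rev[OF x] rev[OF y]]
    have "x (- s) = y (- s)" if "s \<ge> 0" for s using eq that by simp
    from this[of "- t"] show ?thesis using False by simp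
  qed
qed

section \<open>Symmetries of the implicit solution\<close>

lemma loops_affine:
  assumes u: "u \<in> loops" and \<sigma>: "\<sigma> = 1 \<or> \<sigma> = - 1"
  shows "(\<lambda>t. u (\<sigma> * t + \<theta>)) \<in> loops"
proof -
  have per: "u (t + 2 * pi) = u t" for t using u by (simp add: loops_def)
  have "u (\<sigma> * (t + 2 * pi) + \<theta>) = u (\<sigma> * t + \<theta>)" for t
    using \<sigma> per[of "t + \<theta>"] per[of "- (t + 2 * pi) + \<theta>"] by (auto simp: algebra_simps)
  moreover have "continuous_on UNIV (\<lambda>t. u (\<sigma> * t + \<theta>))"
  proof (rule continuous_on_compose2[of UNIV u UNIV "\<lambda>t. \<sigma> * t + \<theta>"])
    show "continuous_on UNIV (\<lambda>t. \<sigma> * t + \<theta>)" by (intro continuous_intros)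
  qed (use u in \<open>simp_all add: loops_def\<close>)
  ultimately show ?thesis by (simp add: loops_def)
qed

lemma loops1_affine:
  assumes u: "u \<in> loops1" and \<sigma>: "\<sigma> = 1 \<or> \<sigma> = - 1" and A: "linear A"
  shows "(\<lambda>t. A (u (\<sigma> * t + \<theta>))) \<in> loops1"
    and "vector_derivative (\<lambda>t. A (u (\<sigma> * t + \<theta>))) (at t) =
      \<sigma> *\<^sub>R A (vector_derivative u (at (\<sigma> * t + \<theta>)))"
proof -
  have d: "((\<lambda>t. A (u (\<sigma> * t + \<theta>))) has_vector_derivative
      \<sigma> *\<^sub>R A (vector_derivative u (at (\<sigma> * t + \<theta>)))) (at t)" for t
  proof -
    have "((\<lambda>t. \<sigma> * t + \<theta>) has_vector_derivative \<sigma>) (at t)"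
      by (auto intro!: derivative_eq_intros)
    from vector_diff_chain_at[OF this loops1_has_vector_derivative[OF u]]
    have "((\<lambda>t. u (\<sigma> * t + \<theta>)) has_vector_derivative
        \<sigma> *\<^sub>R vector_derivative u (at (\<sigma> * t + \<theta>))) (at t)"
      by (simp add: o_def)
    from linear_has_vector_derivative[OF A this]
    show ?thesis by (simp add: linear_scale[OF A])
  qed
  have 1: "(\<lambda>t. A (u (\<sigma> * t + \<theta>))) \<in> loops"
    by (rule linear_loops[OF A loops_affine[OF loops1_subset_loops[OF u] \<sigma>]])
  have 2: "(\<lambda>t. A (vector_derivative u (at (\<sigma> * t + \<theta>)))) \<in> loops"
    by (rule linear_loops[OF A loops_affine[OF loops1_deriv_loops[OF u] \<sigma>]])
  show "(\<lambda>t. A (u (\<sigma> * t + \<theta>))) \<in> loops1"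
  proof (rule loops1I[OF d])
    show "continuous_on UNIV (\<lambda>t. \<sigma> *\<^sub>R A (vector_derivative u (at (\<sigma> * t + \<theta>))))"
      using 2 by (intro continuous_intros) (simp add: loops_def)
    show "A (u (\<sigma> * (t + 2 * pi) + \<theta>)) = A (u (\<sigma> * t + \<theta>))" for t
      using 1 by (simp add: loops_def)
  qed
  show "vector_derivative (\<lambda>t. A (u (\<sigma> * t + \<theta>))) (at t) =
      \<sigma> *\<^sub>R A (vector_derivative u (at (\<sigma> * t + \<theta>)))"
    by (rule vector_derivative_at[OF d])
qed

text \<open>Orthogonal maps combined with shifts or reversals of time preserve the C^1 ball in which
  \<open>W\<close> is the unique solution; the equivariance of \<open>W\<close> depends on
  this.\<close>

lemma c1_norm_affine:
  fixes u :: "real \<Rightarrow> 'a::euclidean_space"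
  assumes u: "u \<in> loops1" and \<sigma>: "\<sigma> = 1 \<or> \<sigma> = - 1" and A: "orthogonal_transformation A"
  shows "c1_norm (\<lambda>t. A (u (\<sigma> * t + \<theta>))) = c1_norm u"
proof -
  have surj: "surj (\<lambda>t. \<sigma> * t + \<theta>)"
  proof (rule surjI)
    show "\<sigma> * (\<sigma> * (t - \<theta>)) + \<theta> = t" for t using \<sigma> by auto
  qed
  have *: "(SUP t. F (\<sigma> * t + \<theta>)) = (SUP t. F t)" for F :: "real \<Rightarrow> real"
  proof -
    have "range (\<lambda>t. F (\<sigma> * t + \<theta>)) = F ` range (\<lambda>t. \<sigma> * t + \<theta>)"
      by (simp only: image_image)
    then show ?thesis by (simp only: surj)
  qed
  have s: "\<bar>\<sigma>\<bar> = 1" using \<sigma> by auto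
  show ?thesis
    unfolding c1_norm_def loops1_affine(2)[OF u \<sigma> orthogonal_transformation_linear[OF A]]
      norm_scaleR s mult_1 orthogonal_transformation_norm[OF A]
      *[of "\<lambda>t. norm (u t)"] *[of "\<lambda>t. norm (vector_derivative u (at t))"] ..
qed

lemma S0_rot: "S0 (rot \<theta> z) = rot \<theta> (S0 z)"
  by (simp add: S0_def rot_def cis_cnj)

lemma S0_S0: "S0 (S0 z) = z"
  by (simp add: S0_def)

lemma c1_norm_zero [simp]: "c1_norm (\<lambda>_. 0) = 0"
  by (simp add: c1_norm_def)

locale liapunov_schmidt = resonant_linear_part L Psi proj
  for L :: "'a::euclidean_space \<Rightarrow> 'a" and Psi :: "c2 \<Rightarrow> 'a" and proj :: "'a \<Rightarrow> c2" +
  fixes f R S :: "'a \<Rightarrow> 'a" and ip :: "'a loop_form" and U :: "(c2 \<times> real) set"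
    and W :: "c2 \<Rightarrow> real \<Rightarrow> real \<Rightarrow> 'a" and h :: "c2 \<Rightarrow> real \<Rightarrow> real"
  assumes f: "ck_on (Suc 0) f UNIV" and f_0: "f 0 = 0" and f_L: "(f has_derivative L) (at 0)"
    and R: "orthogonal_transformation R" "\<And>x. f (R x) = - R (f x)" "\<And>z. R (Psi z) = Psi (R0 z)"
    and S: "orthogonal_transformation S" "\<And>x. f (S x) = S (f x)" "\<And>z. S (Psi z) = Psi (S0 z)"
    and ip: "invariant_inner R S ip" "loop_orth ip (range_Phi L) = range (lin_loop Psi)"
    and W: "implicit_solution f L ip Psi U W"
    and h: "reduced_hamiltonian f L ip Psi U W h"
begin

definition loop_of :: "c2 \<Rightarrow> real \<Rightarrow> real \<Rightarrow> 'a" where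
  "loop_of z \<tau> = (\<lambda>t. lin_loop Psi z t + W z \<tau> t)"

lemma ip_commute: "u \<in> loops \<Longrightarrow> v \<in> loops \<Longrightarrow> ip u v = ip v u"
  and ip_linear: "u \<in> loops \<Longrightarrow> v \<in> loops \<Longrightarrow> w \<in> loops \<Longrightarrow>
      ip (\<lambda>t. a *\<^sub>R u t + b *\<^sub>R v t) w = a * ip u w + b * ip v w"
  and ip_pos: "u \<in> loops \<Longrightarrow> u \<noteq> (\<lambda>_. 0) \<Longrightarrow> ip u u > 0"
  and ip_shift: "u \<in> loops \<Longrightarrow> v \<in> loops \<Longrightarrow> ip (\<lambda>t. u (t + \<theta>)) (\<lambda>t. v (t + \<theta>)) = ip u v"
  and ip_R: "u \<in> loops \<Longrightarrow> v \<in> loops \<Longrightarrow> ip (\<lambda>t. R (u (- t))) (\<lambda>t. R (v (- t))) = ip u v"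
  and ip_S: "u \<in> loops \<Longrightarrow> v \<in> loops \<Longrightarrow> ip (\<lambda>t. S (u t)) (\<lambda>t. S (v t)) = ip u v"
  using ip(1) unfolding invariant_inner_def by blast+

lemma avg_diff:
  "u \<in> loops \<Longrightarrow> v \<in> loops \<Longrightarrow> avg (\<lambda>t. u t - v t) = avg u - avg v"
  using avg_lin_combo[of u v 1 "- 1"] by simp

lemma avg_add:
  "u \<in> loops \<Longrightarrow> v \<in> loops \<Longrightarrow> avg (\<lambda>t. u t + v t) = avg u + avg v"
  using avg_lin_combo[of u v 1 1] by simp

lemma range_complement:
  assumes "y \<in> loops"
  shows "(\<lambda>t. y t - lin_loop Psi (avg y) t) \<in> range_Phi L"
  unfolding range_Phi_eq using assms by (simp add: diff_loops avg_diff lin_loop_loops)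

text \<open>This links the symplectic average to orthogonality for \<open>ip\<close>. Subtracting
  the loop v of \<open>avg w\<close> from \<open>w\<close> leaves an element of the range, to which
  v is orthogonal; hence ip v v = ip w v = 0, and positivity gives v = 0.\<close>

lemma avg_orth_ker:
  assumes w: "w \<in> loop_orth ip (ker_Phi L)"
  shows "avg w = 0"
proof (rule ccontr)
  assume "avg w \<noteq> 0"
  let ?v = "lin_loop Psi (avg w)" and ?r = "\<lambda>t. w t - lin_loop Psi (avg w) t"
  have wl: "w \<in> loops" using w by (simp add: loop_orth_def)
  have rl: "?r \<in> loops" by (rule diff_loops[OF wl lin_loop_loops])
  have "ip w ?v = 0" using w unfolding loop_orth_def ker_Phi_eq by blast
  moreover have "ip ?r ?v = 0"
  proof -
    have "?v \<in> loop_orth ip (range_Phi L)" by (simp add: ip(2))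
    then have "ip ?v ?r = 0" using range_complement[OF wl] unfolding loop_orth_def by blast
    then show ?thesis using ip_commute[OF rl lin_loop_loops] by simp
  qed
  moreover have "ip ?r ?v = ip w ?v - ip ?v ?v"
    using ip_linear[OF wl lin_loop_loops lin_loop_loops, of 1 "- 1" "avg w" "avg w"] by simp
  ultimately have "ip ?v ?v = 0" by simp
  moreover have "?v \<noteq> (\<lambda>_. 0)"
  proof
    assume "?v = (\<lambda>_. 0)"
    moreover have "lin_loop Psi 0 = (\<lambda>_. 0)" by (rule ext) simp
    ultimately have "?v = lin_loop Psi 0" by (simp only:)
    then show False using \<open>avg w \<noteq> 0\<close> by simp
  qed
  ultimately show False using ip_pos[OF lin_loop_loops, of "avg w"] by simp
qed

text \<open>The description in \<open>range_proj\<close> has a single solution because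
  \<open>avg\<close> kills the range and recovers the coefficient of the complement. The orthogonal
  projection thereby becomes a formula free of \<open>ip\<close>.\<close>

lemma range_proj_eq:
  assumes y: "y \<in> loops"
  shows "range_proj L ip y = (\<lambda>t. y t - lin_loop Psi (avg y) t)"
  unfolding range_proj_def
proof (rule the_equality)
  show "(\<lambda>t. y t - lin_loop Psi (avg y) t) \<in> range_Phi L \<and>
      (\<lambda>t. y t - (y t - lin_loop Psi (avg y) t)) \<in> loop_orth ip (range_Phi L)"
    using range_complement[OF y] by (simp add: ip(2))
next
  fix r assume r: "r \<in> range_Phi L \<and> (\<lambda>t. y t - r t) \<in> loop_orth ip (range_Phi L)"
  then obtain \<zeta> where \<zeta>: "(\<lambda>t. y t - r t) = lin_loop Psi \<zeta>" by (auto simp: ip(2))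
  have "r \<in> loops" "avg r = 0" using r by (auto simp: range_Phi_eq)
  then have "avg (\<lambda>t. y t - r t) = avg y" using y by (simp add: avg_diff)
  then have "\<zeta> = avg y" using \<zeta> by simp
  then show "r = (\<lambda>t. y t - lin_loop Psi (avg y) t)"
    using fun_cong[OF \<zeta>] by (auto simp: fun_eq_iff algebra_simps)
qed

lemma range_proj_0_iff:
  assumes y: "y \<in> loops"
  shows "range_proj L ip y = (\<lambda>_. 0) \<longleftrightarrow> (\<exists>\<zeta>. y = lin_loop Psi \<zeta>)"
proof
  assume "range_proj L ip y = (\<lambda>_. 0)"
  then have "y = lin_loop Psi (avg y)" unfolding range_proj_eq[OF y] by (simp add: fun_eq_iff)
  then show "\<exists>\<zeta>. y = lin_loop Psi \<zeta>" ..
next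
  assume "\<exists>\<zeta>. y = lin_loop Psi \<zeta>"
  then obtain \<zeta> where "y = lin_loop Psi \<zeta>" by blast
  then have "lin_loop Psi (avg y) = y" by simp
  then show "range_proj L ip y = (\<lambda>_. 0)" unfolding range_proj_eq[OF y] by simp
qed

lemma Phi_loops:
  assumes "u \<in> loops1"
  shows "Phi f u \<tau> \<in> loops"
proof -
  have u: "continuous_on UNIV u" "continuous_on UNIV (\<lambda>t. vector_derivative u (at t))"
    "\<And>t. u (t + 2 * pi) = u t" "\<And>t. vector_derivative u (at (t + 2 * pi)) = vector_derivative u (at t)"
    using loops1_subset_loops[OF assms] loops1_deriv_loops[OF assms] by (auto simp: loops_def)
  have "continuous_on UNIV (\<lambda>t. f (u t))"
    by (rule continuous_on_compose2[OF ck_on_1D(3)[OF f] u(1)]) simp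
  then have "continuous_on UNIV (\<lambda>t. (1 + \<tau>) *\<^sub>R vector_derivative u (at t) - f (u t))"
    by (rule continuous_on_diff[OF continuous_on_scaleR[OF continuous_on_const u(2)]])
  then show ?thesis unfolding Phi_def loops_def by (simp add: u(3,4))
qed

text \<open>Fixing the radius once makes the uniqueness clause available with the same ball at a
  point and at its image under a symmetry.\<close>

definition implicit_radius :: real where
  "implicit_radius = (SOME r. r > 0 \<and> (\<forall>(z, \<tau>)\<in>U. \<forall>w. w = W z \<tau> \<longleftrightarrow>
     w \<in> loops1 \<and> w \<in> loop_orth ip (ker_Phi L) \<and> c1_norm w < r \<and>
     range_proj L ip (Phi f (\<lambda>t. lin_loop Psi z t + w t) \<tau>) = (\<lambda>_. 0)))"

lemma implicit_radius:
  shows implicit_radius_pos: "implicit_radius > 0"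
    and W_iff: "(z, \<tau>) \<in> U \<Longrightarrow> w = W z \<tau> \<longleftrightarrow>
      w \<in> loops1 \<and> w \<in> loop_orth ip (ker_Phi L) \<and> c1_norm w < implicit_radius \<and>
      range_proj L ip (Phi f (\<lambda>t. lin_loop Psi z t + w t) \<tau>) = (\<lambda>_. 0)"
proof -
  let ?P = "\<lambda>r z \<tau> w. w = W z \<tau> \<longleftrightarrow> w \<in> loops1 \<and> w \<in> loop_orth ip (ker_Phi L) \<and> c1_norm w < r \<and>
      range_proj L ip (Phi f (\<lambda>t. lin_loop Psi z t + w t) \<tau>) = (\<lambda>_. 0)"
  have "\<exists>r>0. \<forall>(z, \<tau>)\<in>U. \<forall>w. ?P r z \<tau> w"
    using W unfolding implicit_solution_def by (elim conjE)
  from someI_ex[OF this]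
  have r: "implicit_radius > 0 \<and> (\<forall>(z, \<tau>)\<in>U. \<forall>w. ?P implicit_radius z \<tau> w)"
    unfolding implicit_radius_def .
  then show "implicit_radius > 0" ..
  show "?P implicit_radius z \<tau> w" if "(z, \<tau>) \<in> U"
    using bspec[OF conjunct2[OF r] that] unfolding prod.case by (rule spec)
qed

lemma U: "open U" "(0, 0) \<in> U"
  using W by (simp_all add: implicit_solution_def)

lemma W_props:
  assumes "(z, \<tau>) \<in> U"
  shows "W z \<tau> \<in> loops1" "W z \<tau> \<in> loop_orth ip (ker_Phi L)"
    "range_proj L ip (Phi f (loop_of z \<tau>) \<tau>) = (\<lambda>_. 0)"
proof -
  from iffD1[OF W_iff[OF assms] refl]
  show "W z \<tau> \<in> loops1" "W z \<tau> \<in> loop_orth ip (ker_Phi L)"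
    "range_proj L ip (Phi f (loop_of z \<tau>) \<tau>) = (\<lambda>_. 0)"
    unfolding loop_of_def by simp_all
qed

lemma loop_of_loops1: "(z, \<tau>) \<in> U \<Longrightarrow> loop_of z \<tau> \<in> loops1"
  using lin_combo_loops1(1)[OF lin_loop_loops1 W_props(1), of z \<tau> 1 z 1] by (simp add: loop_of_def)

lemma vector_derivative_loop_of:
  "(z, \<tau>) \<in> U \<Longrightarrow> vector_derivative (loop_of z \<tau>) (at t) =
    lin_loop Psi (L0 z) t + vector_derivative (W z \<tau>) (at t)"
  using lin_combo_loops1(2)[OF lin_loop_loops1 W_props(1), of z \<tau> 1 z 1] by (simp add: loop_of_def)

lemma avg_loop_of: "(z, \<tau>) \<in> U \<Longrightarrow> avg (loop_of z \<tau>) = z"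
  using avg_add[OF lin_loop_loops loops1_subset_loops[OF W_props(1)], of z \<tau> z]
    avg_orth_ker[OF W_props(2), of z \<tau>]
  by (simp add: loop_of_def)

lemma reduced_field_eq:
  assumes "(z, \<tau>) \<in> U"
  shows "reduced_field f L ip Psi W z \<tau> = avg (Phi f (loop_of z \<tau>) \<tau>)"
    and "Phi f (loop_of z \<tau>) \<tau> = lin_loop Psi (avg (Phi f (loop_of z \<tau>) \<tau>))"
proof -
  let ?y = "Phi f (loop_of z \<tau>) \<tau>"
  have y: "?y \<in> loops" by (rule Phi_loops[OF loop_of_loops1[OF assms]])
  then show eq: "?y = lin_loop Psi (avg ?y)"
    using W_props(3)[OF assms] range_proj_0_iff[OF y] by force
  have "(\<lambda>t. ?y t - range_proj L ip ?y t) = lin_loop Psi (avg ?y)"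
    unfolding range_proj_eq[OF y] by (rule ext) simp
  then show "reduced_field f L ip Psi W z \<tau> = avg ?y"
    by (simp add: reduced_field_def loop_of_def[symmetric])
qed

text \<open>The sign \<open>\<sigma> = - 1\<close> stands for a reversing symmetry; \<open>a\<close> is the induced action on the coordinates \<open>z\<close>.\<close>

definition loop_symmetry :: "('a \<Rightarrow> 'a) \<Rightarrow> real \<Rightarrow> real \<Rightarrow> (c2 \<Rightarrow> c2) \<Rightarrow> (c2 \<Rightarrow> c2) \<Rightarrow> bool" where
  "loop_symmetry A \<sigma> \<theta> a b \<longleftrightarrow> orthogonal_transformation A \<and> (\<sigma> = 1 \<or> \<sigma> = - 1) \<and>
     (\<forall>x. f (A x) = \<sigma> *\<^sub>R A (f x)) \<and>
     (\<forall>z t. A (lin_loop Psi z (\<sigma> * t + \<theta>)) = lin_loop Psi (a z) t) \<and> (\<forall>z. a (b z) = z) \<and>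
     (\<forall>u\<in>loops. \<forall>v\<in>loops. ip (\<lambda>t. A (u (\<sigma> * t + \<theta>))) (\<lambda>t. A (v (\<sigma> * t + \<theta>))) = ip u v)"

lemma loop_symmetry_shift: "loop_symmetry (\<lambda>x. x) 1 \<theta> (rot \<theta>) (rot (- \<theta>))"
proof -
  have "orthogonal_transformation (\<lambda>x::'a. x)" by (simp add: orthogonal_transformation_def)
  then show ?thesis
    by (simp add: loop_symmetry_def ip_shift lin_loop_eq rot_add)
qed

lemma loop_symmetry_S: "loop_symmetry S 1 \<theta> (\<lambda>z. S0 (rot \<theta> z)) (\<lambda>z. rot (- \<theta>) (S0 z))"
  unfolding loop_symmetry_def
proof (intro conjI allI ballI)
  show "S (lin_loop Psi z (1 * t + \<theta>)) = lin_loop Psi (S0 (rot \<theta> z)) t" for z t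
    by (simp add: lin_loop_eq S(3) S0_rot rot_add)
  show "S0 (rot \<theta> (rot (- \<theta>) (S0 z))) = z" for z by (simp add: S0_rot S0_S0)
  show "f (S x) = 1 *\<^sub>R S (f x)" for x by (simp add: S)
  fix u v :: "real \<Rightarrow> 'a" assume uv: "u \<in> loops" "v \<in> loops"
  then have "(\<lambda>t. u (t + \<theta>)) \<in> loops" "(\<lambda>t. v (t + \<theta>)) \<in> loops"
    using loops_affine[of _ 1 \<theta>] by simp_all
  from ip_S[OF this] ip_shift[OF uv]
  show "ip (\<lambda>t. S (u (1 * t + \<theta>))) (\<lambda>t. S (v (1 * t + \<theta>))) = ip u v" by simp
qed (simp_all add: S)

lemma loop_symmetry_R: "loop_symmetry R (- 1) 0 R0 R0"
  unfolding loop_symmetry_def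
proof (intro conjI allI ballI)
  show "R (lin_loop Psi z (- 1 * t + 0)) = lin_loop Psi (R0 z) t" for z t
    by (simp add: lin_loop_eq R(3)) (simp add: R0_def rot_def)
qed (simp_all add: R R0_def ip_R)

text \<open>The right inverse \<open>b\<close> presents every kernel loop as the image of a kernel
  loop; invariance of \<open>ip\<close> then removes the symmetry from both arguments.\<close>

lemma loop_symmetry_orth:
  assumes sym: "loop_symmetry A \<sigma> \<theta> a b" and w: "w \<in> loop_orth ip (ker_Phi L)"
  shows "(\<lambda>t. A (w (\<sigma> * t + \<theta>))) \<in> loop_orth ip (ker_Phi L)"
proof -
  have A: "linear A" and \<sigma>: "\<sigma> = 1 \<or> \<sigma> = - 1"
    using sym by (auto simp: loop_symmetry_def orthogonal_transformation_linear)
  have wl: "w \<in> loops" using w by (simp add: loop_orth_def)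
  have "ip (\<lambda>t. A (w (\<sigma> * t + \<theta>))) (lin_loop Psi z) = 0" for z
  proof -
    have "lin_loop Psi z = (\<lambda>t. A (lin_loop Psi (b z) (\<sigma> * t + \<theta>)))"
    proof (rule ext)
      have "A (lin_loop Psi (b z) (\<sigma> * t + \<theta>)) = lin_loop Psi (a (b z)) t" "a (b z) = z" for t
        using sym unfolding loop_symmetry_def by blast+
      then show "lin_loop Psi z t = A (lin_loop Psi (b z) (\<sigma> * t + \<theta>))" for t by simp
    qed
    then have "ip (\<lambda>t. A (w (\<sigma> * t + \<theta>))) (lin_loop Psi z) = ip w (lin_loop Psi (b z))"
      using sym wl lin_loop_loops[of "b z"] unfolding loop_symmetry_def by metis
    moreover have "ip w (lin_loop Psi (b z)) = 0" using w unfolding loop_orth_def ker_Phi_eq by blast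
    ultimately show ?thesis by simp
  qed
  moreover have "(\<lambda>t. A (w (\<sigma> * t + \<theta>))) \<in> loops"
    by (rule linear_loops[OF A loops_affine[OF wl \<sigma>]])
  ultimately show ?thesis by (auto simp: loop_orth_def ker_Phi_eq)
qed

text \<open>The transform of W(z, \<tau>) has all the properties that characterize W(a z, \<tau>),
  so uniqueness identifies them. Both points are required to lie in \<open>U\<close>, as
  \<open>U\<close> itself is not assumed to be invariant.\<close>

lemma loop_of_symmetry:
  assumes sym: "loop_symmetry A \<sigma> \<theta> a b" and U: "(z, \<tau>) \<in> U" "(a z, \<tau>) \<in> U"
  shows "loop_of (a z) \<tau> t = A (loop_of z \<tau> (\<sigma> * t + \<theta>))"
proof -
  have A: "orthogonal_transformation A" and \<sigma>: "\<sigma> = 1 \<or> \<sigma> = - 1"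
    and fA: "\<And>x. f (A x) = \<sigma> *\<^sub>R A (f x)"
    and lin: "\<And>z t. A (lin_loop Psi z (\<sigma> * t + \<theta>)) = lin_loop Psi (a z) t"
    using sym unfolding loop_symmetry_def by blast+
  have lA: "linear A" by (rule orthogonal_transformation_linear[OF A])
  define w where "w t = A (W z \<tau> (\<sigma> * t + \<theta>))" for t
  have Tu: "lin_loop Psi (a z) t + w t = A (loop_of z \<tau> (\<sigma> * t + \<theta>))" for t
    by (simp add: w_def loop_of_def linear_add[OF lA] lin)
  have "w = W (a z) \<tau>"
    unfolding W_iff[OF U(2)]
  proof (intro conjI)
    show w1: "w \<in> loops1"
      unfolding w_def[abs_def] by (rule loops1_affine(1)[OF W_props(1)[OF U(1)] \<sigma> lA])
    show "w \<in> loop_orth ip (ker_Phi L)"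
      unfolding w_def[abs_def] by (rule loop_symmetry_orth[OF sym W_props(2)[OF U(1)]])
    show "c1_norm w < implicit_radius"
      unfolding w_def[abs_def] c1_norm_affine[OF W_props(1)[OF U(1)] \<sigma> A]
      using iffD1[OF W_iff[OF U(1)] refl] by (elim conjE)
    \<comment> \<open>Vanishing of the range component means that \<open>Phi\<close> of the loop is
      itself a kernel loop; symmetries map kernel loops to kernel loops, up to the sign
      \<sigma>.\<close>
    obtain \<zeta> where \<zeta>: "Phi f (loop_of z \<tau>) \<tau> = lin_loop Psi \<zeta>"
      using reduced_field_eq(2)[OF U(1)] by blast
    have "Phi f (\<lambda>t. lin_loop Psi (a z) t + w t) \<tau> t = \<sigma> *\<^sub>R A (Phi f (loop_of z \<tau>) \<tau> (\<sigma> * t + \<theta>))" for t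
      unfolding Tu Phi_def loops1_affine(2)[OF loop_of_loops1[OF U(1)] \<sigma> lA] fA
      by (simp add: linear_diff[OF lA] linear_scale[OF lA] scaleR_diff_right)
    then have "Phi f (\<lambda>t. lin_loop Psi (a z) t + w t) \<tau> t = lin_loop Psi (\<sigma> *\<^sub>R a \<zeta>) t" for t
      by (simp add: \<zeta> lin linear_scale[OF lin_loop_linear])
    then have "Phi f (\<lambda>t. lin_loop Psi (a z) t + w t) \<tau> = lin_loop Psi (\<sigma> *\<^sub>R a \<zeta>)" by (rule ext)
    then show "range_proj L ip (Phi f (\<lambda>t. lin_loop Psi (a z) t + w t) \<tau>) = (\<lambda>_. 0)"
      using range_proj_0_iff[OF lin_loop_loops] by simp
  qed
  then show ?thesis using Tu[of t] by (simp add: loop_of_def)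
qed

text \<open>The transformed \<open>W\<close> stays orthogonal to the kernel and so has average 0.
  This identity recovers the action on \<open>z\<close> from an action on loops.\<close>

lemma avg_loop_of_symmetry:
  assumes sym: "loop_symmetry A \<sigma> \<theta> a b" and U: "(z, \<tau>) \<in> U"
  shows "avg (\<lambda>t. A (loop_of z \<tau> (\<sigma> * t + \<theta>))) = a z"
proof -
  have "orthogonal_transformation A" and lin: "\<And>z t. A (lin_loop Psi z (\<sigma> * t + \<theta>)) = lin_loop Psi (a z) t"
    using sym unfolding loop_symmetry_def by blast+
  then have A: "linear A" by (simp add: orthogonal_transformation_linear)
  have "(\<lambda>t. A (W z \<tau> (\<sigma> * t + \<theta>))) \<in> loop_orth ip (ker_Phi L)"
    by (rule loop_symmetry_orth[OF sym W_props(2)[OF U]])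
  then have "avg (\<lambda>t. A (W z \<tau> (\<sigma> * t + \<theta>))) = 0" "(\<lambda>t. A (W z \<tau> (\<sigma> * t + \<theta>))) \<in> loops"
    by (simp_all add: avg_orth_ker) (simp add: loop_orth_def)
  then show ?thesis
    by (simp add: loop_of_def linear_add[OF A] lin avg_add lin_loop_loops)
qed

text \<open>The equilibrium is a solution for every \<tau>, and the zero loop satisfies the
  conditions that determine \<open>W\<close>.\<close>

lemma W_0:
  assumes "(0, \<tau>) \<in> U"
  shows "W 0 \<tau> = (\<lambda>_. 0)"
proof -
  have z: "lin_loop Psi 0 = (\<lambda>_. 0)" by (rule ext) simp
  have z1: "(\<lambda>_. 0::'a) \<in> loops1" using lin_loop_loops1[of 0] unfolding z .
  have "ip (\<lambda>_. 0) v = 0" if "v \<in> loops" for v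
    using ip_linear[OF that that that, of 0 0] by simp
  then have orth: "(\<lambda>_. 0) \<in> loop_orth ip (ker_Phi L)"
    using loops1_subset_loops[OF z1] lin_loop_loops unfolding loop_orth_def ker_Phi_eq by blast
  have c1: "c1_norm (\<lambda>_. 0::'a) < implicit_radius" using implicit_radius_pos by simp
  have "Phi f (\<lambda>t. lin_loop Psi 0 t + 0) \<tau> = lin_loop Psi 0"
    by (rule ext) (simp add: Phi_def f_0)
  then have "\<exists>\<zeta>. Phi f (\<lambda>t. lin_loop Psi 0 t + 0) \<tau> = lin_loop Psi \<zeta>" by (rule exI)
  moreover have "Phi f (\<lambda>t. lin_loop Psi 0 t + 0) \<tau> \<in> loops"
    by (rule Phi_loops) (simp add: z1)
  ultimately have rp: "range_proj L ip (Phi f (\<lambda>t. lin_loop Psi 0 t + 0) \<tau>) = (\<lambda>_. 0)"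
    by (rule range_proj_0_iff[THEN iffD2, rotated])
  show ?thesis
    by (rule sym, rule iffD2[OF W_iff[OF assms] conjI[OF z1 conjI[OF orth conjI[OF c1 rp]]]])
qed

end

section \<open>From zeros of the reduced field to families of periodic orbits\<close>

lemma norm_R0 [simp]: "norm (R0 z) = norm z"
  and norm_S0 [simp]: "norm (S0 z) = norm z"
  by (simp_all add: R0_def S0_def norm_prod_def add.commute)

text \<open>The circle acts with weights 1 and -1, hence freely away from the origin. This freeness
  becomes minimality of the period.\<close>

lemma rot_fixed_imp_0:
  assumes "rot \<theta> z = z" "0 < \<theta>" "\<theta> < 2 * pi"
  shows "z = 0"
proof -
  have "cos \<theta> \<noteq> 1"
  proof
    assume "cos \<theta> = 1"
    then obtain k :: int where k: "\<theta> = of_int k * 2 * pi" by (auto simp: cos_one_2pi_int)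
    then have "0 < of_int k * (2 * pi)" "of_int k * (2 * pi) < 1 * (2 * pi)" using assms by simp_all
    then have "0 < k" "k < 1"
      by (simp_all add: zero_less_mult_iff mult_less_cancel_right_pos)
    then show False by simp
  qed
  then have "cis \<theta> \<noteq> 1" "cis (- \<theta>) \<noteq> 1" by (auto simp: complex_eq_iff)
  then show ?thesis
    using assms(1) by (simp add: rot_def prod_eq_iff)
qed

context liapunov_schmidt
begin

section \<open>Periodic solutions from zeros of the reduced field\<close>

lemma lifted_eq: "lifted Psi W z \<tau> t = loop_of z \<tau> ((1 + \<tau>) * t)"
  by (simp add: lifted_def loop_of_def)

lemma critical_Phi:
  assumes U: "(z, \<tau>) \<in> U" and crit: "grad (\<lambda>z. h z \<tau>) z = 0"
  shows "Phi f (loop_of z \<tau>) \<tau> t = 0"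
proof -
  have "reduced_field f L ip Psi W z \<tau> = J0 (grad (\<lambda>z. h z \<tau>) z)"
    using h U unfolding reduced_hamiltonian_def by blast
  then have "avg (Phi f (loop_of z \<tau>) \<tau>) = 0"
    using reduced_field_eq(1)[OF U] crit by (simp add: J0_def zero_prod_def)
  then show ?thesis
    using fun_cong[OF reduced_field_eq(2)[OF U], of t] by simp
qed

lemma solution_of_lifted:
  assumes U: "(z, \<tau>) \<in> U" and crit: "grad (\<lambda>z. h z \<tau>) z = 0"
  shows "solution_of f (lifted Psi W z \<tau>)"
  unfolding solution_of_def
proof
  fix t
  have "((\<lambda>t. (1 + \<tau>) * t) has_vector_derivative (1 + \<tau>)) (at t)"
    by (auto intro!: derivative_eq_intros)
  from vector_diff_chain_at[OF this loops1_has_vector_derivative[OF loop_of_loops1[OF U]]]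
  have "(lifted Psi W z \<tau> has_vector_derivative
      (1 + \<tau>) *\<^sub>R vector_derivative (loop_of z \<tau>) (at ((1 + \<tau>) * t))) (at t)"
    by (simp add: o_def lifted_eq[abs_def])
  moreover have "(1 + \<tau>) *\<^sub>R vector_derivative (loop_of z \<tau>) (at ((1 + \<tau>) * t)) = f (lifted Psi W z \<tau> t)"
    using critical_Phi[OF assms, of "(1 + \<tau>) * t"] by (simp add: Phi_def lifted_eq)
  ultimately show "(lifted Psi W z \<tau> has_vector_derivative f (lifted Psi W z \<tau> t)) (at t)"
    by simp
qed

lemma loop_of_shift_unique:
  assumes U: "(z, \<tau>) \<in> U" "(z', \<tau>) \<in> U" and eq: "\<And>t. loop_of z' \<tau> t = loop_of z \<tau> (t + \<theta>)"
  shows "z' = rot \<theta> z"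
proof -
  have "avg (\<lambda>t. loop_of z \<tau> (1 * t + \<theta>)) = rot \<theta> z"
    by (rule avg_loop_of_symmetry[OF loop_symmetry_shift U(1)])
  moreover have "avg (\<lambda>t. loop_of z \<tau> (1 * t + \<theta>)) = avg (loop_of z' \<tau>)"
    by (rule avg_cong) (simp add: eq)
  ultimately show ?thesis using avg_loop_of[OF U(2)] by simp
qed

text \<open>A smaller period s would make the loop invariant under the shift by (1 + \<tau>) s, so
  the corresponding rotation would fix \<open>z\<close>.\<close>

lemma periodic_solution_lifted:
  assumes U: "(z, \<tau>) \<in> U" and crit: "grad (\<lambda>z. h z \<tau>) z = 0" and z: "z \<noteq> 0" and \<tau>: "1 + \<tau> > 0"
  shows "periodic_solution f (2 * pi / (1 + \<tau>)) (lifted Psi W z \<tau>)"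
  unfolding periodic_solution_def
proof (intro conjI allI impI)
  show "solution_of f (lifted Psi W z \<tau>)" by (rule solution_of_lifted[OF U crit])
  show "2 * pi / (1 + \<tau>) > 0" using \<tau> by simp
  have per: "loop_of z \<tau> (t + 2 * pi) = loop_of z \<tau> t" for t
    using loop_of_loops1[OF U] by (simp add: loops1_def)
  show "lifted Psi W z \<tau> (t + 2 * pi / (1 + \<tau>)) = lifted Psi W z \<tau> t" for t
  proof -
    have "(1 + \<tau>) * (t + 2 * pi / (1 + \<tau>)) = (1 + \<tau>) * t + 2 * pi"
      using \<tau> by (simp add: distrib_left)
    then show ?thesis unfolding lifted_eq using per by simp
  qed
  fix s assume s: "0 < s \<and> s < 2 * pi / (1 + \<tau>)"
  show "\<exists>t. lifted Psi W z \<tau> (t + s) \<noteq> lifted Psi W z \<tau> t"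
  proof (rule ccontr)
    assume "\<not> ?thesis"
    then have *: "loop_of z \<tau> ((1 + \<tau>) * (t + s)) = loop_of z \<tau> ((1 + \<tau>) * t)" for t
      by (simp add: lifted_eq)
    have "loop_of z \<tau> t = loop_of z \<tau> (t + (1 + \<tau>) * s)" for t
    proof -
      have "(1 + \<tau>) * (t / (1 + \<tau>) + s) = t + (1 + \<tau>) * s" "(1 + \<tau>) * (t / (1 + \<tau>)) = t"
        using \<tau> by (simp_all add: distrib_left)
      then show ?thesis using *[of "t / (1 + \<tau>)"] by simp
    qed
    then have "z = rot ((1 + \<tau>) * s) z" by (rule loop_of_shift_unique[OF U U])
    moreover have "0 < (1 + \<tau>) * s" "(1 + \<tau>) * s < 2 * pi"
      using s \<tau> by (simp_all add: pos_less_divide_eq mult.commute)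
    ultimately show False using rot_fixed_imp_0 z by metis
  qed
qed

text \<open>Continuity of \<open>W\<close> at a point where it vanishes. General \<tau>0 is allowed
  because the expansion of the reduced field is made at each fixed \<tau>, not only at 0.\<close>

lemma small_W:
  assumes U0: "(0, \<tau>0) \<in> U" and "\<eta> > 0"
  obtains d where "d > 0"
    "\<And>z \<tau>. norm z < d \<Longrightarrow> \<bar>\<tau> - \<tau>0\<bar> < d \<Longrightarrow> (z, \<tau>) \<in> U \<and> c1_norm (W z \<tau>) < \<eta>"
proof -
  have lim: "((\<lambda>(z', \<tau>'). c1_norm (\<lambda>t. W z' \<tau>' t - W 0 \<tau>0 t)) \<longlongrightarrow> 0) (at (0, \<tau>0))"
    using W U0 unfolding implicit_solution_def by blast
  obtain e where e0: "e > 0" "\<And>x. x \<noteq> (0, \<tau>0) \<Longrightarrow> dist x (0, \<tau>0) < e \<Longrightarrow>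
      dist ((\<lambda>(z', \<tau>'). c1_norm (\<lambda>t. W z' \<tau>' t - W 0 \<tau>0 t)) x) 0 < \<eta>"
    using tendstoD[OF lim \<open>\<eta> > 0\<close>] unfolding eventually_at by blast
  have e: "e > 0" "\<And>x. x \<noteq> (0, \<tau>0) \<Longrightarrow> dist x (0, \<tau>0) < e \<Longrightarrow> c1_norm (W (fst x) (snd x)) < \<eta>"
    using e0(1) e0(2)[unfolded split_def W_0[OF U0]] by (simp_all add: dist_real_def abs_less_iff)
  obtain e' where e': "e' > 0" "ball (0, \<tau>0) e' \<subseteq> U"
    using U(1) U0 by (meson openE)
  show ?thesis
  proof (rule that[of "min e e' / 2"])
    fix z :: c2 and \<tau> assume *: "norm z < min e e' / 2" "\<bar>\<tau> - \<tau>0\<bar> < min e e' / 2"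
    have "dist (z, \<tau>) (0, \<tau>0) \<le> norm z + \<bar>\<tau> - \<tau>0\<bar>"
      using norm_Pair_le[of z "\<tau> - \<tau>0"] by (simp add: dist_norm)
    then have d: "dist (z, \<tau>) (0, \<tau>0) < min e e'" using * by linarith
    then have "(z, \<tau>) \<in> ball (0, \<tau>0) e'" by (simp add: dist_commute)
    then have "(z, \<tau>) \<in> U" using e'(2) by (rule rev_subsetD)
    moreover have "c1_norm (W z \<tau>) < \<eta>"
    \<comment> \<open>The limit says nothing about the centre itself, where \<open>W_0\<close>
      applies.\<close>
    proof (cases "(z, \<tau>) = (0, \<tau>0)")
      case True
      then show ?thesis using \<open>\<eta> > 0\<close> W_0[OF U0] by simp
    next
      case False
      then show ?thesis using e(2)[OF False] d by simp
    qed
    ultimately show "(z, \<tau>) \<in> U \<and> c1_norm (W z \<tau>) < \<eta>" ..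
  qed (use e e' in simp)
qed

lemma norm_lin_loop_le:
  obtains M where "M > 0" "\<And>z t. norm (lin_loop Psi z t) \<le> M * norm z"
proof -
  obtain M where "M > 0" "\<And>z. norm (Psi z) \<le> M * norm z"
    using linear_bounded_pos[OF Psi] by blast
  then show ?thesis using that[of M] by (metis lin_loop_eq norm_rot)
qed

lemma norm_loop_of_le:
  assumes "(z, \<tau>) \<in> U" and M: "\<And>z t. norm (lin_loop Psi z t) \<le> M * norm z"
  shows "norm (loop_of z \<tau> t) \<le> M * norm z + c1_norm (W z \<tau>)"
  using norm_triangle_ineq[of "lin_loop Psi z t" "W z \<tau> t"] M[of z t]
    norm_le_c1_norm(1)[OF W_props(1)[OF assms(1)], of t]
  unfolding loop_of_def by linarith

text \<open>Convergence in the C^1 norm is uniform in \<open>t\<close>; together with continuity of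
  the single loop \<open>W z \<tau>\<close> it gives joint continuity.\<close>

lemma continuous_on_W: "continuous_on (U \<times> UNIV) (\<lambda>(x, t). W (fst x) (snd x) t)"
proof (rule continuous_at_imp_continuous_on, safe)
  fix z \<tau> and t :: real assume U0: "(z, \<tau>) \<in> U"
  let ?D = "\<lambda>x. c1_norm (\<lambda>t. W (fst x) (snd x) t - W z \<tau> t)"
  have "(?D \<longlongrightarrow> ?D (z, \<tau>)) (at (z, \<tau>))"
    using W U0 unfolding implicit_solution_def by (auto simp: split_def)
  then have "isCont ?D (z, \<tau>)" by (simp add: isCont_def)
  then have D: "((\<lambda>y. ?D (fst y)) \<longlongrightarrow> ?D (fst ((z, \<tau>), t))) (at ((z, \<tau>), t))"
    by (intro isCont_tendsto_compose[of "fst ((z, \<tau>), t)" ?D] tendsto_fst tendsto_ident_at) simp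
  have "continuous_on UNIV (W z \<tau>)"
    using loops1_subset_loops[OF W_props(1)[OF U0]] by (simp add: loops_def)
  then have "isCont (W z \<tau>) t" by (simp add: continuous_on_eq_continuous_at)
  then have C: "((\<lambda>y. W z \<tau> (snd y)) \<longlongrightarrow> W z \<tau> (snd ((z, \<tau>), t))) (at ((z, \<tau>), t))"
    by (intro isCont_tendsto_compose[of "snd ((z, \<tau>), t)" "W z \<tau>"] tendsto_snd tendsto_ident_at) simp
  have "eventually (\<lambda>y. y \<in> U \<times> UNIV) (at ((z, \<tau>), t))"
    using U0 U(1) by (intro eventually_at_in_open') (auto intro: open_Times)
  then have le: "eventually (\<lambda>y. norm (W (fst (fst y)) (snd (fst y)) (snd y) - W z \<tau> (snd y)) \<le> ?D (fst y)) (at ((z, \<tau>), t))"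
  proof (rule eventually_mono, safe)
    fix a b and s :: real assume ab: "(a, b) \<in> U"
    have "(\<lambda>t. 1 *\<^sub>R W a b t + (- 1) *\<^sub>R W z \<tau> t) \<in> loops1"
      by (rule lin_combo_loops1(1)[OF W_props(1)[OF ab] W_props(1)[OF U0]])
    then have "(\<lambda>t. W a b t - W z \<tau> t) \<in> loops1" by simp
    from norm_le_c1_norm(1)[OF this, of s]
    show "norm (W (fst (fst ((a, b), s))) (snd (fst ((a, b), s))) (snd ((a, b), s)) - W z \<tau> (snd ((a, b), s)))
      \<le> ?D (fst ((a, b), s))" by simp
  qed
  have "((\<lambda>y. W (fst (fst y)) (snd (fst y)) (snd y) - W z \<tau> (snd y)) \<longlongrightarrow> 0) (at ((z, \<tau>), t))"
    using Lim_null_comparison[OF le] D by simp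
  from tendsto_add[OF this C]
  have "((\<lambda>y. W (fst (fst y)) (snd (fst y)) (snd y)) \<longlongrightarrow> W z \<tau> t) (at ((z, \<tau>), t))" by simp
  then show "isCont (\<lambda>(x, t). W (fst x) (snd x) t) ((z, \<tau>), t)"
    by (simp add: isCont_def split_def)
qed

text \<open>One construction serves the cone and both Liapunov families. The hypothesis
  \<open>inj\<close> concerns circle orbits of zeros. It passes to orbits in phase space because two
  solutions with a common point differ by a time shift, have equal minimal period and thus equal
  \<tau>, and \<open>avg\<close> turns the shift into a rotation.\<close>

lemma periodic_orbit_family:
  fixes P :: "'p::euclidean_space set" and \<zeta> :: "'p \<Rightarrow> c2" and \<tau> :: "'p \<Rightarrow> real"
  assumes cont: "continuous_on P \<zeta>" "continuous_on P \<tau>"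
    and inU: "\<And>p. p \<in> P \<Longrightarrow> (\<zeta> p, \<tau> p) \<in> U" and pos: "\<And>p. p \<in> P \<Longrightarrow> 1 + \<tau> p > 0"
    and crit: "\<And>p. p \<in> P \<Longrightarrow> grad (\<lambda>z. h z (\<tau> p)) (\<zeta> p) = 0"
    and nz: "\<And>p. p \<in> P \<Longrightarrow> \<zeta> p \<noteq> 0"
    and lim: "(\<zeta> \<longlongrightarrow> 0) (at 0 within P)" "(\<tau> \<longlongrightarrow> 0) (at 0 within P)"
    and inj: "\<And>p q \<theta>. p \<in> P \<Longrightarrow> q \<in> P \<Longrightarrow> \<zeta> q = rot \<theta> (\<zeta> p) \<Longrightarrow> p = q"
    and X: "X = (\<lambda>p. lifted Psi W (\<zeta> p) (\<tau> p))" and T: "T = (\<lambda>p. 2 * pi / (1 + \<tau> p))"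
  shows "orbit_family f P X T" "emanates_from_0 P X" "(T \<longlongrightarrow> 2 * pi) (at 0 within P)"
    "corresponds_on Psi U W h P \<zeta> \<tau> X T"
proof -
  have per: "periodic_solution f (T p) (X p)" if "p \<in> P" for p
    unfolding X T by (rule periodic_solution_lifted[OF inU crit nz pos]) (rule that)+
  have bounded: "\<exists>B. \<forall>t. norm (X p t) \<le> B" if p: "p \<in> P" for p
  proof -
    obtain B where "\<And>t. norm (loop_of (\<zeta> p) (\<tau> p) t) \<le> B"
      using loops_bounded[OF loops1_subset_loops[OF loop_of_loops1[OF inU[OF p]]]] by blast
    then show ?thesis by (auto simp: X lifted_eq)
  qed
  have "inj_on (\<lambda>p. range (X p)) P"
  proof (rule inj_onI)
    fix p q assume p: "p \<in> P" and q: "q \<in> P" and eq: "range (X p) = range (X q)"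
    have "X q 0 \<in> range (X p)" unfolding eq by (rule rangeI)
    then obtain t0 where t0: "X q 0 = X p t0" by (rule rangeE)
    obtain B where B: "\<forall>t. norm (X p t) \<le> B" using bounded[OF p] ..
    obtain C where C: "\<forall>t. norm (X q t) \<le> C" using bounded[OF q] ..
    have sol: "solution_of f (X p)" "solution_of f (X q)"
      using per p q by (simp_all add: periodic_solution_def)
    have "solution_of f (\<lambda>t. X p (t + t0))"
      unfolding solution_of_def
    proof
      fix t
      have "((\<lambda>t. t + t0) has_vector_derivative 1) (at t)" by (auto intro!: derivative_eq_intros)
      from vector_diff_chain_at[OF this, of "X p" "f (X p (t + t0))"] sol(1)
      show "((\<lambda>t. X p (t + t0)) has_vector_derivative f (X p (t + t0))) (at t)"
        by (simp add: o_def solution_of_def)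
    qed
    then have "X q = (\<lambda>t. X p (t + t0))"
    proof (rule solution_unique[OF f sol(2)])
      show "norm (X q t) \<le> max B C" "norm (X p (t + t0)) \<le> max B C" for t
        using B[rule_format, of "t + t0"] C[rule_format, of t] by (simp_all add: le_max_iff_disj)
    qed (simp add: t0)
    then have sh: "X q t = X p (t + t0)" for t by (rule fun_cong)
    \<comment> \<open>A period of one curve is a period of its shift, so neither minimal period can
      be the smaller one.\<close>
    have T_le: "\<not> T a < T b" if ab: "a \<in> P" "b \<in> P" and s: "\<And>t. X a t = X b (t + r)" for a b r
    proof
      assume lt: "T a < T b"
      have a: "T a > 0" "X a (t + T a) = X a t" for t
        using per[OF ab(1)] by (simp_all add: periodic_solution_def)
      have "X b (t + T a) = X b t" for t
      proof -
        have "X b (t + T a) = X a (t - r + T a)" using s[of "t - r + T a"] by simp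
        also have "\<dots> = X b t" using a(2)[of "t - r"] s[of "t - r"] by simp
        finally show ?thesis .
      qed
      moreover have "\<exists>t. X b (t + T a) \<noteq> X b t"
        using per[OF ab(2)] a(1) lt unfolding periodic_solution_def by (elim conjE) simp
      ultimately show False by simp
    qed
    have "\<not> T q < T p" by (rule T_le[OF q p sh])
    moreover have "\<not> T p < T q" by (rule T_le[OF p q, of "- t0"]) (simp add: sh)
    ultimately have "T p = T q" by simp
    \<comment> \<open>Equal \<tau> is needed because shifts of loops are compared with rotations of
      \<open>z\<close> at one fixed \<tau>.\<close>
    then have \<tau>: "\<tau> q = \<tau> p" using pos[OF p] pos[OF q] by (simp add: T field_simps)
    have "loop_of (\<zeta> q) (\<tau> p) t = loop_of (\<zeta> p) (\<tau> p) (t + (1 + \<tau> p) * t0)" for t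
    proof -
      have "(1 + \<tau> p) * (t / (1 + \<tau> p) + t0) = t + (1 + \<tau> p) * t0" "(1 + \<tau> p) * (t / (1 + \<tau> p)) = t"
        using pos[OF p] by (simp_all add: distrib_left)
      then show ?thesis using sh[of "t / (1 + \<tau> p)"] by (simp add: X lifted_eq \<tau>)
    qed
    then have "\<zeta> q = rot ((1 + \<tau> p) * t0) (\<zeta> p)"
      using inU[OF p] inU[OF q] \<tau> by (intro loop_of_shift_unique) simp_all
    then show "p = q" by (rule inj[OF p q])
  qed
  moreover have "continuous_on P T"
    unfolding T using pos by (intro continuous_intros cont) force
  moreover have "continuous_on (P \<times> UNIV) (\<lambda>(p, t). X p t)"
  proof -
    have z: "continuous_on (P \<times> UNIV) (\<lambda>x::'p \<times> real. \<zeta> (fst x))"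
      by (rule continuous_on_compose2[OF cont(1) continuous_on_fst[OF continuous_on_id]]) auto
    have t: "continuous_on (P \<times> UNIV) (\<lambda>x::'p \<times> real. \<tau> (fst x))"
      by (rule continuous_on_compose2[OF cont(2) continuous_on_fst[OF continuous_on_id]]) auto
    have s: "continuous_on (P \<times> UNIV) (\<lambda>x::'p \<times> real. (1 + \<tau> (fst x)) * snd x)"
      by (intro continuous_intros t)
    have "continuous_on (P \<times> UNIV) (\<lambda>x. Psi (rot ((1 + \<tau> (fst x)) * snd x) (\<zeta> (fst x))))"
      by (rule linear_continuous_on_compose[OF continuous_rot[OF s z] Psi])
    moreover have "continuous_on (P \<times> UNIV)
        (\<lambda>x. (\<lambda>(x, t). W (fst x) (snd x) t) ((\<zeta> (fst x), \<tau> (fst x)), (1 + \<tau> (fst x)) * snd x))"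
      by (rule continuous_on_compose2[OF continuous_on_W continuous_on_Pair[OF continuous_on_Pair[OF z t] s]])
        (use inU in auto)
    ultimately have "continuous_on (P \<times> UNIV)
      (\<lambda>x. Psi (rot ((1 + \<tau> (fst x)) * snd x) (\<zeta> (fst x))) + W (\<zeta> (fst x)) (\<tau> (fst x)) ((1 + \<tau> (fst x)) * snd x))"
      by (intro continuous_on_add) (simp_all add: split_def)
    then show ?thesis by (simp add: X lifted_def lin_loop_eq split_def)
  qed
  ultimately show "orbit_family f P X T"
    using per by (simp add: orbit_family_def)
  show "corresponds_on Psi U W h P \<zeta> \<tau> X T"
    using inU crit by (simp add: corresponds_on_def X T)
  show "(T \<longlongrightarrow> 2 * pi) (at 0 within P)"
    unfolding T using tendsto_divide[OF tendsto_const[of "2 * pi"] tendsto_add[OF tendsto_const[of 1] lim(2)]]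
    by simp
  show "emanates_from_0 P X"
    unfolding emanates_from_0_def uniform_limit_iff
  proof (intro allI impI)
    fix e :: real assume e: "e > 0"
    obtain M where M: "M > 0" "\<And>z t. norm (lin_loop Psi z t) \<le> M * norm z"
      using norm_lin_loop_le by blast
    obtain d where d: "d > 0" "\<And>z \<tau>. norm z < d \<Longrightarrow> \<bar>\<tau> - 0\<bar> < d \<Longrightarrow> (z, \<tau>) \<in> U \<and> c1_norm (W z \<tau>) < e / 2"
      using small_W[OF U(2), of "e / 2"] e by auto
    have "eventually (\<lambda>p. dist (\<zeta> p) 0 < min d (e / (2 * M))) (at 0 within P)"
      using lim(1) d(1) e M(1) by (intro tendstoD) simp_all
    moreover have "eventually (\<lambda>p. dist (\<tau> p) 0 < d) (at 0 within P)"
      using lim(2) d(1) by (rule tendstoD)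
    ultimately show "eventually (\<lambda>p. \<forall>t\<in>UNIV. dist (X p t) 0 < e) (at 0 within P)"
    proof eventually_elim
      case (elim p)
      then have n: "norm (\<zeta> p) < d" "M * norm (\<zeta> p) < e / 2" "\<bar>\<tau> p - 0\<bar> < d"
        using M(1) by (simp_all add: field_simps)
      then have "(\<zeta> p, \<tau> p) \<in> U" "c1_norm (W (\<zeta> p) (\<tau> p)) < e / 2" using d(2) by blast+
      then have "norm (loop_of (\<zeta> p) (\<tau> p) t) < e" for t
        using norm_loop_of_le[OF _ M(2), of "\<zeta> p" "\<tau> p" t] n(2) by linarith
      then show ?case by (simp add: X lifted_eq)
    qed
  qed
qed

section \<open>Symmetries of the periodic solutions\<close>

lemma reversing_symmetric_R:
  assumes U: "(z, \<tau>) \<in> U" "(R0 z, \<tau>) \<in> U" and \<tau>: "1 + \<tau> > 0" and eq: "R0 z = rot \<theta> z"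
  shows "reversing_symmetric R (lifted Psi W z \<tau>)"
  unfolding reversing_symmetric_def
proof (intro exI allI)
  fix t
  have a: "loop_of (R0 z) \<tau> s = R (loop_of z \<tau> (- 1 * s + 0))" for s
    by (rule loop_of_symmetry[OF loop_symmetry_R U])
  have b: "loop_of (rot \<theta> z) \<tau> s = loop_of z \<tau> (1 * s + \<theta>)" for s
    by (rule loop_of_symmetry[OF loop_symmetry_shift U(1)]) (use U(2) eq in simp)
  have "(1 + \<tau>) * (\<theta> / (1 + \<tau>) - t) = \<theta> - (1 + \<tau>) * t"
    using \<tau> by (simp add: right_diff_distrib)
  then have "R (lifted Psi W z \<tau> (\<theta> / (1 + \<tau>) - t)) = loop_of (R0 z) \<tau> ((1 + \<tau>) * t - \<theta>)"
    using a[of "(1 + \<tau>) * t - \<theta>"] by (simp add: lifted_eq)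
  also have "\<dots> = lifted Psi W z \<tau> t"
    using b[of "(1 + \<tau>) * t - \<theta>"] eq by (simp add: lifted_eq)
  finally show "R (lifted Psi W z \<tau> (\<theta> / (1 + \<tau>) - t)) = lifted Psi W z \<tau> t" .
qed

lemma R_lifted:
  assumes "(z, \<tau>) \<in> U" "(R0 z, \<tau>) \<in> U"
  shows "R (lifted Psi W z \<tau> (- t)) = lifted Psi W (R0 z) \<tau> t"
  using loop_of_symmetry[OF loop_symmetry_R assms, of "(1 + \<tau>) * t"] by (simp add: lifted_eq)

lemma S_lifted:
  assumes "(z, \<tau>) \<in> U" "(S0 z, \<tau>) \<in> U"
  shows "S (lifted Psi W z \<tau> t) = lifted Psi W (S0 z) \<tau> t"
  using loop_of_symmetry[OF loop_symmetry_S[of 0], of z \<tau> "(1 + \<tau>) * t"] assms by (simp add: lifted_eq)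

lemma image_R_lifted:
  assumes "(z, \<tau>) \<in> U" "(R0 z, \<tau>) \<in> U"
  shows "R ` range (lifted Psi W z \<tau>) = range (lifted Psi W (R0 z) \<tau>)"
proof -
  have "range (lifted Psi W z \<tau>) = range (\<lambda>t. lifted Psi W z \<tau> (- t))"
  proof (intro equalityI subsetI)
    fix x assume "x \<in> range (lifted Psi W z \<tau>)"
    then obtain t where "x = lifted Psi W z \<tau> t" ..
    then have "x = lifted Psi W z \<tau> (- (- t))" by simp
    then show "x \<in> range (\<lambda>t. lifted Psi W z \<tau> (- t))" by (rule range_eqI)
  qed blast
  then show ?thesis by (simp add: image_image R_lifted[OF assms])
qed

lemma image_S_lifted:
  assumes "(z, \<tau>) \<in> U" "(S0 z, \<tau>) \<in> U"
  shows "S ` range (lifted Psi W z \<tau>) = range (lifted Psi W (S0 z) \<tau>)"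
  by (simp add: image_image S_lifted[OF assms])

lemma reversing_symmetric_SR:
  assumes U: "(z, \<tau>) \<in> U" "(R0 z, \<tau>) \<in> U" and eq: "S0 (R0 z) = z"
  shows "reversing_symmetric (S \<circ> R) (lifted Psi W z \<tau>)"
  unfolding reversing_symmetric_def
proof (intro exI allI)
  show "(S \<circ> R) (lifted Psi W z \<tau> (0 - t)) = lifted Psi W z \<tau> t" for t
    using R_lifted[OF U, of t] S_lifted[OF U(2), of t] U(1) eq by simp
qed

lemma equivariant_symmetric_S:
  assumes U: "(z, \<tau>) \<in> U" "(S0 z, \<tau>) \<in> U" and \<tau>: "1 + \<tau> > 0" and eq: "S0 z = rot \<theta> z"
  shows "equivariant_symmetric S (lifted Psi W z \<tau>)"
  unfolding equivariant_symmetric_def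
proof (intro exI allI)
  fix t
  have b: "loop_of (rot \<theta> z) \<tau> s = loop_of z \<tau> (1 * s + \<theta>)" for s
    by (rule loop_of_symmetry[OF loop_symmetry_shift U(1)]) (use U(2) eq in simp)
  have "(1 + \<tau>) * (t + - \<theta> / (1 + \<tau>)) = (1 + \<tau>) * t - \<theta>"
    using \<tau> by (simp add: right_diff_distrib)
  then have "lifted Psi W (S0 z) \<tau> (t + - \<theta> / (1 + \<tau>)) = lifted Psi W z \<tau> t"
    using b[of "(1 + \<tau>) * t - \<theta>"] eq by (simp add: lifted_eq)
  then show "S (lifted Psi W z \<tau> (t + - \<theta> / (1 + \<tau>))) = lifted Psi W z \<tau> t"
    using S_lifted[OF U] by simp
qed

text \<open>The converse direction, obtained by averaging: it shows that no members of the cone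
  family besides the two special branches are symmetric under \<open>S\<close>.\<close>

lemma equivariant_symmetric_S_D:
  assumes U: "(z, \<tau>) \<in> U" and \<tau>: "1 + \<tau> > 0" and sym: "equivariant_symmetric S (lifted Psi W z \<tau>)"
  obtains \<theta> where "S0 (rot \<theta> z) = z"
proof -
  obtain s where s: "\<And>t. S (lifted Psi W z \<tau> (t + s)) = lifted Psi W z \<tau> t"
    using sym by (auto simp: equivariant_symmetric_def)
  have "S (loop_of z \<tau> (1 * t + (1 + \<tau>) * s)) = loop_of z \<tau> t" for t
  proof -
    have "(1 + \<tau>) * (t / (1 + \<tau>) + s) = t + (1 + \<tau>) * s" "(1 + \<tau>) * (t / (1 + \<tau>)) = t"
      using \<tau> by (simp_all add: distrib_left)
    then show ?thesis using s[of "t / (1 + \<tau>)"] by (simp add: lifted_eq)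
  qed
  then have "avg (\<lambda>t. S (loop_of z \<tau> (1 * t + (1 + \<tau>) * s))) = avg (loop_of z \<tau>)" by (rule avg_cong)
  then have "S0 (rot ((1 + \<tau>) * s) z) = z"
    using avg_loop_of_symmetry[OF loop_symmetry_S U, of "(1 + \<tau>) * s"] avg_loop_of[OF U] by simp
  then show ?thesis by (rule that)
qed

end

section \<open>Size of \<open>W\<close> and of the reduced field near the trivial solution\<close>

lemma c1_norm_le:
  assumes "\<And>t. norm (u t) \<le> B" "\<And>t. norm (vector_derivative u (at t)) \<le> B"
  shows "c1_norm u \<le> 2 * B"
proof -
  have "(SUP t. norm (u t)) \<le> B" "(SUP t. norm (vector_derivative u (at t))) \<le> B"
    using assms by (auto intro: cSUP_least)
  then show ?thesis by (simp add: c1_norm_def)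
qed

context liapunov_schmidt
begin

lemma avg_L:
  assumes u: "u \<in> loops"
  shows "avg (\<lambda>t. L (u t)) = L0 (avg u)"
proof -
  have "(\<lambda>t. rot (- t) (proj (u t))) integrable_on {0..2*pi}"
    by (rule integrable_continuous_real[OF continuous_avg[OF u]])
  from integral_linear[OF this linear_L0[unfolded linear_conv_bounded_linear]]
  have "integral {0..2*pi} (\<lambda>t. rot (- t) (proj (L (u t)))) = L0 (integral {0..2*pi} (\<lambda>t. rot (- t) (proj (u t))))"
    by (simp add: o_def proj_L rot_L0)
  then show ?thesis by (simp add: avg_def linear_scale[OF linear_L0])
qed

lemma avg_vector_derivative:
  assumes u: "u \<in> loops1"
  shows "avg (\<lambda>t. vector_derivative u (at t)) = L0 (avg u)"
proof -
  have "avg (\<lambda>t. lin_Phi L u t + L (u t)) = avg (lin_Phi L u) + avg (\<lambda>t. L (u t))"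
    by (rule avg_add[OF lin_Phi_loops[OF u] linear_loops[OF L loops1_subset_loops[OF u]]])
  then show ?thesis
    by (simp add: avg_lin_Phi[OF u] avg_L[OF loops1_subset_loops[OF u]]) (simp add: lin_Phi_def)
qed

text \<open>Exact identities with \<open>nl\<close>, the nonlinear part of \<open>f\<close> along
  the loop. The average of the nonlinear part is the whole deviation of the reduced field from
  \<tau> L0 z. In the equation for \<open>W\<close> the term \<tau> W' is moved to the right; the
  C^1 norm controls it.\<close>

lemma reduced_field_expansion:
  assumes U: "(z, \<tau>) \<in> U"
  defines "nl \<equiv> \<lambda>t. f (loop_of z \<tau> t) - L (loop_of z \<tau> t)"
  shows "nl \<in> loops" "reduced_field f L ip Psi W z \<tau> = \<tau> *\<^sub>R L0 z - avg nl"
    "lin_Phi L (W z \<tau>) t = nl t - lin_loop Psi (avg nl) t - \<tau> *\<^sub>R vector_derivative (W z \<tau>) (at t)"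
proof -
  let ?u = "loop_of z \<tau>"
  have u1: "?u \<in> loops1" by (rule loop_of_loops1[OF U])
  have ul: "?u \<in> loops" by (rule loops1_subset_loops[OF u1])
  have du: "(\<lambda>t. vector_derivative ?u (at t)) \<in> loops" by (rule loops1_deriv_loops[OF u1])
  have Lu: "(\<lambda>t. L (?u t)) \<in> loops" by (rule linear_loops[OF L ul])
  have nl_eq: "nl t = (1 + \<tau>) *\<^sub>R vector_derivative ?u (at t) - Phi f ?u \<tau> t - L (?u t)" for t
    by (simp add: nl_def Phi_def)
  have Pl: "Phi f ?u \<tau> \<in> loops" by (rule Phi_loops[OF u1])
  have dP: "(\<lambda>t. (1 + \<tau>) *\<^sub>R vector_derivative ?u (at t) - Phi f ?u \<tau> t) \<in> loops"
    using lin_combo_loops[OF du Pl, of "1 + \<tau>" "- 1"] by simp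
  show nl: "nl \<in> loops"
    using diff_loops[OF dP Lu] by (simp add: nl_eq[abs_def])
  have "avg nl = avg (\<lambda>t. (1 + \<tau>) *\<^sub>R vector_derivative ?u (at t) - Phi f ?u \<tau> t) - avg (\<lambda>t. L (?u t))"
    using avg_diff[OF dP Lu] by (simp add: nl_eq[abs_def])
  also have "avg (\<lambda>t. (1 + \<tau>) *\<^sub>R vector_derivative ?u (at t) - Phi f ?u \<tau> t) =
      (1 + \<tau>) *\<^sub>R avg (\<lambda>t. vector_derivative ?u (at t)) - avg (Phi f ?u \<tau>)"
    using avg_lin_combo[OF du Pl, of "1 + \<tau>" "- 1"] by simp
  finally have "avg nl = \<tau> *\<^sub>R L0 z - avg (Phi f ?u \<tau>)"
    by (simp add: avg_vector_derivative[OF u1] avg_L[OF ul] avg_loop_of[OF U] scaleR_add_left)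
  then have avgP: "avg (Phi f ?u \<tau>) = \<tau> *\<^sub>R L0 z - avg nl" by simp
  then show "reduced_field f L ip Psi W z \<tau> = \<tau> *\<^sub>R L0 z - avg nl"
    using reduced_field_eq(1)[OF U] by simp
  have "Phi f ?u \<tau> t = lin_loop Psi (\<tau> *\<^sub>R L0 z - avg nl) t"
    using fun_cong[OF reduced_field_eq(2)[OF U], of t] avgP by simp
  then have P: "Phi f ?u \<tau> t = \<tau> *\<^sub>R lin_loop Psi (L0 z) t - lin_loop Psi (avg nl) t"
    by (simp add: linear_diff[OF lin_loop_linear] linear_scale[OF lin_loop_linear])
  have "L (?u t) = lin_loop Psi (L0 z) t + L (W z \<tau> t)"
    by (simp add: loop_of_def linear_add[OF L] L_lin_loop)
  with nl_eq[of t] show "lin_Phi L (W z \<tau>) t = nl t - lin_loop Psi (avg nl) t - \<tau> *\<^sub>R vector_derivative (W z \<tau>) (at t)"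
    unfolding P lin_Phi_def vector_derivative_loop_of[OF U] by (simp add: algebra_simps)
qed

text \<open>An absorption argument. With c the C^1 norm of \<open>W\<close>, the bounded inverse
  gives c \<le> 2 K ((1 + M Q) \<epsilon>' (M |z| + c) + |\<tau>| c). Small \<epsilon>' and \<tau>
  let the terms in c be absorbed, so c \<le> M |z|, and the average of the nonlinear part is then at
  most \<epsilon> |z|. The radius in z may depend on \<tau>.\<close>

lemma reduced_field_asymptotic:
  obtains \<tau>1 where "\<tau>1 > 0" "\<And>\<tau>. \<bar>\<tau>\<bar> < \<tau>1 \<Longrightarrow> (0, \<tau>) \<in> U"
    "\<And>\<tau> \<epsilon>. \<bar>\<tau>\<bar> < \<tau>1 \<Longrightarrow> \<epsilon> > 0 \<Longrightarrow> \<exists>d>0. \<forall>z. norm z < d \<longrightarrow>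
      (z, \<tau>) \<in> U \<and> norm (reduced_field f L ip Psi W z \<tau> - \<tau> *\<^sub>R L0 z) \<le> \<epsilon> * norm z"
proof -
  obtain K where K: "K > 0" "\<And>w B t. w \<in> loops1 \<Longrightarrow> avg w = 0 \<Longrightarrow> (\<And>t. norm (lin_Phi L w t) \<le> B) \<Longrightarrow>
      norm (w t) \<le> K * B \<and> norm (vector_derivative w (at t)) \<le> K * B"
    using lin_Phi_bounded_below by blast
  obtain Q where Q: "Q > 0" "\<And>u B. u \<in> loops \<Longrightarrow> (\<And>t. norm (u t) \<le> B) \<Longrightarrow> norm (avg u) \<le> Q * B"
    using norm_avg_le by blast
  obtain M where M: "M > 0" "\<And>z t. norm (lin_loop Psi z t) \<le> M * norm z"
    using norm_lin_loop_le by blast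
  obtain d0 where d0: "d0 > 0"
    "\<And>z \<tau>. norm z < d0 \<Longrightarrow> \<bar>\<tau> - 0\<bar> < d0 \<Longrightarrow> (z, \<tau>) \<in> U \<and> c1_norm (W z \<tau>) < 1"
    using small_W[OF U(2), of 1] by auto
  \<comment> \<open>The factor 8 K makes the coefficient 2 K |\<tau>| at most 1/4.\<close>
  define \<tau>1 where "\<tau>1 = min d0 (1 / (8 * K))"
  show ?thesis
  proof (rule that)
    show "\<tau>1 > 0" using d0 K by (simp add: \<tau>1_def)
    show U0: "(0, \<tau>) \<in> U" if "\<bar>\<tau>\<bar> < \<tau>1" for \<tau>
      using d0(2)[of 0 \<tau>] d0(1) that by (simp add: \<tau>1_def)
    fix \<tau> \<epsilon> :: real assume \<tau>: "\<bar>\<tau>\<bar> < \<tau>1" and \<epsilon>: "\<epsilon> > 0"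
    \<comment> \<open>The first entry produces the final \<epsilon>; the second makes the other
      coefficient at most 1/4. The two quarters leave half of c on the left.\<close>
    define \<epsilon>' where "\<epsilon>' = min (\<epsilon> / (2 * Q * M)) (1 / (8 * K * (1 + M * Q)))"
    have pos: "1 + M * Q > 0" using M(1) Q(1) by (simp add: add_pos_pos)
    have \<epsilon>': "\<epsilon>' > 0" "2 * Q * M * \<epsilon>' \<le> \<epsilon>" "2 * K * (1 + M * Q) * \<epsilon>' \<le> 1 / 4"
    proof -
      show "\<epsilon>' > 0" using \<epsilon> M(1) Q(1) K(1) pos by (simp add: \<epsilon>'_def)
      have "\<epsilon>' \<le> \<epsilon> / (2 * Q * M)" by (simp add: \<epsilon>'_def)
      then show "2 * Q * M * \<epsilon>' \<le> \<epsilon>" using M(1) Q(1) by (simp add: field_simps)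
      have "\<epsilon>' \<le> 1 / (8 * K * (1 + M * Q))" by (simp add: \<epsilon>'_def)
      then have "\<epsilon>' * (8 * K * (1 + M * Q)) \<le> 1"
        using K(1) pos by (subst (asm) pos_le_divide_eq) simp_all
      then show "2 * K * (1 + M * Q) * \<epsilon>' \<le> 1 / 4" by (simp add: algebra_simps)
    qed
    obtain r where r: "r > 0" "\<And>y. norm y < r \<Longrightarrow> norm (f y - L y) \<le> \<epsilon>' * norm y"
      using f_L[unfolded has_derivative_at_alt] \<epsilon>'(1) by (auto simp: f_0)
    obtain d where d: "d > 0" "\<And>z \<tau>'. norm z < d \<Longrightarrow> \<bar>\<tau>' - \<tau>\<bar> < d \<Longrightarrow> (z, \<tau>') \<in> U \<and> c1_norm (W z \<tau>') < r / 2"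
      using small_W[OF U0[OF \<tau>], of "r / 2"] r(1) by auto
    show "\<exists>d>0. \<forall>z. norm z < d \<longrightarrow>
      (z, \<tau>) \<in> U \<and> norm (reduced_field f L ip Psi W z \<tau> - \<tau> *\<^sub>R L0 z) \<le> \<epsilon> * norm z"
    proof (intro exI[of _ "min d (r / (2 * M))"] conjI allI impI)
      show "min d (r / (2 * M)) > 0" using d r M by simp
      fix z :: c2 assume z: "norm z < min d (r / (2 * M))"
      then show U: "(z, \<tau>) \<in> U" using d by simp
      let ?w = "W z \<tau>"
      define c where "c = c1_norm ?w"
      have c: "c < r / 2" using d(2)[of z \<tau>] d(1) z by (simp add: c_def)
      have w1: "?w \<in> loops1" and w0: "avg ?w = 0"
        using W_props[OF U] avg_orth_ker by auto
      have wc: "norm (?w t) \<le> c" "norm (vector_derivative ?w (at t)) \<le> c" for t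
        using norm_le_c1_norm[OF w1] by (simp_all add: c_def)
      have "c \<ge> 0" using wc(1)[of 0] norm_ge_zero order_trans by blast
      have Mz: "M * norm z < r / 2" using z M(1) by (simp add: field_simps)
      have uc: "norm (loop_of z \<tau> t) \<le> M * norm z + c" for t
        using norm_loop_of_le[OF U M(2), of t] by (simp add: c_def)
      define E where "E = \<epsilon>' * (M * norm z + c)"
      have "E \<ge> 0" using \<epsilon>'(1) M(1) \<open>c \<ge> 0\<close> by (simp add: E_def)
      let ?nl = "\<lambda>t. f (loop_of z \<tau> t) - L (loop_of z \<tau> t)"
      note ex = reduced_field_expansion[OF U]
      have nlE: "norm (?nl t) \<le> E" for t
      proof -
        have "norm (loop_of z \<tau> t) < r" using uc[of t] Mz c by linarith
        then have "norm (?nl t) \<le> \<epsilon>' * norm (loop_of z \<tau> t)" by (rule r(2))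
        also have "\<dots> \<le> E" unfolding E_def using uc \<epsilon>'(1) by (intro mult_left_mono) simp_all
        finally show ?thesis .
      qed
      have aE: "norm (avg ?nl) \<le> Q * E" by (rule Q(2)[OF ex(1) nlE])
      have lin: "norm (lin_Phi L ?w t) \<le> (1 + M * Q) * E + \<bar>\<tau>\<bar> * c" for t
      proof -
        have "norm (lin_loop Psi (avg ?nl) t) \<le> M * (Q * E)"
          using M(2)[of "avg ?nl" t] mult_left_mono[OF aE, of M] M(1) by linarith
        moreover have "norm (\<tau> *\<^sub>R vector_derivative ?w (at t)) \<le> \<bar>\<tau>\<bar> * c"
          using wc(2)[of t] by (simp add: mult_left_mono)
        ultimately have "norm (lin_Phi L ?w t) \<le> E + M * (Q * E) + \<bar>\<tau>\<bar> * c"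
          unfolding ex(3)
          using nlE[of t] norm_triangle_ineq4[of "?nl t - lin_loop Psi (avg ?nl) t" "\<tau> *\<^sub>R vector_derivative ?w (at t)"]
            norm_triangle_ineq4[of "?nl t" "lin_loop Psi (avg ?nl) t"] by linarith
        then show ?thesis by (simp add: algebra_simps)
      qed
      have "c \<le> 2 * (K * ((1 + M * Q) * E + \<bar>\<tau>\<bar> * c))"
        unfolding c_def
        by (rule c1_norm_le; use K(2)[OF w1 w0 lin] c_def in simp)
      also have "\<dots> = (2 * K * (1 + M * Q) * \<epsilon>') * (M * norm z + c) + (2 * K * \<bar>\<tau>\<bar>) * c"
        by (simp add: E_def algebra_simps)
      also have "\<dots> \<le> (1 / 4) * (M * norm z + c) + (1 / 4) * c"
      proof (intro add_mono mult_right_mono \<epsilon>'(3))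
        have "\<bar>\<tau>\<bar> \<le> 1 / (8 * K)" using \<tau> by (simp add: \<tau>1_def)
        then show "2 * K * \<bar>\<tau>\<bar> \<le> 1 / 4" using K(1) by (simp add: field_simps)
      qed (use \<open>c \<ge> 0\<close> M(1) in simp_all)
      finally have "c \<le> (1 / 4) * (M * norm z + c) + (1 / 4) * c" .
      moreover have "M * norm z \<ge> 0" using M(1) by simp
      moreover have "c \<le> X" if "c \<le> (1 / 4) * (X + c) + (1 / 4) * c" "X \<ge> 0" for X :: real
        using that by (simp add: field_simps)
      ultimately have cM: "c \<le> M * norm z" by blast
      have "norm (reduced_field f L ip Psi W z \<tau> - \<tau> *\<^sub>R L0 z) = norm (avg ?nl)"
        by (simp add: ex(2))
      also have "\<dots> \<le> Q * (\<epsilon>' * (M * norm z + M * norm z))"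
        using aE cM \<epsilon>'(1) Q(1) unfolding E_def
        by (elim order_trans) (intro mult_left_mono add_left_mono; simp)
      also have "\<dots> = (2 * Q * M * \<epsilon>') * norm z" by (simp add: algebra_simps)
      also have "\<dots> \<le> \<epsilon> * norm z" using \<epsilon>'(2) by (rule mult_right_mono) simp
      finally show "norm (reduced_field f L ip Psi W z \<tau> - \<tau> *\<^sub>R L0 z) \<le> \<epsilon> * norm z" .
    qed
  qed
qed

end

section \<open>The reduced Hamiltonian in normal form\<close>

lemma invN_eq: "invN z = z \<bullet> z"
  and invdelta_eq: "invdelta z = fst z \<bullet> fst z - snd z \<bullet> snd z"
  by (simp_all add: invN_def invdelta_def inner_prod_def power2_norm_eq_inner)

lemma invariant_derivatives:
  shows "(invN has_derivative (\<lambda>v. 2 * (z \<bullet> v))) (at z)"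
    and "(invdelta has_derivative (\<lambda>v. 2 * (fst z \<bullet> fst v - snd z \<bullet> snd v))) (at z)"
    and "(invC has_derivative (\<lambda>v. Re (2 * (fst v * snd z + fst z * snd v)))) (at z)"
    and "((\<lambda>z. (invD z)\<^sup>2) has_derivative
      (\<lambda>v. 2 * invD z * Im (2 * (fst v * snd z + fst z * snd v)))) (at z)"
proof -
  have q: "((\<lambda>z. 2 * fst z * snd z :: complex) has_derivative
      (\<lambda>v. 2 * (fst v * snd z + fst z * snd v))) (at z)"
    by (auto intro!: derivative_eq_intros simp: algebra_simps)
  show "(invC has_derivative (\<lambda>v. Re (2 * (fst v * snd z + fst z * snd v)))) (at z)"
    unfolding invC_def[abs_def] by (rule bounded_linear.has_derivative[OF bounded_linear_Re q])
  have D: "(invD has_derivative (\<lambda>v. Im (2 * (fst v * snd z + fst z * snd v)))) (at z)"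
    unfolding invD_def[abs_def] by (rule bounded_linear.has_derivative[OF bounded_linear_Im q])
  show "((\<lambda>z. (invD z)\<^sup>2) has_derivative
      (\<lambda>v. 2 * invD z * Im (2 * (fst v * snd z + fst z * snd v)))) (at z)"
    by (auto intro!: derivative_eq_intros D)
  show "(invN has_derivative (\<lambda>v. 2 * (z \<bullet> v))) (at z)"
    unfolding invN_eq[abs_def] by (auto intro!: derivative_eq_intros simp: inner_commute)
  show "(invdelta has_derivative (\<lambda>v. 2 * (fst z \<bullet> fst v - snd z \<bullet> snd v))) (at z)"
    unfolding invdelta_eq[abs_def] by (auto intro!: derivative_eq_intros simp: inner_commute)
qed

lemma J0_L0: "J0 (L0 z) = (- fst z, snd z)"
  by (simp add: J0_def L0_def flip: mult.assoc)

lemma linear_J0: "linear J0"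
  by (rule linearI) (simp_all add: J0_def algebra_simps)

lemma norm_J0 [simp]: "norm (J0 z) = norm z"
  by (simp add: J0_def norm_prod_def norm_mult)

lemma J0_J0 [simp]: "J0 (J0 z) = - z"
  by (simp add: J0_def prod_eq_iff flip: mult.assoc)

text \<open>Two derivatives of \<open>g\<close> are included because first derivatives of
  \<open>g\<close> occur in the equations on the rays, to which the implicit function theorem is
  applied.\<close>

locale reduced_normal_form = liapunov_schmidt L Psi proj f R S ip U W h
  for L :: "'a::euclidean_space \<Rightarrow> 'a" and Psi :: "c2 \<Rightarrow> 'a" and proj :: "'a \<Rightarrow> c2"
    and f R S :: "'a \<Rightarrow> 'a" and ip :: "'a loop_form" and U :: "(c2 \<times> real) set"
    and W :: "c2 \<Rightarrow> real \<Rightarrow> real \<Rightarrow> 'a" and h :: "c2 \<Rightarrow> real \<Rightarrow> real" +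
  fixes g :: "real \<times> real \<times> real \<times> real \<Rightarrow> real" and G :: "(real \<times> real \<times> real \<times> real) set"
  assumes G: "open G" and g: "ck_on (Suc (Suc 0)) g G"
    and UG: "\<And>z \<tau>. (z, \<tau>) \<in> U \<Longrightarrow> (invN z, invC z, (invD z)\<^sup>2, \<tau>) \<in> G"
    and h_eq: "\<And>z \<tau>. (z, \<tau>) \<in> U \<Longrightarrow>
      h z \<tau> = invdelta z * g (invN z, invC z, (invD z)\<^sup>2, \<tau>)"
begin

abbreviation dg :: "real \<times> real \<times> real \<times> real \<Rightarrow> real \<times> real \<times> real \<times> real \<Rightarrow> real" where
  "dg x \<equiv> frechet_derivative g (at x)"

lemma g_C1: "ck_on (Suc 0) g G"
  by (rule ck_on_SucD[OF g])

lemma dg_C1: "ck_on (Suc 0) (\<lambda>x. dg x v) G"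
  using g unfolding ck_on.simps(2)[of "Suc 0"] by blast

lemma g_has_derivative: "x \<in> G \<Longrightarrow> (g has_derivative dg x) (at x)"
  by (rule ck_on_1D(1)[OF g_C1])

lemma linear_dg: "x \<in> G \<Longrightarrow> linear (dg x)"
  by (rule has_derivative_linear[OF g_has_derivative])

lemma h_has_derivative:
  assumes U: "(z, \<tau>) \<in> U"
  defines "x \<equiv> (invN z, invC z, (invD z)\<^sup>2, \<tau>)"
  shows "((\<lambda>z. h z \<tau>) has_derivative (\<lambda>v. invdelta z * dg x (2 * (z \<bullet> v),
      Re (2 * (fst v * snd z + fst z * snd v)), 2 * invD z * Im (2 * (fst v * snd z + fst z * snd v)), 0) +
      2 * (fst z \<bullet> fst v - snd z \<bullet> snd v) * g x)) (at z)"
proof -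
  have x: "((\<lambda>z. (invN z, invC z, (invD z)\<^sup>2, \<tau>)) has_derivative (\<lambda>v. (2 * (z \<bullet> v),
      Re (2 * (fst v * snd z + fst z * snd v)), 2 * invD z * Im (2 * (fst v * snd z + fst z * snd v)), 0))) (at z)"
    by (intro has_derivative_Pair invariant_derivatives has_derivative_const)
  have "x \<in> G" unfolding x_def by (rule UG[OF U])
  from has_derivative_mult[OF invariant_derivatives(2) has_derivative_compose[OF x g_has_derivative[OF this[unfolded x_def]]]]
  have d: "((\<lambda>z. invdelta z * g (invN z, invC z, (invD z)\<^sup>2, \<tau>)) has_derivative
     (\<lambda>v. invdelta z * dg x (2 * (z \<bullet> v),
      Re (2 * (fst v * snd z + fst z * snd v)), 2 * invD z * Im (2 * (fst v * snd z + fst z * snd v)), 0) +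
      2 * (fst z \<bullet> fst v - snd z \<bullet> snd v) * g x)) (at z)"
    by (simp only: x_def)
  have "open ((\<lambda>z. (z, \<tau>)) -` U)"
    using liapunov_schmidt.U(1)[OF liapunov_schmidt_axioms] by (intro open_vimage continuous_intros)
  then show ?thesis
    by (rule has_derivative_transform_within_open[OF d]) (use U h_eq in auto)
qed

lemma grad_0I:
  assumes "(z, \<tau>) \<in> U"
    and "\<And>v. invdelta z * dg (invN z, invC z, (invD z)\<^sup>2, \<tau>) (2 * (z \<bullet> v),
      Re (2 * (fst v * snd z + fst z * snd v)), 2 * invD z * Im (2 * (fst v * snd z + fst z * snd v)), 0) +
      2 * (fst z \<bullet> fst v - snd z \<bullet> snd v) * g (invN z, invC z, (invD z)\<^sup>2, \<tau>) = 0"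
  shows "grad (\<lambda>z. h z \<tau>) z = 0"
  by (rule grad_eqI) (use h_has_derivative[OF assms(1)] assms(2) in simp)

text \<open>On the points (s, 0) one has N = \<delta> = s^2 and C = D = 0, so the radial derivative
  of h is 2 s (g + s^2 g_N). The expansion of the reduced field says that it is \<tau> s up to
  \<epsilon> s; divide by s and let s tend to 0.\<close>

lemma g_on_axis:
  obtains \<tau>1 where "\<tau>1 > 0" "\<And>\<tau>. \<bar>\<tau>\<bar> < \<tau>1 \<Longrightarrow> (0, 0, 0, \<tau>) \<in> G \<and> g (0, 0, 0, \<tau>) = \<tau> / 2"
proof -
  obtain \<tau>1 where \<tau>1: "\<tau>1 > 0" "\<And>\<tau>. \<bar>\<tau>\<bar> < \<tau>1 \<Longrightarrow> (0, \<tau>) \<in> U"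
    "\<And>\<tau> \<epsilon>. \<bar>\<tau>\<bar> < \<tau>1 \<Longrightarrow> \<epsilon> > 0 \<Longrightarrow> \<exists>d>0. \<forall>z. norm z < d \<longrightarrow>
      (z, \<tau>) \<in> U \<and> norm (reduced_field f L ip Psi W z \<tau> - \<tau> *\<^sub>R L0 z) \<le> \<epsilon> * norm z"
    using reduced_field_asymptotic by blast
  show ?thesis
  proof (rule that[OF \<tau>1(1)])
    fix \<tau> :: real assume \<tau>: "\<bar>\<tau>\<bar> < \<tau>1"
    have inG: "(0, 0, 0, \<tau>) \<in> G"
      using UG[OF \<tau>1(2)[OF \<tau>]] by (simp add: invN_def invC_def invD_def)
    define x where "x s = (s * s, 0::real, 0::real, \<tau>)" for s :: real
    \<comment> \<open>\<open>s * q s\<close> is the radial derivative of h minus \<tau> s. Unlike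
      the quotient it comes from, \<open>q\<close> is continuous at 0 by its formula.\<close>
    define q where "q s = s * s * dg (x s) (1, 0, 0, 0) * 2 + 2 * g (x s) - \<tau>" for s
    have "x 0 \<in> G" using inG by (simp add: x_def)
    have cx: "isCont x 0" unfolding x_def[abs_def] by (intro continuous_intros)
    have "isCont g (x 0)"
      using g_C1 G \<open>x 0 \<in> G\<close> by (metis ck_on_1D(3) continuous_on_eq_continuous_at)
    then have cg: "isCont (\<lambda>s. g (x s)) 0" by (rule isCont_o2[OF cx])
    have "isCont (\<lambda>y. dg y (1, 0, 0, 0)) (x 0)"
      using dg_C1 G \<open>x 0 \<in> G\<close> by (metis (no_types) ck_on_1D(3) continuous_on_eq_continuous_at)
    then have cdg: "isCont (\<lambda>s. dg (x s) (1, 0, 0, 0)) 0" by (rule isCont_o2[OF cx])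
    have "isCont q 0" unfolding q_def[abs_def] by (intro continuous_intros cg cdg)
    then have q0: "(q \<longlongrightarrow> 2 * g (0, 0, 0, \<tau>) - \<tau>) (at_right 0)"
      by (simp add: isCont_def q_def x_def filterlim_at_split)
    have "\<bar>2 * g (0, 0, 0, \<tau>) - \<tau>\<bar> \<le> \<epsilon>" if \<epsilon>: "\<epsilon> > 0" for \<epsilon>
    proof -
      obtain d where d: "d > 0" "\<And>z. norm z < d \<Longrightarrow>
        (z, \<tau>) \<in> U \<and> norm (reduced_field f L ip Psi W z \<tau> - \<tau> *\<^sub>R L0 z) \<le> \<epsilon> * norm z"
        using \<tau>1(3)[OF \<tau> \<epsilon>] by blast
      have bound: "\<bar>q s\<bar> \<le> \<epsilon>" if s: "0 < s" "s < d" for s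
      proof -
        define z :: c2 where "z = (of_real s, 0)"
        define e where "e = reduced_field f L ip Psi W z \<tau> - \<tau> *\<^sub>R L0 z"
        have nz: "norm z = s" using s by (simp add: z_def)
        then have U: "(z, \<tau>) \<in> U" and e: "norm e \<le> \<epsilon> * s" using d(2)[of z] s by (simp_all add: e_def)
        have inv: "invN z = s * s" "invC z = 0" "invD z = 0" "invdelta z = s * s"
          by (simp_all add: z_def invN_def invC_def invD_def invdelta_def power2_eq_square)
        have "reduced_field f L ip Psi W z \<tau> = J0 (grad (\<lambda>z. h z \<tau>) z)"
          using h U unfolding reduced_hamiltonian_def by blast
        then have "J0 (grad (\<lambda>z. h z \<tau>) z) = \<tau> *\<^sub>R L0 z + e" by (simp add: e_def)
        then have "J0 (J0 (grad (\<lambda>z. h z \<tau>) z)) = J0 (\<tau> *\<^sub>R L0 z + e)" by (rule arg_cong)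
        then have "- grad (\<lambda>z. h z \<tau>) z = \<tau> *\<^sub>R J0 (L0 z) + J0 e"
          by (simp add: linear_add[OF linear_J0] linear_scale[OF linear_J0])
        then have gr: "grad (\<lambda>z. h z \<tau>) z = \<tau> *\<^sub>R (fst z, - snd z) - J0 e"
        proof -
          have "grad (\<lambda>z. h z \<tau>) z = - (\<tau> *\<^sub>R J0 (L0 z) + J0 e)"
            using \<open>- grad (\<lambda>z. h z \<tau>) z = \<tau> *\<^sub>R J0 (L0 z) + J0 e\<close> by (metis minus_minus)
          then show ?thesis by (simp add: J0_L0 prod_eq_iff)
        qed
        have "(\<lambda>z. h z \<tau>) differentiable (at z)"
          using h_has_derivative[OF U] by (rule differentiableI)
        from has_derivative_unique[OF has_derivative_grad(1)[OF this] h_has_derivative[OF U]]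
        have "(1, 0) \<bullet> grad (\<lambda>z. h z \<tau>) z = s * s * dg (x s) (2 * s, 0, 0, 0) + 2 * s * g (x s)"
          by (simp add: fun_eq_iff inv) (simp add: z_def x_def inner_prod_def inner_complex_def)
        moreover have "dg (x s) (2 * s, 0, 0, 0) = 2 * s * dg (x s) (1, 0, 0, 0)"
        proof -
          have "x s \<in> G" using UG[OF U] by (simp add: inv x_def)
          from linear_scale[OF linear_dg[OF this], of "2 * s" "(1, 0, 0, 0)"] show ?thesis by simp
        qed
        moreover have "(1, 0) \<bullet> grad (\<lambda>z. h z \<tau>) z = \<tau> * s - (1, 0) \<bullet> J0 e"
          unfolding gr by (simp add: inner_diff_right z_def inner_prod_def inner_complex_def)
        ultimately have "s * q s = - ((1, 0) \<bullet> J0 e)"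
          by (simp add: q_def algebra_simps)
        moreover have "\<bar>(1, 0) \<bullet> J0 e\<bar> \<le> norm e"
          using Cauchy_Schwarz_ineq2[of "(1::complex, 0::complex)" "J0 e"] by simp
        ultimately have "\<bar>s * q s\<bar> \<le> \<epsilon> * s" using e by simp
        then show ?thesis using s by (simp add: abs_mult mult.commute)
      qed
      have "((\<lambda>s. \<bar>q s\<bar>) \<longlongrightarrow> \<bar>2 * g (0, 0, 0, \<tau>) - \<tau>\<bar>) (at_right 0)"
        by (rule tendsto_rabs[OF q0])
      moreover have "eventually (\<lambda>s. \<bar>q s\<bar> \<le> \<epsilon>) (at_right 0)"
        using d(1) bound unfolding eventually_at_right_field by blast
      ultimately show ?thesis
        by (rule tendsto_upperbound) simp
    qed
    then have "\<bar>2 * g (0, 0, 0, \<tau>) - \<tau>\<bar> \<le> 0" by (rule field_le_epsilon) simp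
    then show "(0, 0, 0, \<tau>) \<in> G \<and> g (0, 0, 0, \<tau>) = \<tau> / 2" using inG by simp
  qed
qed

text \<open>Differentiating the identity on the axis gives g_\<tau>(0) = 1/2, the nonzero
  coefficient that makes both implicit equations solvable for \<tau>.\<close>

lemma zero_in_G: "(0, 0, 0, 0) \<in> G"
  and g_0: "g (0, 0, 0, 0) = 0"
  and dg_0_tau: "dg (0, 0, 0, 0) (0, 0, 0, k) = k / 2"
proof -
  obtain \<tau>1 where \<tau>1: "\<tau>1 > 0" "\<And>\<tau>. \<bar>\<tau>\<bar> < \<tau>1 \<Longrightarrow> (0, 0, 0, \<tau>) \<in> G \<and> g (0, 0, 0, \<tau>) = \<tau> / 2"
    using g_on_axis by blast
  show inG: "(0, 0, 0, 0) \<in> G" and "g (0, 0, 0, 0) = 0"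
    using \<tau>1(2)[of 0] \<tau>1(1) by simp_all
  have "((\<lambda>t::real. (0::real, 0::real, 0::real, t)) has_derivative (\<lambda>k. (0, 0, 0, k))) (at 0)"
    by (intro has_derivative_Pair has_derivative_const has_derivative_ident)
  from has_derivative_compose[OF this g_has_derivative[OF inG]]
  have 1: "((\<lambda>t. g (0, 0, 0, t)) has_derivative (\<lambda>k. dg (0, 0, 0, 0) (0, 0, 0, k))) (at 0)" .
  have "((\<lambda>t::real. t / 2) has_derivative (\<lambda>k. k / 2)) (at 0)"
    by (auto intro!: derivative_eq_intros)
  then have "((\<lambda>t. g (0, 0, 0, t)) has_derivative (\<lambda>k. k / 2)) (at 0)"
    by (rule has_derivative_transform_within_open[of _ _ _ _ "ball 0 \<tau>1"])
      (use \<tau>1 in \<open>auto simp: dist_real_def\<close>)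
  from has_derivative_unique[OF 1 this] show "dg (0, 0, 0, 0) (0, 0, 0, k) = k / 2" by meson
qed

end

section \<open>The family in the cone\<close>

text \<open>If the moduli agree, the swap of coordinates is the rotation by the argument of z2 / z1.
  This is why every orbit in the cone is symmetric under \<open>R\<close>.\<close>

lemma R0_eq_rotI:
  assumes "cmod (fst z) = cmod (snd z)"
  obtains \<theta> where "R0 z = rot \<theta> z"
proof (cases "fst z = 0")
  case True
  then show ?thesis using assms that[of 0] by (simp add: R0_def rot_def prod_eq_iff)
next
  case False
  then have "cmod (snd z / fst z) = 1" using assms[symmetric] by (simp add: norm_divide)
  then obtain \<theta> where \<theta>: "snd z / fst z = cis \<theta>"
    by (metis cis_Arg complex_eq_0 div_by_1 norm_zero of_real_1 sgn_eq zero_neq_one)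
  then have "snd z = cis \<theta> * fst z" using False by (simp add: field_simps)
  moreover from this have "fst z = cis (- \<theta>) * snd z"
    by (simp add: cis_mult flip: mult.assoc)
  ultimately show ?thesis using that[of \<theta>] by (simp add: R0_def rot_def)
qed

lemma rot_product: "fst (rot \<theta> z) * snd (rot \<theta> z) = fst z * snd z"
proof -
  have "fst (rot \<theta> z) * snd (rot \<theta> z) = (cis \<theta> * cis (- \<theta>)) * (fst z * snd z)"
    by (simp add: rot_def)
  then show ?thesis by (simp add: cis_mult)
qed

lemma exchanges_orbits:
  assumes "\<And>p. p \<in> P \<Longrightarrow> Q ` range (A p) = range (B p)" "\<And>p. p \<in> P \<Longrightarrow> Q ` range (B p) = range (A p)"
  shows "exchanges Q (orbits P A) (orbits P B)"
proof -
  have "(\<lambda>M. Q ` M) ` ((\<lambda>p. range (A p)) ` P) = (\<lambda>p. range (B p)) ` P"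
    if "\<And>p. p \<in> P \<Longrightarrow> Q ` range (A p) = range (B p)" for A B
    unfolding image_image[of "\<lambda>M. Q ` M"] by (rule image_cong[OF refl that])
  from this[of A B, OF assms(1)] this[of B A, OF assms(2)] show ?thesis
    unfolding exchanges_def orbits_def by (rule conjI)
qed

context reduced_normal_form
begin

lemma small_parameters:
  obtains d where "d > 0" "d \<le> 1 / 2" "\<And>z \<tau>. norm z < d \<Longrightarrow> \<bar>\<tau>\<bar> < d \<Longrightarrow> (z, \<tau>) \<in> U"
proof -
  obtain d where d: "d > 0" "\<And>z \<tau>. norm z < d \<Longrightarrow> \<bar>\<tau> - 0\<bar> < d \<Longrightarrow> (z, \<tau>) \<in> U \<and> c1_norm (W z \<tau>) < 1"
    using small_W[OF U(2), of 1] by auto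
  show ?thesis by (rule that[of "min d (1 / 2)"]) (use d in auto)
qed

text \<open>A section of the circle action on the cone \<open>\<delta> = 0\<close>, parametrized by the invariant \<open>z\<^sub>1 z\<^sub>2\<close>.\<close>

definition cone_section :: "real \<times> real \<Rightarrow> c2" where
  "cone_section p = (Complex (fst p) (snd p) / of_real (sqrt (norm p)), of_real (sqrt (norm p)))"

lemma cone_section:
  assumes "p \<noteq> 0"
  shows "cmod (fst (cone_section p)) = sqrt (norm p)" "cmod (snd (cone_section p)) = sqrt (norm p)"
    "fst (cone_section p) * snd (cone_section p) = Complex (fst p) (snd p)"
proof -
  have n: "cmod (Complex (fst p) (snd p)) = norm p"
    by (simp add: cmod_def norm_prod_def)
  have "norm p > 0" using assms by simp
  then have "norm p / sqrt (norm p) = sqrt (norm p)" by (simp add: real_div_sqrt)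
  then show "cmod (fst (cone_section p)) = sqrt (norm p)"
    by (simp add: cone_section_def norm_divide n)
  show "cmod (snd (cone_section p)) = sqrt (norm p)" by (simp add: cone_section_def)
  show "fst (cone_section p) * snd (cone_section p) = Complex (fst p) (snd p)"
    using \<open>norm p > 0\<close> by (simp add: cone_section_def)
qed

lemma cone_section_invariants:
  assumes "p \<noteq> 0"
  shows "invN (cone_section p) = 2 * norm p" "invdelta (cone_section p) = 0"
    "invC (cone_section p) = 2 * fst p" "invD (cone_section p) = 2 * snd p" "norm (cone_section p) = sqrt (2 * norm p)"
proof -
  show N: "invN (cone_section p) = 2 * norm p" and "invdelta (cone_section p) = 0"
    by (simp_all add: invN_def invdelta_def cone_section[OF assms])
  show "norm (cone_section p) = sqrt (2 * norm p)"
    using N by (simp add: invN_eq norm_eq_sqrt_inner)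
  have eq: "2 * fst (cone_section p) * snd (cone_section p) = 2 * Complex (fst p) (snd p)"
    using cone_section(3)[OF assms] by (simp add: mult.assoc)
  show "invC (cone_section p) = 2 * fst p" "invD (cone_section p) = 2 * snd p"
    unfolding invC_def invD_def eq by simp_all
qed

lemma continuous_cone_section: "continuous_on (UNIV - {0}) cone_section"
proof -
  have "continuous_on (UNIV - {0}) (\<lambda>p::real \<times> real. Complex (fst p) (snd p))"
    unfolding Complex_eq by (intro continuous_intros)
  then show ?thesis
    unfolding cone_section_def[abs_def]
    by (intro continuous_on_Pair continuous_on_divide continuous_on_of_real continuous_on_real_sqrt
        continuous_on_norm continuous_on_id) auto
qed

lemma tendsto_cone_section: "(cone_section \<longlongrightarrow> 0) (at 0)"
proof (rule Lim_null_comparison)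
  show "eventually (\<lambda>p. norm (cone_section p) \<le> sqrt (2 * norm p)) (at 0)"
    by (rule eventually_at_topological[THEN iffD2]) (auto intro!: exI[of _ UNIV] simp: cone_section_invariants)
  have "((\<lambda>p::real \<times> real. sqrt (2 * norm p)) \<longlongrightarrow> sqrt (2 * norm (0::real \<times> real))) (at 0)"
    by (intro tendsto_intros)
  then show "((\<lambda>p::real \<times> real. sqrt (2 * norm p)) \<longlongrightarrow> 0) (at 0)" by simp
qed

text \<open>On the cone the differential of h = \<delta> g is g times that of \<delta>, so g = 0
  suffices, and g_\<tau>(0) = 1/2 lets this be solved for \<tau>. The parameter p = z1 z2 is
  invariant under the circle action and thus separates orbits. \<open>S\<close> conjugates p, so the
  S-symmetric orbits are those with real p; the two halves of the axis are the two special
  branches.\<close>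

lemma R_symmetric_family:
  "\<exists>\<rho>>0. \<exists>(\<zeta> :: real \<times> real \<Rightarrow> c2) \<tau> X T. let P = ball 0 \<rho> - {0} in
     orbit_family f P X T \<and> emanates_from_0 P X \<and>
     corresponds_on Psi U W h P \<zeta> \<tau> X T \<and>
     (\<forall>p\<in>P. invdelta (\<zeta> p) = 0 \<and> reversing_symmetric R (X p)) \<and>
     (\<exists>\<epsilon> \<gamma>1 \<gamma>2.
        liapunov_centre_family f \<epsilon> (X \<circ> \<gamma>1) (T \<circ> \<gamma>1) \<and>
        liapunov_centre_family f \<epsilon> (X \<circ> \<gamma>2) (T \<circ> \<gamma>2) \<and>
        \<gamma>1 ` {0<..<\<epsilon>} \<inter> \<gamma>2 ` {0<..<\<epsilon>} = {} \<and>
        \<gamma>1 ` {0<..<\<epsilon>} \<union> \<gamma>2 ` {0<..<\<epsilon>} = {p \<in> P. equivariant_symmetric S (X p)}) \<and>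
     (T \<longlongrightarrow> 2 * pi) (at 0 within P)"
proof -
  define F where "F q = g (fst (fst q), fst (snd (fst q)), snd (snd (fst q)), snd q)" for q :: "(real \<times> real \<times> real) \<times> real"
  define M where "M q = (fst (fst q), fst (snd (fst q)), snd (snd (fst q)), snd q)" for q :: "(real \<times> real \<times> real) \<times> real"
  have M: "linear M" by (rule linearI) (simp_all add: M_def)
  define V where "V = M -` G"
  have "open V"
    unfolding V_def by (rule open_vimage[OF G linear_continuous_on[OF M[unfolded linear_conv_bounded_linear]]])
  have F: "ck_on (Suc 0) F V"
  proof -
    have "ck_on (Suc 0) (\<lambda>q. g (M q)) V"
      by (rule ck_on_1_compose[OF g_C1 ck_on_1_linear[OF M]]) (simp add: V_def)
    then show ?thesis by (simp add: F_def[abs_def] M_def)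
  qed
  have "((\<lambda>t::real. (0::real, 0::real, 0::real, t)) has_derivative (\<lambda>k. (0, 0, 0, k))) (at 0)"
    by (intro has_derivative_Pair has_derivative_const has_derivative_ident)
  from has_derivative_compose[OF this g_has_derivative[OF zero_in_G]]
  have D: "((\<lambda>y. F (0, y)) has_derivative (\<lambda>k. k / 2)) (at 0)"
    by (simp add: F_def dg_0_tau)
  have V0: "(0, 0) \<in> V" using zero_in_G by (simp add: V_def M_def)
  have F0: "F (0, 0) = 0" by (simp add: F_def g_0)
  obtain r y where r: "r > 0" "continuous_on (ball 0 r) y" "y 0 = 0"
    "\<And>x. x \<in> ball 0 r \<Longrightarrow> (x, y x) \<in> V \<and> F (x, y x) = 0"
    using implicit_function[OF \<open>open V\<close> V0 F0 F D] by (auto simp: inj_def)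
  obtain d where d: "d > 0" "d \<le> 1 / 2" "\<And>z \<tau>. norm z < d \<Longrightarrow> \<bar>\<tau>\<bar> < d \<Longrightarrow> (z, \<tau>) \<in> U"
    using small_parameters by blast
  \<comment> \<open>The invariants N, C and D^2 at \<open>cone_section p\<close>, inserted into the
    solution \<open>y\<close> of g = 0.\<close>
  define s where "s p = (2 * norm p, 2 * fst p, (2 * snd p)\<^sup>2)" for p :: "real \<times> real"
  have cs: "continuous_on A s" for A unfolding s_def[abs_def] by (intro continuous_intros)
  have s0: "s 0 = 0" by (simp add: s_def zero_prod_def)
  define \<tau> where "\<tau> p = y (s p)" for p
  have "isCont y (s 0)" using r(1,2) by (simp add: s0 continuous_on_eq_continuous_at)
  moreover have cs0: "isCont s 0"
    using cs[of UNIV] unfolding continuous_on_eq_continuous_at[OF open_UNIV] by blast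
  ultimately have c\<tau>0: "isCont \<tau> 0" unfolding \<tau>_def[abs_def] by (rule isCont_o2[rotated])
  have \<tau>0: "\<tau> 0 = 0" by (simp add: \<tau>_def s0 r)
  have lim\<tau>: "(\<tau> \<longlongrightarrow> 0) (at 0)" using c\<tau>0 by (simp add: isCont_def \<tau>0)
  have "eventually (\<lambda>p. dist (\<tau> p) 0 < d) (at 0)" using lim\<tau> d(1) by (rule tendstoD)
  moreover have "eventually (\<lambda>p. dist (cone_section p) 0 < d) (at 0)" using tendsto_cone_section d(1) by (rule tendstoD)
  moreover have "(s \<longlongrightarrow> 0) (at 0)"
    using cs0 unfolding isCont_def s0 .
  then have "eventually (\<lambda>p. dist (s p) 0 < r) (at 0)" using r(1) by (rule tendstoD)
  ultimately have "eventually (\<lambda>p. norm (\<tau> p) < d \<and> norm (cone_section p) < d \<and> norm (s p) < r) (at 0)"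
    by eventually_elim simp
  then obtain \<rho> where \<rho>: "\<rho> > 0"
    "\<And>p. p \<noteq> 0 \<Longrightarrow> dist p 0 < \<rho> \<Longrightarrow> norm (\<tau> p) < d \<and> norm (cone_section p) < d \<and> norm (s p) < r"
    unfolding eventually_at by blast
  define P :: "(real \<times> real) set" where "P = ball 0 \<rho> - {0}"
  have P: "norm (\<tau> p) < d" "norm (cone_section p) < d" "s p \<in> ball 0 r" "p \<noteq> 0" if "p \<in> P" for p
    using \<rho>(2)[of p] that by (auto simp: P_def)
  have inU: "(cone_section p, \<tau> p) \<in> U" if "p \<in> P" for p
    by (rule d(3)) (use P[OF that] in simp_all)
  have pos: "1 + \<tau> p > 0" if "p \<in> P" for p
    using P(1)[OF that] d(2) by (simp add: abs_less_iff)
  have crit: "grad (\<lambda>z. h z (\<tau> p)) (cone_section p) = 0" if p: "p \<in> P" for p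
  proof (rule grad_0I[OF inU[OF p]])
    have "F (s p, \<tau> p) = 0" using r(4)[OF P(3)[OF p]] by (simp add: \<tau>_def)
    then have "g (invN (cone_section p), invC (cone_section p), (invD (cone_section p))\<^sup>2, \<tau> p) = 0"
      by (simp add: F_def s_def cone_section_invariants[OF P(4)[OF p]])
    then show "invdelta (cone_section p) * dg (invN (cone_section p), invC (cone_section p), (invD (cone_section p))\<^sup>2, \<tau> p) q +
       r * g (invN (cone_section p), invC (cone_section p), (invD (cone_section p))\<^sup>2, \<tau> p) = 0" for q r
      by (simp add: cone_section_invariants(2)[OF P(4)[OF p]])
  qed
  have nz: "cone_section p \<noteq> 0" if "p \<in> P" for p
    using cone_section(3)[OF P(4)[OF that]] P(4)[OF that] by (auto simp: complex_eq_iff prod_eq_iff)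
  have c\<zeta>: "continuous_on P cone_section"
    by (rule continuous_on_subset[OF continuous_cone_section]) (auto simp: P_def)
  have c\<tau>: "continuous_on P \<tau>"
    unfolding \<tau>_def[abs_def] by (rule continuous_on_compose2[OF r(2) cs]) (use P(3) in auto)
  have inj: "p = q" if pq: "p \<in> P" "q \<in> P" "cone_section q = rot \<theta> (cone_section p)" for p q \<theta>
  proof -
    have "Complex (fst q) (snd q) = Complex (fst p) (snd p)"
      using rot_product[of \<theta> "cone_section p"] pq
      by (simp flip: cone_section(3)[OF P(4)[OF pq(1)]] cone_section(3)[OF P(4)[OF pq(2)]])
    then show ?thesis by (simp add: prod_eq_iff)
  qed
  define X where "X = (\<lambda>p. lifted Psi W (cone_section p) (\<tau> p))"
  define T where "T = (\<lambda>p. 2 * pi / (1 + \<tau> p))"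
  have lim: "(cone_section \<longlongrightarrow> 0) (at 0 within P)" "(\<tau> \<longlongrightarrow> 0) (at 0 within P)"
    using tendsto_cone_section lim\<tau> by (auto intro: tendsto_within_subset)
  have fam: "orbit_family f P X T" "emanates_from_0 P X" "(T \<longlongrightarrow> 2 * pi) (at 0 within P)"
    "corresponds_on Psi U W h P cone_section \<tau> X T"
    by (rule periodic_orbit_family[OF c\<zeta> c\<tau> inU pos crit nz lim inj X_def T_def]; assumption)+
  have RU: "(R0 (cone_section p), \<tau> p) \<in> U" "(S0 (cone_section p), \<tau> p) \<in> U" if "p \<in> P" for p
    using P[OF that] by (auto intro!: d(3))
  have rot_R: "\<exists>\<theta>. R0 (cone_section p) = rot \<theta> (cone_section p)" if "p \<in> P" for p
    using R0_eq_rotI[of "cone_section p"] cone_section[OF P(4)[OF that]] by metis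
  have Rsym: "reversing_symmetric R (X p)" if p: "p \<in> P" for p
    unfolding X_def using rot_R[OF p] reversing_symmetric_R[OF inU[OF p] RU(1)[OF p] pos[OF p]] by blast
  \<comment> \<open>For real p both coordinates of the section are real, so \<open>S0\<close> acts
    as \<open>R0\<close>, which is a rotation on the cone. Conversely, symmetry makes the invariant
    z1 z2 equal to its conjugate.\<close>
  have Ssym: "equivariant_symmetric S (X p) \<longleftrightarrow> snd p = 0" if p: "p \<in> P" for p
  proof
    assume "snd p = 0"
    then have "S0 (cone_section p) = R0 (cone_section p)"
      by (simp add: S0_def R0_def cone_section_def complex_eq_iff)
    then show "equivariant_symmetric S (X p)"
      unfolding X_def using rot_R[OF p] equivariant_symmetric_S[OF inU[OF p] RU(2)[OF p] pos[OF p]] by metis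
  next
    assume "equivariant_symmetric S (X p)"
    then obtain \<theta> where \<theta>: "S0 (rot \<theta> (cone_section p)) = cone_section p"
      unfolding X_def using equivariant_symmetric_S_D[OF inU[OF p] pos[OF p]] by blast
    have "fst (S0 (rot \<theta> (cone_section p))) * snd (S0 (rot \<theta> (cone_section p))) =
        cnj (fst (rot \<theta> (cone_section p)) * snd (rot \<theta> (cone_section p)))"
      by (simp add: S0_def)
    then have "fst (cone_section p) * snd (cone_section p) = cnj (fst (cone_section p) * snd (cone_section p))"
      by (simp only: \<theta> rot_product)
    then show "snd p = 0" by (simp only: cone_section(3)[OF P(4)[OF p]]) (simp add: complex_eq_iff)
  qed
  have sub: "liapunov_centre_family f \<rho> (X \<circ> \<gamma>) (T \<circ> \<gamma>)"
    if \<gamma>: "\<gamma> = (\<lambda>s. (a * s, 0))" and a: "a = 1 \<or> a = - 1" for \<gamma> and a :: real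
  proof -
    have \<gamma>P: "\<gamma> s \<in> P" if "s \<in> {0<..<\<rho>}" for s
    proof -
      have "norm (\<gamma> s) = s" using that a by (auto simp: \<gamma> norm_Pair)
      then show ?thesis using that by (auto simp: P_def)
    qed
    have c: "continuous_on {0<..<\<rho>} \<gamma>" unfolding \<gamma> by (intro continuous_intros)
    have "isCont \<gamma> 0" unfolding \<gamma> by (intro continuous_intros)
    then have l0: "(\<gamma> \<longlongrightarrow> 0) (at 0 within {0<..<\<rho>})"
      by (auto simp: isCont_def \<gamma> zero_prod_def intro: tendsto_within_subset)
    have l: "filterlim \<gamma> (at 0 within P) (at 0 within {0<..<\<rho>})"
      unfolding filterlim_at
    proof (rule conjI[OF _ l0])
      show "eventually (\<lambda>s. \<gamma> s \<in> P \<and> \<gamma> s \<noteq> 0) (at 0 within {0<..<\<rho>})"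
        using \<gamma>P P(4) by (auto simp: eventually_at_filter intro: always_eventually)
    qed
    have inj': "s = t" if "s \<in> {0<..<\<rho>}" "t \<in> {0<..<\<rho>}" "cone_section (\<gamma> t) = rot \<theta> (cone_section (\<gamma> s))" for s t \<theta>
      using inj[OF \<gamma>P[OF that(1)] \<gamma>P[OF that(2)] that(3)] a by (auto simp: \<gamma>)
    have X': "X \<circ> \<gamma> = (\<lambda>s. lifted Psi W (cone_section (\<gamma> s)) (\<tau> (\<gamma> s)))"
      and T': "T \<circ> \<gamma> = (\<lambda>s. 2 * pi / (1 + \<tau> (\<gamma> s)))" by (simp_all add: X_def T_def o_def)
    have img: "\<gamma> ` {0<..<\<rho>} \<subseteq> P" using \<gamma>P by blast
    have "orbit_family f {0<..<\<rho>} (X \<circ> \<gamma>) (T \<circ> \<gamma>)" "emanates_from_0 {0<..<\<rho>} (X \<circ> \<gamma>)"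
      by (rule periodic_orbit_family[OF continuous_on_compose2[OF c\<zeta> c img] continuous_on_compose2[OF c\<tau> c img] inU[OF \<gamma>P]
          pos[OF \<gamma>P] crit[OF \<gamma>P] nz[OF \<gamma>P] filterlim_compose[OF lim(1) l] filterlim_compose[OF lim(2) l]
          inj' X' T']; assumption)+
    then show ?thesis using \<rho>(1) by (simp add: liapunov_centre_family_def)
  qed
  define \<gamma>1 \<gamma>2 :: "real \<Rightarrow> real \<times> real" where "\<gamma>1 = (\<lambda>s. (1 * s, 0))" and "\<gamma>2 = (\<lambda>s. (- 1 * s, 0))"
  have union: "\<gamma>1 ` {0<..<\<rho>} \<union> \<gamma>2 ` {0<..<\<rho>} = {p \<in> P. equivariant_symmetric S (X p)}"
  proof (intro equalityI subsetI)
    fix p assume "p \<in> \<gamma>1 ` {0<..<\<rho>} \<union> \<gamma>2 ` {0<..<\<rho>}"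
    then have "norm p \<in> {0<..<\<rho>}" "snd p = 0" by (auto simp: \<gamma>1_def \<gamma>2_def norm_Pair zero_prod_def)
    then have "p \<in> P" "snd p = 0" by (auto simp: P_def)
    then show "p \<in> {p \<in> P. equivariant_symmetric S (X p)}" using Ssym by blast
  next
    fix p assume "p \<in> {p \<in> P. equivariant_symmetric S (X p)}"
    then have p: "p \<in> P" and "equivariant_symmetric S (X p)" by blast+
    then have p: "p \<in> P" "snd p = 0" using Ssym[OF p] by blast+
    then have "norm p = \<bar>fst p\<bar>" by (simp add: norm_prod_def)
    moreover have "norm p < \<rho>" using p(1) by (simp add: P_def)
    moreover have "0 < norm p" using P(4)[OF p(1)] by simp
    ultimately have n: "0 < \<bar>fst p\<bar>" "\<bar>fst p\<bar> < \<rho>" by (simp_all only:)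
    show "p \<in> \<gamma>1 ` {0<..<\<rho>} \<union> \<gamma>2 ` {0<..<\<rho>}"
    proof (cases "fst p > 0")
      case True
      then have "p = \<gamma>1 (fst p)" "fst p \<in> {0<..<\<rho>}" using p n by (simp_all add: \<gamma>1_def prod_eq_iff)
      then show ?thesis by blast
    next
      case False
      then have "p = \<gamma>2 (- fst p)" "- fst p \<in> {0<..<\<rho>}" using p n by (simp_all add: \<gamma>2_def prod_eq_iff)
      then show ?thesis by blast
    qed
  qed
  have disjoint: "\<gamma>1 ` {0<..<\<rho>} \<inter> \<gamma>2 ` {0<..<\<rho>} = {}"
  proof (rule equals0I)
    fix x assume "x \<in> \<gamma>1 ` {0<..<\<rho>} \<inter> \<gamma>2 ` {0<..<\<rho>}"
    moreover have "fst x > 0" if "x \<in> \<gamma>1 ` {0<..<\<rho>}" using that by (auto simp: \<gamma>1_def)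
    moreover have "fst x < 0" if "x \<in> \<gamma>2 ` {0<..<\<rho>}" using that by (auto simp: \<gamma>2_def)
    ultimately have "fst x > 0" "fst x < 0" by blast+
    then show False by simp
  qed
  have special: "\<forall>p\<in>P. invdelta (cone_section p) = 0 \<and> reversing_symmetric R (X p)"
    using Rsym cone_section_invariants(2) P(4) by blast
  have sub1: "liapunov_centre_family f \<rho> (X \<circ> \<gamma>1) (T \<circ> \<gamma>1)" by (rule sub[OF \<gamma>1_def]) simp
  have sub2: "liapunov_centre_family f \<rho> (X \<circ> \<gamma>2) (T \<circ> \<gamma>2)" by (rule sub[OF \<gamma>2_def]) simp
  show ?thesis
    unfolding Let_def
    by (rule exI, rule conjI[OF \<rho>(1)], (rule exI)+, rule conjI[OF fam(1)[unfolded P_def]],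
        rule conjI[OF fam(2)[unfolded P_def]], rule conjI[OF fam(4)[unfolded P_def]],
        rule conjI[OF special[unfolded P_def]], rule conjI[OF _ fam(3)[unfolded P_def]], (rule exI)+,
        rule conjI[OF sub1 conjI[OF sub2 conjI[OF disjoint union[unfolded P_def]]]])
qed

end

section \<open>The two Liapunov centre families\<close>

text \<open>The quadratic takes the values 2 (n + c) at 1 and -2 (n - c) at -1, of opposite sign if
  n^2 > c^2. Its derivative 2 (n + k c) cannot vanish for |k| < 1, as then |n| \<le> |c|; so the
  root is simple.\<close>

lemma slope_exists:
  fixes n c :: real
  assumes "n\<^sup>2 - c\<^sup>2 > 0"
  obtains k where "\<bar>k\<bar> < 1" "2 * k * n + (1 + k * k) * c = 0" "n + k * c \<noteq> 0"
proof -
  define p where "p k = 2 * k * n + (1 + k * k) * c" for k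
  have cont: "continuous_on A p" for A
    unfolding p_def[abs_def] by (intro continuous_intros)
  have "(n + c) * (n - c) > 0" using assms by (simp add: power2_eq_square algebra_simps)
  then consider "n + c > 0" "n - c > 0" | "n + c < 0" "n - c < 0"
    by (auto simp: zero_less_mult_iff)
  then have "\<exists>k. - 1 \<le> k \<and> k \<le> 1 \<and> p k = 0"
  proof cases
    case 1
    then have "p (- 1) \<le> 0" "0 \<le> p 1" by (simp_all add: p_def)
    then show ?thesis by (rule IVT'[OF _ _ _ cont]) simp
  next
    case 2
    then have "p 1 \<le> 0" "0 \<le> p (- 1)" by (simp_all add: p_def)
    then show ?thesis by (rule IVT2'[OF _ _ _ cont]) simp
  qed
  then obtain k where k: "- 1 \<le> k" "k \<le> 1" "p k = 0" by blast
  have "p 1 = 2 * (n + c)" "p (- 1) = - 2 * (n - c)" by (simp_all add: p_def)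
  moreover have "n + c \<noteq> 0" "n - c \<noteq> 0" using \<open>(n + c) * (n - c) > 0\<close> by auto
  ultimately have "p 1 \<noteq> 0" "p (- 1) \<noteq> 0" by simp_all
  then have "k \<noteq> 1" "k \<noteq> - 1" using k(3) by metis+
  then have "\<bar>k\<bar> < 1" using k by (simp add: abs_less_iff)
  moreover have "n + k * c \<noteq> 0"
  proof
    assume "n + k * c = 0"
    then have "\<bar>n\<bar> = \<bar>k\<bar> * \<bar>c\<bar>" by (simp add: abs_mult[symmetric] add_eq_0_iff)
    also have "\<dots> \<le> 1 * \<bar>c\<bar>" using \<open>\<bar>k\<bar> < 1\<close> by (intro mult_right_mono) simp_all
    finally have "n\<^sup>2 \<le> c\<^sup>2" by (simp add: abs_le_square_iff)
    then show False using assms by simp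
  qed
  ultimately show ?thesis using that k(3) by (simp add: p_def)
qed

text \<open>\<open>c1\<close> and \<open>c2\<close> are the two derivatives without their common
  factor a, with e in the role of g. Hypothesis 1 is k c1 + c2 = 0 divided by \<delta>, hypothesis 2
  is c1 - k c2 = 0. The combination has determinant of absolute value 1 + k^2, hence can be
  undone.\<close>

lemma critical_ray:
  fixes a k N C e :: real
  assumes 1: "2 * k * N + (1 + k * k) * C = 0"
    and 2: "(1 + k * k) * e + a * a * ((1 - k * k) * (1 - k * k)) * N = 0"
  defines "\<delta> \<equiv> a * a - (a * k) * (a * k)"
  shows "\<delta> * (a * N + a * k * C) + a * e = 0" "\<delta> * (a * k * N + a * C) - a * k * e = 0"
proof -
  define c1 where "c1 = \<delta> * (N + k * C) + e"
  define c2 where "c2 = \<delta> * (k * N + C) - k * e"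
  have "(1 + k * k) * c1 = ((1 + k * k) * e + a * a * ((1 - k * k) * (1 - k * k)) * N) +
      k * \<delta> * (2 * k * N + (1 + k * k) * C)"
    by (simp add: c1_def \<delta>_def algebra_simps)
  then have "(1 + k * k) * c1 = 0" by (simp add: 1 2)
  moreover have "1 + k * k > 0" by (simp add: add_pos_nonneg)
  ultimately have c1: "c1 = 0" by simp
  have "c2 = \<delta> * (2 * k * N + (1 + k * k) * C) - k * c1"
    by (simp add: c1_def c2_def algebra_simps)
  then have c2: "c2 = 0" by (simp add: 1 c1)
  have "\<delta> * (a * N + a * k * C) + a * e = a * c1" "\<delta> * (a * k * N + a * C) - a * k * e = a * c2"
    by (simp_all add: c1_def c2_def algebra_simps)
  then show "\<delta> * (a * N + a * k * C) + a * e = 0" "\<delta> * (a * k * N + a * C) - a * k * e = 0"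
    by (simp_all add: c1 c2)
qed

context reduced_normal_form
begin

text \<open>At real points D = 0, so the derivative of D^2 drops out, and derivatives in imaginary
  directions vanish. Hypotheses 1 and 2 are half the derivatives in the two real directions.\<close>

lemma grad_0_real:
  fixes x y \<tau> :: real
  defines "q \<equiv> (x * x + y * y, 2 * x * y, 0, \<tau>)"
  assumes U: "((of_real x, of_real y), \<tau>) \<in> U"
    and 1: "(x * x - y * y) * (x * dg q (1, 0, 0, 0) + y * dg q (0, 1, 0, 0)) + x * g q = 0"
    and 2: "(x * x - y * y) * (y * dg q (1, 0, 0, 0) + x * dg q (0, 1, 0, 0)) - y * g q = 0"
  shows "grad (\<lambda>z. h z \<tau>) (of_real x, of_real y) = 0"
proof (rule grad_0I[OF U])
  fix v :: c2
  let ?z = "(of_real x, of_real y) :: c2"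
  have inv: "invN ?z = x * x + y * y" "invC ?z = 2 * x * y" "invD ?z = 0" "invdelta ?z = x * x - y * y"
    by (simp_all add: invN_def invC_def invD_def invdelta_def power2_eq_square)
  have "q \<in> G" using UG[OF U] by (simp add: inv q_def)
  define \<alpha> where "\<alpha> = 2 * (x * Re (fst v) + y * Re (snd v))"
  define \<beta> where "\<beta> = 2 * (y * Re (fst v) + x * Re (snd v))"
  have lin: "dg q (\<alpha>, \<beta>, 0, 0) = \<alpha> * dg q (1, 0, 0, 0) + \<beta> * dg q (0, 1, 0, 0)"
  proof -
    have "dg q (\<alpha>, \<beta>, 0, 0) = dg q (\<alpha> *\<^sub>R (1, 0, 0, 0) + \<beta> *\<^sub>R (0, 1, 0, 0))" by simp
    then show ?thesis
      by (simp only: linear_add[OF linear_dg[OF \<open>q \<in> G\<close>]] linear_scale[OF linear_dg[OF \<open>q \<in> G\<close>]] real_scaleR_def)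
  qed
  have \<alpha>: "2 * (?z \<bullet> v) = \<alpha>" and \<beta>: "Re (2 * (fst v * snd ?z + fst ?z * snd v)) = \<beta>"
    and \<gamma>: "2 * (fst ?z \<bullet> fst v - snd ?z \<bullet> snd v) = 2 * (x * Re (fst v) - y * Re (snd v))"
    by (simp_all add: \<alpha>_def \<beta>_def inner_prod_def inner_complex_def algebra_simps)
  have "(x * x - y * y) * (\<alpha> * dg q (1, 0, 0, 0) + \<beta> * dg q (0, 1, 0, 0)) +
      2 * (x * Re (fst v) - y * Re (snd v)) * g q =
      2 * Re (fst v) * ((x * x - y * y) * (x * dg q (1, 0, 0, 0) + y * dg q (0, 1, 0, 0)) + x * g q) +
      2 * Re (snd v) * ((x * x - y * y) * (y * dg q (1, 0, 0, 0) + x * dg q (0, 1, 0, 0)) - y * g q)"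
    by (simp add: \<alpha>_def \<beta>_def algebra_simps)
  then have "(x * x - y * y) * dg q (\<alpha>, \<beta>, 0, 0) + 2 * (x * Re (fst v) - y * Re (snd v)) * g q = 0"
    by (simp only: lin 1 2 mult_zero_right add_0)
  then show "invdelta ?z * dg (invN ?z, invC ?z, (invD ?z)\<^sup>2, \<tau>) (2 * (?z \<bullet> v),
      Re (2 * (fst v * snd ?z + fst ?z * snd v)), 2 * invD ?z * Im (2 * (fst v * snd ?z + fst ?z * snd v)), 0) +
      2 * (fst ?z \<bullet> fst v - snd ?z \<bullet> snd v) * g (invN ?z, invC ?z, (invD ?z)\<^sup>2, \<tau>) = 0"
    unfolding \<alpha> \<beta> \<gamma> inv by (simp add: q_def)
qed

lemma dg_0_N:
  assumes "((\<lambda>s. g (s, 0, 0, 0)) has_real_derivative n) (at 0)"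
  shows "dg (0, 0, 0, 0) (1, 0, 0, 0) = n"
proof -
  have "((\<lambda>s::real. (s, 0::real, 0::real, 0::real)) has_derivative (\<lambda>k. (k, 0, 0, 0))) (at 0)"
    by (intro has_derivative_Pair has_derivative_const has_derivative_ident)
  from has_derivative_compose[OF this g_has_derivative[OF zero_in_G]]
  have "((\<lambda>s. g (s, 0, 0, 0)) has_derivative (\<lambda>k. dg (0, 0, 0, 0) (k, 0, 0, 0))) (at 0)" .
  from fun_cong[OF has_derivative_unique[OF this assms[unfolded has_field_derivative_def]], of 1]
  show ?thesis by simp
qed

lemma dg_0_C:
  assumes "((\<lambda>s. g (0, s, 0, 0)) has_real_derivative c) (at 0)"
  shows "dg (0, 0, 0, 0) (0, 1, 0, 0) = c"
proof -
  have "((\<lambda>s::real. (0::real, s, 0::real, 0::real)) has_derivative (\<lambda>k. (0, k, 0, 0))) (at 0)"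
    by (intro has_derivative_Pair has_derivative_const has_derivative_ident)
  from has_derivative_compose[OF this g_has_derivative[OF zero_in_G]]
  have "((\<lambda>s. g (0, s, 0, 0)) has_derivative (\<lambda>k. dg (0, 0, 0, 0) (0, k, 0, 0))) (at 0)" .
  from fun_cong[OF has_derivative_unique[OF this assms[unfolded has_field_derivative_def]], of 1]
  show ?thesis by simp
qed

text \<open>At a = 0 the Jacobian in (k, \<tau>) is triangular: the second equation does not vary
  with k there because g vanishes at the origin. The diagonal entries are 2 (n + k0 c) and (1 +
  k0^2) / 2, both nonzero.\<close>

lemma ray_equations:
  assumes n: "((\<lambda>s. g (s, 0, 0, 0)) has_real_derivative n) (at 0)"
    and c: "((\<lambda>s. g (0, s, 0, 0)) has_real_derivative c) (at 0)" and nc: "n\<^sup>2 - c\<^sup>2 > 0"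
  obtains k0 r y where "\<bar>k0\<bar> < 1" "r > 0" "continuous_on (ball 0 r) y" "y 0 = (k0, 0)"
    "\<And>a k \<tau>. \<bar>a\<bar> < r \<Longrightarrow> y a = (k, \<tau>) \<Longrightarrow>
      (let q = (a * a + (a * k) * (a * k), 2 * a * (a * k), 0, \<tau>) in
       2 * k * dg q (1, 0, 0, 0) + (1 + k * k) * dg q (0, 1, 0, 0) = 0 \<and>
       (1 + k * k) * g q + a * a * ((1 - k * k) * (1 - k * k)) * dg q (1, 0, 0, 0) = 0)"
proof -
  obtain k0 where k0: "\<bar>k0\<bar> < 1" "2 * k0 * n + (1 + k0 * k0) * c = 0" "n + k0 * c \<noteq> 0"
    using slope_exists[OF nc] by blast
  define Q :: "real \<times> real \<times> real \<Rightarrow> real \<times> real \<times> real \<times> real" where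
    "Q p = (fst p * fst p + (fst p * fst (snd p)) * (fst p * fst (snd p)),
      2 * fst p * (fst p * fst (snd p)), 0, snd (snd p))" for p
  \<comment> \<open>Differences are written with a factor -1, so that the C^1 rules for sums and
    products apply.\<close>
  define F where "F p = (2 * fst (snd p) * dg (Q p) (1, 0, 0, 0) +
      (1 + fst (snd p) * fst (snd p)) * dg (Q p) (0, 1, 0, 0),
      (1 + fst (snd p) * fst (snd p)) * g (Q p) +
      fst p * fst p * ((1 + (- 1) * (fst (snd p) * fst (snd p))) * (1 + (- 1) * (fst (snd p) * fst (snd p)))) *
        dg (Q p) (1, 0, 0, 0))" for p
  define V where "V = Q -` G"
  have "open V"
    unfolding V_def by (rule open_vimage[OF G]) (unfold Q_def[abs_def], intro continuous_intros)
  have Q0: "Q (0, y) = (0, 0, 0, snd y)" for y by (simp add: Q_def)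
  have V0: "(0, (k0, 0)) \<in> V" using zero_in_G by (simp add: V_def Q0)
  have pr: "ck_on (Suc 0) (\<lambda>p::real \<times> real \<times> real. fst p) V" "ck_on (Suc 0) (\<lambda>p::real \<times> real \<times> real. fst (snd p)) V"
    "ck_on (Suc 0) (\<lambda>p::real \<times> real \<times> real. snd (snd p)) V"
    by (rule ck_on_1_linear, (rule linearI; simp))+
  have Q: "ck_on (Suc 0) Q V"
    unfolding Q_def[abs_def] by (intro ck_on_1_Pair ck_on_1_add ck_on_1_mult pr ck_on_1_const)
  have QV: "Q p \<in> G" if "p \<in> V" for p using that by (simp add: V_def)
  have F: "ck_on (Suc 0) F V"
    unfolding F_def[abs_def]
    by (intro ck_on_1_Pair ck_on_1_add ck_on_1_mult pr ck_on_1_const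
        ck_on_1_compose[OF dg_C1 Q QV] ck_on_1_compose[OF g_C1 Q QV])
  have F0: "F (0, (k0, 0)) = 0"
    by (simp add: F_def Q0 g_0 dg_0_N[OF n] dg_0_C[OF c] k0(2) zero_prod_def)
  have ax: "((\<lambda>y::real \<times> real. (0::real, 0::real, 0::real, snd y)) has_derivative (\<lambda>v. (0, 0, 0, snd v))) (at (k0, 0))"
    by (intro has_derivative_Pair has_derivative_const has_derivative_snd has_derivative_ident)
  \<comment> \<open>\<open>A\<close> and \<open>B\<close>, the derivatives in \<tau> of g_N and g_C,
    enter only the off-diagonal entry.\<close>
  define A where "A v = frechet_derivative (\<lambda>x. dg x (1, 0, 0, 0)) (at (0, 0, 0, 0)) (0, 0, 0, v)" for v
  define B where "B v = frechet_derivative (\<lambda>x. dg x (0, 1, 0, 0)) (at (0, 0, 0, 0)) (0, 0, 0, v)" for v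
  have dA: "((\<lambda>y. dg (0, 0, 0, snd y) (1, 0, 0, 0)) has_derivative (\<lambda>v. A (snd v))) (at (k0, 0))"
    unfolding A_def by (rule has_derivative_compose[OF ax]) (simp, rule ck_on_1D(1)[OF dg_C1 zero_in_G])
  have dB: "((\<lambda>y. dg (0, 0, 0, snd y) (0, 1, 0, 0)) has_derivative (\<lambda>v. B (snd v))) (at (k0, 0))"
    unfolding B_def by (rule has_derivative_compose[OF ax]) (simp, rule ck_on_1D(1)[OF dg_C1 zero_in_G])
  have dC: "((\<lambda>y. g (0, 0, 0, snd y)) has_derivative (\<lambda>v. dg (0, 0, 0, 0) (0, 0, 0, snd v))) (at (k0, 0))"
    by (rule has_derivative_compose[OF ax]) (simp, rule g_has_derivative[OF zero_in_G])
  have A0: "A 0 = 0" "B 0 = 0"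
    using linear_0[OF has_derivative_linear[OF ck_on_1D(1)[OF dg_C1 zero_in_G]]]
    by (simp_all add: A_def B_def zero_prod_def)
  define D where "D v = (2 * k0 * A (snd v) + 2 * fst v * n + ((1 + k0 * k0) * B (snd v) + (k0 * fst v + fst v * k0) * c),
      (1 + k0 * k0) * (snd v / 2))" for v
  have d1: "((\<lambda>y::real \<times> real. 2 * fst y) has_derivative (\<lambda>v. 2 * fst v)) (at (k0, 0))"
    "((\<lambda>y::real \<times> real. 1 + fst y * fst y) has_derivative (\<lambda>v. k0 * fst v + fst v * k0)) (at (k0, 0))"
    by (auto intro!: derivative_eq_intros)
  have dF: "((\<lambda>y. F (0, y)) has_derivative D) (at (k0, 0))"
  proof -
    have "((\<lambda>y. (2 * fst y * dg (0, 0, 0, snd y) (1, 0, 0, 0) + (1 + fst y * fst y) * dg (0, 0, 0, snd y) (0, 1, 0, 0),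
        (1 + fst y * fst y) * g (0, 0, 0, snd y))) has_derivative D) (at (k0, 0))"
      by (rule has_derivative_eq_rhs[OF has_derivative_Pair[OF
            has_derivative_add[OF has_derivative_mult[OF d1(1) dA] has_derivative_mult[OF d1(2) dB]]
            has_derivative_mult[OF d1(2) dC]]])
        (simp add: D_def fun_eq_iff dg_0_N[OF n] dg_0_C[OF c] g_0 dg_0_tau)
    then show ?thesis by (simp add: F_def Q0)
  qed
  have "inj D"
    unfolding linear_injective_0[OF has_derivative_linear[OF dF]]
  proof (intro allI impI)
    fix v assume "D v = 0"
    then have *: "2 * k0 * A (snd v) + 2 * fst v * n + ((1 + k0 * k0) * B (snd v) + (k0 * fst v + fst v * k0) * c) = 0"
      "(1 + k0 * k0) * (snd v / 2) = 0"
      by (simp_all only: D_def zero_prod_def prod.inject)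
    have "1 + k0 * k0 > 0" by (simp add: add_pos_nonneg)
    then have sv: "snd v = 0" using *(2) by simp
    have "2 * fst v * (n + k0 * c) = 0" using *(1) by (simp add: sv A0 algebra_simps)
    then have "fst v = 0" using k0(3) by simp
    then show "v = 0" using sv by (simp add: prod_eq_iff)
  qed
  from implicit_function[OF \<open>open V\<close> V0 F0 F dF this]
  obtain r y where r: "r > 0" "continuous_on (ball 0 r) y" "y 0 = (k0, 0)"
    "\<And>x. x \<in> ball 0 r \<Longrightarrow> (x, y x) \<in> V \<and> F (x, y x) = 0" by metis
  show ?thesis
  proof (rule that[OF k0(1) r(1-3)])
    fix a k \<tau> assume a: "\<bar>a\<bar> < r" "y a = (k, \<tau>)"
    then have "F (a, (k, \<tau>)) = 0" using r(4)[of a] by simp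
    then show "let q = (a * a + (a * k) * (a * k), 2 * a * (a * k), 0, \<tau>) in
       2 * k * dg q (1, 0, 0, 0) + (1 + k * k) * dg q (0, 1, 0, 0) = 0 \<and>
       (1 + k * k) * g q + a * a * ((1 - k * k) * (1 - k * k)) * dg q (1, 0, 0, 0) = 0"
      by (simp add: F_def Q_def zero_prod_def Let_def)
  qed
qed

text \<open>Points (a, a k) with real entries are fixed by S0 R0, which gives the symmetry under SR.
  The family with \<delta> < 0 is obtained by swapping the coordinates at the same \<tau>; on real
  points \<open>R0\<close> and \<open>S0\<close> coincide, so both involutions exchange the
  families.\<close>

lemma Liapunov_centre_families:
  assumes n: "((\<lambda>s. g (s, 0, 0, 0)) has_real_derivative n) (at 0)"
    and c: "((\<lambda>s. g (0, s, 0, 0)) has_real_derivative c) (at 0)" and nc: "n\<^sup>2 - c\<^sup>2 > 0"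
  shows "\<exists>\<epsilon>>0. \<exists>\<zeta>p \<tau>p Xp Tp \<zeta>m \<tau>m Xm Tm. let I = {0<..<\<epsilon>} in
        liapunov_centre_family f \<epsilon> Xp Tp \<and> liapunov_centre_family f \<epsilon> Xm Tm \<and>
        corresponds_on Psi U W h I \<zeta>p \<tau>p Xp Tp \<and> corresponds_on Psi U W h I \<zeta>m \<tau>m Xm Tm \<and>
        (\<forall>s\<in>I. invdelta (\<zeta>p s) > 0 \<and> reversing_symmetric (S \<circ> R) (Xp s)) \<and>
        (\<forall>s\<in>I. invdelta (\<zeta>m s) < 0 \<and> reversing_symmetric (S \<circ> R) (Xm s)) \<and>
        (Tp \<longlongrightarrow> 2 * pi) (at 0 within I) \<and> (Tm \<longlongrightarrow> 2 * pi) (at 0 within I) \<and>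
        exchanges R (orbits I Xp) (orbits I Xm) \<and> exchanges S (orbits I Xp) (orbits I Xm)"
proof -
  obtain k0 r y where k0: "\<bar>k0\<bar> < 1" and r: "r > 0" "continuous_on (ball 0 r) y" "y 0 = (k0, 0)"
    and eqs: "\<And>a k \<tau>. \<bar>a\<bar> < r \<Longrightarrow> y a = (k, \<tau>) \<Longrightarrow>
      (let q = (a * a + (a * k) * (a * k), 2 * a * (a * k), 0, \<tau>) in
       2 * k * dg q (1, 0, 0, 0) + (1 + k * k) * dg q (0, 1, 0, 0) = 0 \<and>
       (1 + k * k) * g q + a * a * ((1 - k * k) * (1 - k * k)) * dg q (1, 0, 0, 0) = 0)"
    using ray_equations[OF n c nc] by metis
  define k where "k a = fst (y a)" for a
  define \<tau> where "\<tau> a = snd (y a)" for a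
  define \<zeta> :: "real \<Rightarrow> c2" where "\<zeta> a = (of_real a, of_real (a * k a))" for a
  have ck: "continuous_on (ball 0 r) k" and c\<tau>: "continuous_on (ball 0 r) \<tau>"
    unfolding k_def[abs_def] \<tau>_def[abs_def] by (intro continuous_intros r)+
  have c\<zeta>: "continuous_on (ball 0 r) \<zeta>"
    unfolding \<zeta>_def[abs_def] by (intro continuous_intros ck)
  have at0: "(F \<longlongrightarrow> F 0) (at 0)" if "continuous_on (ball 0 r) F" for F :: "real \<Rightarrow> 'z::topological_space"
    using that r(1) by (simp add: continuous_on_eq_continuous_at isCont_def)
  have lk: "(k \<longlongrightarrow> k0) (at 0)" using at0[OF ck] by (simp add: k_def r(3))
  have l\<tau>: "(\<tau> \<longlongrightarrow> 0) (at 0)" using at0[OF c\<tau>] by (simp add: \<tau>_def r(3))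
  have l\<zeta>: "(\<zeta> \<longlongrightarrow> 0) (at 0)" using at0[OF c\<zeta>] by (simp add: \<zeta>_def zero_prod_def)
  obtain d where d: "d > 0" "d \<le> 1 / 2" "\<And>z \<tau>. norm z < d \<Longrightarrow> \<bar>\<tau>\<bar> < d \<Longrightarrow> (z, \<tau>) \<in> U"
    using small_parameters by blast
  \<comment> \<open>This radius keeps |k a| below 1, and therefore \<delta> away from 0 along the
    ray.\<close>
  have "eventually (\<lambda>a. dist (k a) k0 < 1 - \<bar>k0\<bar>) (at 0)"
    by (rule tendstoD[OF lk]) (use k0 in simp)
  moreover have "eventually (\<lambda>a. dist (\<tau> a) 0 < d) (at 0)" by (rule tendstoD[OF l\<tau> d(1)])
  moreover have "eventually (\<lambda>a. dist (\<zeta> a) 0 < d) (at 0)" by (rule tendstoD[OF l\<zeta> d(1)])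
  ultimately have "eventually (\<lambda>a. \<bar>k a\<bar> < 1 \<and> \<bar>\<tau> a\<bar> < d \<and> norm (\<zeta> a) < d) (at 0)"
    by eventually_elim (auto simp: dist_real_def)
  then obtain \<epsilon>0 where \<epsilon>0: "\<epsilon>0 > 0"
    "\<And>a. a \<noteq> 0 \<Longrightarrow> dist a 0 < \<epsilon>0 \<Longrightarrow> \<bar>k a\<bar> < 1 \<and> \<bar>\<tau> a\<bar> < d \<and> norm (\<zeta> a) < d"
    unfolding eventually_at by blast
  define \<epsilon> where "\<epsilon> = min \<epsilon>0 r"
  define I where "I = {0<..<\<epsilon>}"
  have \<epsilon>: "\<epsilon> > 0" using \<epsilon>0(1) r(1) by (simp add: \<epsilon>_def)
  have I: "a > 0" "\<bar>a\<bar> < r" "\<bar>k a\<bar> < 1" "\<bar>\<tau> a\<bar> < d" "norm (\<zeta> a) < d" if "a \<in> I" for a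
    using that \<epsilon>0(2)[of a] by (auto simp: I_def \<epsilon>_def)
  have sub: "I \<subseteq> ball 0 r" by (auto simp: I_def \<epsilon>_def)
  have inU: "(\<zeta> a, \<tau> a) \<in> U" "(R0 (\<zeta> a), \<tau> a) \<in> U" if "a \<in> I" for a
    using I[OF that] by (auto intro!: d(3))
  have pos: "1 + \<tau> a > 0" if "a \<in> I" for a
    using I(4)[OF that] d(2) by (simp add: abs_less_iff)
  have SR: "S0 (\<zeta> a) = R0 (\<zeta> a)" "S0 (R0 (\<zeta> a)) = \<zeta> a" "R0 (R0 z) = z" for a z
    by (simp_all add: S0_def R0_def \<zeta>_def)
  have nz: "\<zeta> a \<noteq> 0" "R0 (\<zeta> a) \<noteq> 0" if "a \<in> I" for a
    using I(1)[OF that] by (auto simp: \<zeta>_def R0_def prod_eq_iff)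
  have ray: "let q = (a * a + (a * k a) * (a * k a), 2 * a * (a * k a), 0, \<tau> a);
      \<delta> = a * a - (a * k a) * (a * k a) in
      \<delta> * (a * dg q (1, 0, 0, 0) + a * k a * dg q (0, 1, 0, 0)) + a * g q = 0 \<and>
      \<delta> * (a * k a * dg q (1, 0, 0, 0) + a * dg q (0, 1, 0, 0)) - a * k a * g q = 0" if "a \<in> I" for a
    using eqs[OF I(2)[OF that], of "k a" "\<tau> a"] critical_ray unfolding Let_def
    by (simp add: k_def \<tau>_def)
  have crit: "grad (\<lambda>z. h z (\<tau> a)) (\<zeta> a) = 0" "grad (\<lambda>z. h z (\<tau> a)) (R0 (\<zeta> a)) = 0" if a: "a \<in> I" for a
  proof -
    note e = ray[OF a, unfolded Let_def]
    show "grad (\<lambda>z. h z (\<tau> a)) (\<zeta> a) = 0"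
      unfolding \<zeta>_def
      by (rule grad_0_real) (use inU(1)[OF a] e in \<open>simp_all add: \<zeta>_def\<close>)
    \<comment> \<open>Swapping x and y leaves N and C unchanged and reverses \<delta>, so the two
      critical equations trade places up to sign.\<close>
    have neg: "X + Y = 0 \<Longrightarrow> - X - Y = 0" "X - Y = 0 \<Longrightarrow> - X + Y = 0" for X Y :: real by simp_all
    have sw: "(a * k a) * (a * k a) + a * a = a * a + (a * k a) * (a * k a)"
      "2 * (a * k a) * a = 2 * a * (a * k a)"
      "(a * k a) * (a * k a) - a * a = - (a * a - (a * k a) * (a * k a))" by simp_all
    have "grad (\<lambda>z. h z (\<tau> a)) (of_real (a * k a), of_real a) = 0"
    proof (rule grad_0_real)
      show "((of_real (a * k a), of_real a), \<tau> a) \<in> U" using inU(2)[OF a] by (simp add: \<zeta>_def R0_def)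
    qed (unfold sw mult_minus_left, rule neg(2)[OF conjunct2[OF e]], rule neg(1)[OF conjunct1[OF e]])
    then show "grad (\<lambda>z. h z (\<tau> a)) (R0 (\<zeta> a)) = 0" by (simp add: \<zeta>_def R0_def)
  qed
  \<comment> \<open>|z1| = a on the first family is invariant under rotation; for the swapped family
    |z2| takes this part.\<close>
  have inj: "a = b" if "a \<in> I" "b \<in> I" "cmod (fst (\<zeta> b)) = cmod (fst (\<zeta> a))" for a b
    using that I(1)[OF that(1)] I(1)[OF that(2)] by (simp add: \<zeta>_def)
  have injp: "a = b" if "a \<in> I" "b \<in> I" "\<zeta> b = rot \<theta> (\<zeta> a)" for a b \<theta>
    by (rule inj[OF that(1,2)]) (use that(3) in \<open>simp add: rot_def norm_mult\<close>)
  have injm: "a = b" if "a \<in> I" "b \<in> I" "R0 (\<zeta> b) = rot \<theta> (R0 (\<zeta> a))" for a b \<theta>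
  proof (rule inj[OF that(1,2)])
    have "cmod (snd (R0 (\<zeta> b))) = cmod (snd (R0 (\<zeta> a)))" unfolding that(3) by (simp add: rot_def norm_mult)
    then show "cmod (fst (\<zeta> b)) = cmod (fst (\<zeta> a))" by (simp add: R0_def)
  qed
  define Xp where "Xp = (\<lambda>a. lifted Psi W (\<zeta> a) (\<tau> a))"
  define Xm where "Xm = (\<lambda>a. lifted Psi W (R0 (\<zeta> a)) (\<tau> a))"
  define T where "T = (\<lambda>a. 2 * pi / (1 + \<tau> a))"
  have ctI: "continuous_on I \<zeta>" "continuous_on I \<tau>"
    using c\<zeta> c\<tau> sub by (auto intro: continuous_on_subset)
  have cmI: "continuous_on I (\<lambda>a. R0 (\<zeta> a))"
    unfolding R0_def by (intro continuous_intros ctI)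
  have lI: "(\<zeta> \<longlongrightarrow> 0) (at 0 within I)" "(\<tau> \<longlongrightarrow> 0) (at 0 within I)"
    using l\<zeta> l\<tau> by (auto intro: tendsto_within_subset)
  have lmI: "((\<lambda>a. R0 (\<zeta> a)) \<longlongrightarrow> 0) (at 0 within I)"
    using tendsto_Pair[OF tendsto_snd[OF lI(1)] tendsto_fst[OF lI(1)]] by (simp add: R0_def zero_prod_def)
  have famp: "orbit_family f I Xp T" "emanates_from_0 I Xp" "(T \<longlongrightarrow> 2 * pi) (at 0 within I)"
    "corresponds_on Psi U W h I \<zeta> \<tau> Xp T"
    by (rule periodic_orbit_family[OF ctI inU(1) pos crit(1) nz(1) lI injp Xp_def T_def]; assumption)+
  have famm: "orbit_family f I Xm T" "emanates_from_0 I Xm"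
    "corresponds_on Psi U W h I (\<lambda>a. R0 (\<zeta> a)) \<tau> Xm T"
    by (rule periodic_orbit_family[OF cmI ctI(2) inU(2) pos crit(2) nz(2) lmI lI(2) injm Xm_def T_def]; assumption)+
  have lp: "liapunov_centre_family f \<epsilon> Xp T" and lm: "liapunov_centre_family f \<epsilon> Xm T"
    using \<epsilon> famp(1,2) famm(1,2) unfolding liapunov_centre_family_def I_def by simp_all
  have \<delta>: "invdelta (\<zeta> a) > 0" "invdelta (R0 (\<zeta> a)) < 0" if "a \<in> I" for a
  proof -
    have "k a * k a < 1" using I(3)[OF that] abs_square_less_1[of "k a"] by (simp add: power2_eq_square)
    then have "a * a * (1 - k a * k a) > 0" using I(1)[OF that] by simp
    moreover have "invdelta (\<zeta> a) = a * a * (1 - k a * k a)" "invdelta (R0 (\<zeta> a)) = - (a * a * (1 - k a * k a))"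
      by (simp_all add: invdelta_eq \<zeta>_def R0_def inner_complex_def algebra_simps)
    ultimately show "invdelta (\<zeta> a) > 0" "invdelta (R0 (\<zeta> a)) < 0" by simp_all
  qed
  have symp: "\<forall>a\<in>I. invdelta (\<zeta> a) > 0 \<and> reversing_symmetric (S \<circ> R) (Xp a)"
  proof
    fix a assume a: "a \<in> I"
    show "invdelta (\<zeta> a) > 0 \<and> reversing_symmetric (S \<circ> R) (Xp a)"
      unfolding Xp_def by (rule conjI[OF \<delta>(1)[OF a] reversing_symmetric_SR[OF inU[OF a] SR(2)]])
  qed
  have symm: "\<forall>a\<in>I. invdelta (R0 (\<zeta> a)) < 0 \<and> reversing_symmetric (S \<circ> R) (Xm a)"
  proof
    fix a assume a: "a \<in> I"
    have "reversing_symmetric (S \<circ> R) (Xm a)"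
      unfolding Xm_def by (rule reversing_symmetric_SR) (use inU[OF a] SR in simp_all)
    then show "invdelta (R0 (\<zeta> a)) < 0 \<and> reversing_symmetric (S \<circ> R) (Xm a)"
      using \<delta>(2)[OF a] by (rule conjI[rotated])
  qed
  have exR: "exchanges R (orbits I Xp) (orbits I Xm)"
  proof (rule exchanges_orbits)
    fix a assume a: "a \<in> I"
    show "R ` range (Xp a) = range (Xm a)"
      unfolding Xp_def Xm_def by (rule image_R_lifted[OF inU[OF a]])
    show "R ` range (Xm a) = range (Xp a)"
      using image_R_lifted[OF inU(2)[OF a]] inU(1)[OF a] by (simp add: SR Xp_def Xm_def)
  qed
  have exS: "exchanges S (orbits I Xp) (orbits I Xm)"
  proof (rule exchanges_orbits)
    fix a assume a: "a \<in> I"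
    show "S ` range (Xp a) = range (Xm a)"
      using image_S_lifted[OF inU(1)[OF a]] inU(2)[OF a] by (simp add: SR Xp_def Xm_def)
    show "S ` range (Xm a) = range (Xp a)"
      using image_S_lifted[OF inU(2)[OF a]] inU(1)[OF a] by (simp add: SR Xp_def Xm_def)
  qed
  show ?thesis
    unfolding Let_def
    by (rule exI, rule conjI[OF \<epsilon>], (rule exI)+,
        rule conjI[OF lp conjI[OF lm conjI[OF famp(4) conjI[OF famm(3) conjI[OF symp conjI[OF symm
          conjI[OF famp(3) conjI[OF famp(3) conjI[OF exR exS]]]]]]]], unfolded I_def])
qed

end

section \<open>The normal form data of a Hamiltonian system\<close>

lemma ck_on_1_sum:
  "(\<And>i. i \<in> A \<Longrightarrow> ck_on (Suc 0) (F i) U) \<Longrightarrow> ck_on (Suc 0) (\<lambda>x. \<Sum>i\<in>A. F i x) U"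
  by (induction A rule: infinite_finite_induct) (simp_all add: ck_on_1_const ck_on_1_add del: ck_on.simps)

lemma ck_on_1_grad:
  assumes "ck_on (Suc (Suc 0)) H UNIV"
  shows "ck_on (Suc 0) (grad H) UNIV" "H differentiable (at x)"
proof -
  have d: "H differentiable (at x)" and c: "ck_on (Suc 0) (\<lambda>x. frechet_derivative H (at x) v) UNIV" for x v
    using assms unfolding ck_on.simps(2)[of "Suc 0"] by blast+
  show "H differentiable (at x)" by (rule d)
  have "ck_on (Suc 0) (\<lambda>x. frechet_derivative H (at x) b *\<^sub>R b) UNIV" for b
    by (rule ck_on_1_compose[OF ck_on_1_linear[of "\<lambda>r. r *\<^sub>R b" UNIV] c])
      (simp_all add: linear_scale_left)
  then have "ck_on (Suc 0) (\<lambda>x. \<Sum>b\<in>Basis. frechet_derivative H (at x) b *\<^sub>R b) UNIV"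
    by (rule ck_on_1_sum)
  moreover have "grad H = (\<lambda>x. \<Sum>b\<in>Basis. frechet_derivative H (at x) b *\<^sub>R b)"
    by (rule ext) (rule has_derivative_grad(2)[OF d])
  ultimately show "ck_on (Suc 0) (grad H) UNIV" by simp
qed

text \<open>J L = J J D^2 H(0) is minus the Hessian, hence symmetric: \<open>L\<close> is
  infinitesimally symplectic.\<close>

lemma hamiltonian_linearization:
  fixes J L :: "'a::euclidean_space \<Rightarrow> 'a" and H :: "'a \<Rightarrow> real"
  assumes J: "linear J" "\<And>x. J (J x) = - x"
    and H: "\<And>x. H differentiable (at x)"
    and L: "((\<lambda>x. J (grad H x)) has_derivative L) (at 0)"
  shows "J (L x) \<bullet> y = J (L y) \<bullet> x"
proof -
  have "((\<lambda>x. - J (J (grad H x))) has_derivative (\<lambda>v. - J (L v))) (at 0)"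
    by (intro has_derivative_minus bounded_linear.has_derivative[OF J(1)[unfolded linear_conv_bounded_linear]] L)
  then have "(grad H has_derivative (\<lambda>v. - J (L v))) (at 0)"
    by (simp add: J(2))
  from hessian_symmetric[OF has_derivative_grad(1)[OF H] this, of x y] show ?thesis by simp
qed

text \<open>Since - J0 inverts J0, \<open>proj\<close> is the adjoint of \<open>Psi\<close> with
  respect to the two symplectic forms. It is a left inverse because \<open>Psi\<close> preserves the
  forms, and it intertwines \<open>L\<close> and \<open>L0\<close> because each is skew for its
  form.\<close>

lemma symplectic_projection:
  fixes J L :: "'a::euclidean_space \<Rightarrow> 'a" and Psi :: "c2 \<Rightarrow> 'a"
  assumes J: "linear J" "\<And>x y. J x \<bullet> y = - (x \<bullet> J y)"
    and L: "linear L" "\<And>x y. J (L x) \<bullet> y = J (L y) \<bullet> x"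
    and Psi: "linear Psi" "\<And>z w. Psi z \<bullet> J (Psi w) = z \<bullet> J0 w" "\<And>z. L (Psi z) = Psi (L0 z)"
  defines "proj \<equiv> \<lambda>x. - J0 (adjoint Psi (J x))"
  shows "linear proj" "proj (Psi z) = z" "proj (L x) = L0 (proj x)"
proof -
  have adj: "z \<bullet> adjoint Psi y = Psi z \<bullet> y" for z y
    by (rule adjoint_works[OF Psi(1)])
  have ladj: "linear (adjoint Psi)" by (rule adjoint_linear[OF Psi(1)])
  show "linear proj"
    unfolding proj_def
    by (rule linearI) (simp_all add: linear_add[OF J(1)] linear_scale[OF J(1)] linear_add[OF ladj]
        linear_scale[OF ladj] linear_add[OF linear_J0] linear_scale[OF linear_J0])
  have "adjoint Psi (J (Psi z)) = J0 z"
  proof -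
    have "w \<bullet> adjoint Psi (J (Psi z)) = w \<bullet> J0 z" for w by (simp add: adj Psi(2))
    then show ?thesis by (metis vector_eq_ldot)
  qed
  then show "proj (Psi z) = z" by (simp add: proj_def)
  have L0_skew: "L0 z \<bullet> w = - (z \<bullet> L0 w)" for z w
    by (simp add: L0_def inner_prod_def inner_complex_def)
  have "z \<bullet> adjoint Psi (J (L x)) = z \<bullet> L0 (adjoint Psi (J x))" for z
  proof -
    have "z \<bullet> adjoint Psi (J (L x)) = J (L x) \<bullet> Psi z" by (simp add: adj inner_commute)
    also have "\<dots> = J (Psi (L0 z)) \<bullet> x" using L(2)[of x "Psi z"] by (simp add: Psi(3))
    also have "\<dots> = - (L0 z \<bullet> adjoint Psi (J x))" by (simp add: J(2) adj)
    also have "\<dots> = z \<bullet> L0 (adjoint Psi (J x))" by (simp add: L0_skew)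
    finally show ?thesis .
  qed
  then have "adjoint Psi (J (L x)) = L0 (adjoint Psi (J x))" by (metis vector_eq_ldot)
  then show "proj (L x) = L0 (proj x)"
    by (simp add: proj_def linear_neg[OF linear_L0]) (simp add: J0_def L0_def)
qed

theorem theorem7p1:
  fixes J R S f L :: "'a::euclidean_space \<Rightarrow> 'a"
    and H :: "'a \<Rightarrow> real"
    and Psi :: "c2 \<Rightarrow> 'a"
    and ip :: "(real \<Rightarrow> 'a) \<Rightarrow> (real \<Rightarrow> 'a) \<Rightarrow> real"
    and U :: "(c2 \<times> real) set"
    and W :: "c2 \<Rightarrow> real \<Rightarrow> real \<Rightarrow> 'a"
    and h :: "c2 \<Rightarrow> real \<Rightarrow> real"
    and g :: "real \<times> real \<times> real \<times> real \<Rightarrow> real"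
    and G :: "(real \<times> real \<times> real \<times> real) set"
    and n c :: real
  assumes J: "linear J" "\<And>x y. J x \<bullet> y = - (x \<bullet> J y)" "\<And>x. J (J x) = - x"
    and H: "smooth_on H UNIV" "H 0 = 0"
    and f: "\<And>x. f x = J (grad H x)"
    and equilibrium: "f 0 = 0"
    and R: "orthogonal_transformation R" "R \<circ> R = id"
      "\<And>x y. R x \<bullet> J (R y) = x \<bullet> J y" "\<And>x. f (R x) = - R (f x)"
    and S: "orthogonal_transformation S" "S \<circ> S = id"
      "\<And>x y. S x \<bullet> J (S y) = - (x \<bullet> J y)" "\<And>x. f (S x) = S (f x)"
    and commute: "R \<circ> S = S \<circ> R"
    and L: "L = frechet_derivative f (at 0)"
    and eigenvalues: "alg_mult L \<i> = 2" "alg_mult L (- \<i>) = 2"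
      "\<And>k::int. eigenvalue_of L (of_int k * \<i>) \<Longrightarrow> k = 1 \<or> k = -1"
    and coordinates: "normal_form_coordinates J L R S Psi"
    and ip: "invariant_inner R S ip" "loop_orth ip (range_Phi L) = range (lin_loop Psi)"
    and W: "implicit_solution f L ip Psi U W"
    and h: "reduced_hamiltonian f L ip Psi U W h"
    and g: "open G" "0 \<in> G" "smooth_on g G"
      "\<And>z \<tau>. (z, \<tau>) \<in> U \<Longrightarrow> (invN z, invC z, (invD z)\<^sup>2, \<tau>) \<in> G"
      "\<And>z \<tau>. (z, \<tau>) \<in> U \<Longrightarrow>
         h z \<tau> = invdelta z * g (invN z, invC z, (invD z)\<^sup>2, \<tau>)"
    and n: "((\<lambda>s. g (s, 0, 0, 0)) has_real_derivative n) (at 0)"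
    and c: "((\<lambda>s. g (0, s, 0, 0)) has_real_derivative c) (at 0)"
  shows
    "(\<exists>\<rho>>0. \<exists>(\<zeta> :: real \<times> real \<Rightarrow> c2) \<tau> X T. let P = ball 0 \<rho> - {0} in
        orbit_family f P X T \<and> emanates_from_0 P X \<and>
        corresponds_on Psi U W h P \<zeta> \<tau> X T \<and>
        (\<forall>p\<in>P. invdelta (\<zeta> p) = 0 \<and> reversing_symmetric R (X p)) \<and>
        (\<exists>\<epsilon> \<gamma>1 \<gamma>2.
           liapunov_centre_family f \<epsilon> (X \<circ> \<gamma>1) (T \<circ> \<gamma>1) \<and>
           liapunov_centre_family f \<epsilon> (X \<circ> \<gamma>2) (T \<circ> \<gamma>2) \<and>
           \<gamma>1 ` {0<..<\<epsilon>} \<inter> \<gamma>2 ` {0<..<\<epsilon>} = {} \<and>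
           \<gamma>1 ` {0<..<\<epsilon>} \<union> \<gamma>2 ` {0<..<\<epsilon>} = {p \<in> P. equivariant_symmetric S (X p)}) \<and>
        (T \<longlongrightarrow> 2 * pi) (at 0 within P))
     \<and>
     (n\<^sup>2 - c\<^sup>2 > 0 \<longrightarrow>
      (\<exists>\<epsilon>>0. \<exists>\<zeta>p \<tau>p Xp Tp \<zeta>m \<tau>m Xm Tm. let I = {0<..<\<epsilon>} in
        liapunov_centre_family f \<epsilon> Xp Tp \<and> liapunov_centre_family f \<epsilon> Xm Tm \<and>
        corresponds_on Psi U W h I \<zeta>p \<tau>p Xp Tp \<and> corresponds_on Psi U W h I \<zeta>m \<tau>m Xm Tm \<and>
        (\<forall>s\<in>I. invdelta (\<zeta>p s) > 0 \<and> reversing_symmetric (S \<circ> R) (Xp s)) \<and>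
        (\<forall>s\<in>I. invdelta (\<zeta>m s) < 0 \<and> reversing_symmetric (S \<circ> R) (Xm s)) \<and>
        (Tp \<longlongrightarrow> 2 * pi) (at 0 within I) \<and> (Tm \<longlongrightarrow> 2 * pi) (at 0 within I) \<and>
        exchanges R (orbits I Xp) (orbits I Xm) \<and> exchanges S (orbits I Xp) (orbits I Xm)))"
proof -
  have H2: "ck_on (Suc (Suc 0)) H UNIV" using H(1) by (simp only: smooth_on_def)
  have fJ: "f = (\<lambda>x. J (grad H x))" by (rule ext) (rule f)
  have f1: "ck_on (Suc 0) f UNIV"
    unfolding fJ by (rule ck_on_1_compose[OF ck_on_1_linear[OF J(1)] ck_on_1_grad(1)[OF H2] UNIV_I])
  have fL: "(f has_derivative L) (at 0)"
    unfolding L by (rule ck_on_1D(1)[OF f1 UNIV_I])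
  then have linL: "linear L" by (rule has_derivative_linear)
  have JL: "J (L x) \<bullet> y = J (L y) \<bullet> x" for x y
    by (rule hamiltonian_linearization[OF J(1,3) ck_on_1_grad(2)[OF H2] fL[unfolded fJ]])
  have co: "linear Psi" "\<And>z w. Psi z \<bullet> J (Psi w) = z \<bullet> J0 w" "\<And>z. L (Psi z) = Psi (L0 z)"
    "\<And>z. R (Psi z) = Psi (R0 z)" "\<And>z. S (Psi z) = Psi (S0 z)"
    using coordinates unfolding normal_form_coordinates_def by blast+
  define proj where "proj x = - J0 (adjoint Psi (J x))" for x
  have pr: "linear proj" "\<And>z. proj (Psi z) = z" "\<And>x. proj (L x) = L0 (proj x)"
    unfolding proj_def[abs_def] by (rule symplectic_projection[OF J(1,2) linL JL co(1-3)])+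
  have g2: "ck_on (Suc (Suc 0)) g G" using g(3) by (simp only: smooth_on_def)
  interpret reduced_normal_form L Psi proj f R S ip U W h g G
    by unfold_locales
      (fact co pr eigenvalues f1 fL equilibrium R S ip W h g g2 linear_add[OF linL] linear_scale[OF linL]
        linear_add[OF co(1)] linear_scale[OF co(1)] linear_add[OF pr(1)] linear_scale[OF pr(1)])+
  show ?thesis
    using R_symmetric_family Liapunov_centre_families[OF n c] by (intro conjI impI)
qed

end
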